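(* Let $N\ge 1$, $m\geq 2$, let $T_1,\dots,T_m$ be non-singular linear contractions on $\mathbb{R}^N$, and let $\mu$ be a shift-invariant Gibbs measure on $I_\infty=\{1,\dots,m\}^{\mathbb{N}}$. Let $\Omega$ be a space of families $\omega=\{\omega_{\mathbf{i}}:\mathbf{i}\in I\}$ of translation vectors in $\mathbb{R}^N$ such that, for some non-empty compact set $B\subset\mathbb{R}^N$, $T_{i_k}(B)+\omega_{i_1,\dots,i_k}\subseteq B$ for all $k\ge1$, all $(i_1,\dots,i_k)\in I_k$ and all $\omega\in\Omega$; let $\mathsf{P}$ be a probability measure on $\Omega$ such that the random vectors $\omega_{\mathbf{i}}$ are jointly measurable, and let $\mathsf{E}$ denote expectation with respect to $\mathsf{P}$. Let $\mu^\omega$ be the projection of $\mu$ onto the almost self-affine set $E^\omega$. Suppose that there are numbers $0\le s<\min\{d_1,N\}$ arbitrarily close to $\min\{d_1,N\}$ for which there exists $c<\infty$ such that $$\mathsf{E}\left(|x^\omega(\mathbf{i})-x^\omega(\mathbf{j})|^{-s}\right)\le\frac{c}{\phi^s(T_{\mathbf{i}\wedge\mathbf{j}})}\qquad(\mathbf{i}\ne\mathbf{j}\in I_\infty).$$ Then, for $\mathsf{P}$-almost all $\omega$, $$\min\{d_1,N\}\le\lim_{r\to0}\frac{\log\mu^\omega(B(x,r))}{\log r}\le\min\Big\{\lim_{q\nearrow1}d_q,\,N\Big\}$$ for $\mu^\omega$-almost all $x$.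
   Context: A linear contraction is a linear map of Euclidean operator norm less than $1$. $B(x,r)$ is the closed ball with centre $x$ and radius $r$. Code space: $I_k=\{1,\dots,m\}^k$, $I=\bigcup_{k\ge0}I_k$, $I_\infty=\{1,\dots,m\}^{\mathbb{N}}$; for $\mathbf{i}\in I$, $|\mathbf{i}|$ is its length and $C_{\mathbf{i}}\subset I_\infty$ is the cylinder of all infinite sequences beginning with $\mathbf{i}$; $\mathbf{i}|k$ is the initial segment of length $k$ of $\mathbf{i}\in I_\infty$. For $\mathbf{i}\neq\mathbf{j}\in I_\infty$, $\mathbf{i}\wedge\mathbf{j}\in I$ is their maximal common initial subsequence. $\sigma$ is the shift $\sigma(i_1,i_2,\dots)=(i_2,i_3,\dots)$. For $\mathbf{i}=(i_1,\dots,i_k)\in I$ write $T_{\mathbf{i}}=T_{i_1}\cdots T_{i_k}$ ($T_\emptyset$ is the identity, and $\phi^s(T_\emptyset)=1$). $I_\infty$ has the metric $d(\mathbf{i},\mathbf{j})=2^{-|\mathbf{i}\wedge\mathbf{j}|}$ for distinct $\mathbf{i},\mathbf{j}$. Gibbs measure: a Borel probability measure $\mu$ on $I_\infty$ for which there are a continuous $f:I_\infty\to\mathbb{R}$, a real number $P(f)$ and $a>0$ with $$a^{-1}\le\frac{\mu(C_{\mathbf{i}|k})}{\exp\big(-kP(f)+\sum_{j=0}^{k-1}f(\sigma^j(\mathbf{i}))\big)}\le a\qquad(\mathbf{i}\in I_\infty,\ k\in\mathbb{Z}^+).$$ Almost self-affine sets and measures: for $\omega\in\Omega$ and $\mathbf{i}=(i_1,i_2,\dots)\in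 I_\infty$ let $$x^\omega(\mathbf{i})=\omega_{i_1}+T_{i_1}\omega_{i_1,i_2}+T_{i_1}T_{i_2}\omega_{i_1,i_2,i_3}+\cdots.$$ Then $E^\omega=\{x^\omega(\mathbf{i}):\mathbf{i}\in I_\infty\}$, a compact set, and $\mu^\omega(A)=\mu\{\mathbf{i}:x^\omega(\mathbf{i})\in A\}$ for $A\subseteq\mathbb{R}^N$. Singular value function: for a non-singular linear contraction $T$ with singular values $1>\alpha_1\ge\cdots\ge\alpha_N>0$ and $0<s\le N$, $\phi^s(T)=\alpha_1\cdots\alpha_{l-1}\alpha_l^{\,s-l+1}$ where $l$ is the integer with $l-1<s\le l$; $\phi^0(T)=1$; and $\phi^s(T)=(\alpha_1\cdots\alpha_N)^{s/N}$ for $s\ge N$. Pressure: for $s\ge0$ and $q\ge0$, $q\ne1$, $$P(s,q)=\lim_{k\to\infty}\frac1k\,\frac{\log\sum_{|\mathbf{i}|=k}\phi^s(T_{\mathbf{i}})^{1-q}\mu(C_{\mathbf{i}})^q}{q-1},\qquad P(s,1)=\lim_{k\to\infty}\frac1k\sum_{|\mathbf{i}|=k}\mu(C_{\mathbf{i}})\log\big(\phi^s(T_{\mathbf{i}})^{-1}\mu(C_{\mathbf{i}})\big).$$ These limits exist; for each $q\ge0$, $P(\cdot,q)$ is continuous and strictly increasing in $s$, and $d_q>0$ is the unique number with $P(d_q,q)=0$. $d_q$ is non-increasing in $q$, so $\lim_{q\nearrow1}d_q$ exists. *)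

theory Defs
  imports "HOL-Probability.Probability"
begin

section \<open>Code space\<close>

text \<open>The alphabet is a finite type \<open>'m\<close>; words are lists over it, and infinite sequences are
  functions \<open>nat \<Rightarrow> 'm\<close> indexed from 0, so the first letter of \<open>x\<close> is \<open>x 0\<close>.\<close>

definition initial :: "(nat \<Rightarrow> 'm) \<Rightarrow> nat \<Rightarrow> 'm list" where
  "initial x k = map x [0..<k]"

definition cylinder :: "'m list \<Rightarrow> (nat \<Rightarrow> 'm) set" where
  "cylinder w = {x. initial x (length w) = w}"

definition shift :: "(nat \<Rightarrow> 'm) \<Rightarrow> nat \<Rightarrow> 'm" where
  "shift x = (\<lambda>n. x (Suc n))"

text \<open>Only meaningful for distinct sequences.\<close>

definition meet :: "(nat \<Rightarrow> 'm) \<Rightarrow> (nat \<Rightarrow> 'm) \<Rightarrow> 'm list" where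
  "meet x y = initial x (LEAST n. x n \<noteq> y n)"

definition code_dist :: "(nat \<Rightarrow> 'm) \<Rightarrow> (nat \<Rightarrow> 'm) \<Rightarrow> real" where
  "code_dist x y = (if x = y then 0 else (1/2) ^ length (meet x y))"

lemma code_dist_less_iff: "code_dist x y < (1/2) ^ n \<longleftrightarrow> (\<forall>k\<le>n. x k = y k)"
proof (cases "x = y")
  case True
  then show ?thesis by (simp add: code_dist_def)
next
  case False
  then obtain l where "x l \<noteq> y l" by auto
  then have L: "x (LEAST n. x n \<noteq> y n) \<noteq> y (LEAST n. x n \<noteq> y n)"
    by (rule LeastI[where P = "\<lambda>n. x n \<noteq> y n"])
  have "code_dist x y < (1/2) ^ n \<longleftrightarrow> n < (LEAST n. x n \<noteq> y n)"
    using False by (simp add: code_dist_def meet_def initial_def)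
  also have "\<dots> \<longleftrightarrow> (\<forall>k\<le>n. x k = y k)"
  proof
    assume n: "n < (LEAST n. x n \<noteq> y n)"
    show "\<forall>k\<le>n. x k = y k"
      using n not_less_Least[where P = "\<lambda>n. x n \<noteq> y n"] by (meson le_less_trans)
  next
    assume "\<forall>k\<le>n. x k = y k"
    with L show "n < (LEAST n. x n \<noteq> y n)" using not_le_imp_less by blast
  qed
  finally show ?thesis .
qed

lemma Metric_space_code_dist: "Metric_space UNIV code_dist"
proof
  fix x y z :: "nat \<Rightarrow> 'a"
  show "0 \<le> code_dist x y" by (simp add: code_dist_def)
  show "code_dist x y = code_dist y x"
    by (simp add: code_dist_def meet_def initial_def eq_commute[of "x _"])
  show "code_dist x y = 0 \<longleftrightarrow> x = y" by (simp add: code_dist_def)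
  show "code_dist x z \<le> code_dist x y + code_dist y z"
  proof (cases "x = z \<or> x = y \<or> y = z")
    case True
    then show ?thesis by (auto simp: code_dist_def)
  next
    case False
    have "max (code_dist x y) (code_dist y z) \<ge> code_dist x z"
    proof (rule ccontr)
      assume "\<not> ?thesis"
      then have less: "code_dist x y < code_dist x z" "code_dist y z < code_dist x z" by auto
      have eq: "code_dist x z = (1/2) ^ length (meet x z)"
        using False by (simp add: code_dist_def)
      have "code_dist x z < (1/2) ^ length (meet x z)"
        using less[unfolded eq code_dist_less_iff] by (subst code_dist_less_iff) metis
      then show False using eq by simp
    qed
    moreover have "0 \<le> code_dist x y" "0 \<le> code_dist y z" by (simp_all add: code_dist_def)
    ultimately show ?thesis by linarith
  qed
qed

definition code_topology :: "(nat \<Rightarrow> 'm) topology" where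
  "code_topology = Metric_space.mtopology UNIV code_dist"

definition code_borel :: "(nat \<Rightarrow> 'm) measure" where
  "code_borel = sigma UNIV {U. openin code_topology U}"

section \<open>Shift-invariant Gibbs measures\<close>

definition gibbs_measure :: "(nat \<Rightarrow> 'm) measure \<Rightarrow> bool" where
  "gibbs_measure \<mu> \<longleftrightarrow> prob_space \<mu> \<and> sets \<mu> = sets code_borel \<and>
     (\<exists>f Pf a. continuous_map code_topology euclideanreal f \<and> a > 0 \<and>
        (\<forall>x k. 1 \<le> k \<longrightarrow>
           (let R = measure \<mu> (cylinder (initial x k)) /
                    exp (- real k * Pf + (\<Sum>j<k. f ((shift ^^ j) x)))
            in inverse a \<le> R \<and> R \<le> a)))"

definition shift_invariant :: "(nat \<Rightarrow> 'm) measure \<Rightarrow> bool" where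
  "shift_invariant \<mu> \<longleftrightarrow>
     (\<forall>A\<in>sets \<mu>. shift -` A \<in> sets \<mu> \<and> emeasure \<mu> (shift -` A) = emeasure \<mu> A)"

section \<open>Singular value function\<close>

definition nonsingular_contraction :: "('a::euclidean_space \<Rightarrow> 'a) \<Rightarrow> bool" where
  "nonsingular_contraction T \<longleftrightarrow> linear T \<and> onorm T < 1 \<and> bij T"

text \<open>The non-negative square roots of the eigenvalues of \<open>T\<^sup>*T\<close>, in decreasing order and each
  repeated according to the dimension of its eigenspace.\<close>

definition gram_eigenspace :: "('a::euclidean_space \<Rightarrow> 'a) \<Rightarrow> real \<Rightarrow> 'a set" where
  "gram_eigenspace T c = {v. adjoint T (T v) = c *\<^sub>R v}"

definition singular_values :: "('a::euclidean_space \<Rightarrow> 'a) \<Rightarrow> real list" where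
  "singular_values T =
     concat (map (\<lambda>a. replicate (dim (gram_eigenspace T (a\<^sup>2))) a)
       (rev (sorted_list_of_set {a. 0 \<le> a \<and> gram_eigenspace T (a\<^sup>2) \<noteq> {0}})))"

text \<open>The list is indexed from 0, so \<open>\<alpha>\<^sub>l\<close> is \<open>singular_values T ! (l - 1)\<close>; the integer \<open>l\<close> with
  \<open>l - 1 < s \<le> l\<close> is the ceiling of \<open>s\<close>. Negative \<open>s\<close> do not matter.\<close>

definition sv_fun :: "real \<Rightarrow> ('a::euclidean_space \<Rightarrow> 'a) \<Rightarrow> real" where
  "sv_fun s T =
     (if s \<le> 0 then 1
      else if s \<le> real DIM('a) then
        (let l = nat \<lceil>s\<rceil> in
          prod_list (take (l - 1) (singular_values T)) *
          (singular_values T ! (l - 1)) powr (s - real l + 1))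
      else prod_list (singular_values T) powr (s / real DIM('a)))"

primrec word_map :: "('m \<Rightarrow> 'a \<Rightarrow> 'a) \<Rightarrow> 'm list \<Rightarrow> 'a \<Rightarrow> 'a" where
  "word_map T [] = id"
| "word_map T (i # w) = T i \<circ> word_map T w"

section \<open>Pressure and the numbers \<open>d\<^sub>q\<close>\<close>

definition pressure ::
  "('m \<Rightarrow> 'a::euclidean_space \<Rightarrow> 'a) \<Rightarrow> (nat \<Rightarrow> 'm) measure \<Rightarrow> real \<Rightarrow> real \<Rightarrow> real" where
  "pressure T \<mu> s q =
     (if q = 1 then
        lim (\<lambda>k. (1 / real k) *
          (\<Sum>w | length w = k. measure \<mu> (cylinder w) *
             ln (inverse (sv_fun s (word_map T w)) * measure \<mu> (cylinder w))))
      else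
        lim (\<lambda>k. (1 / real k) *
          (ln (\<Sum>w | length w = k.
             sv_fun s (word_map T w) powr (1 - q) * measure \<mu> (cylinder w) powr q) / (q - 1))))"

definition dim_q ::
  "('m \<Rightarrow> 'a::euclidean_space \<Rightarrow> 'a) \<Rightarrow> (nat \<Rightarrow> 'm) measure \<Rightarrow> real \<Rightarrow> real" where
  "dim_q T \<mu> q = (THE s. 0 < s \<and> pressure T \<mu> s q = 0)"

section \<open>Almost self-affine measures\<close>

definition code_point ::
  "('m \<Rightarrow> 'a::euclidean_space \<Rightarrow> 'a) \<Rightarrow> ('m list \<Rightarrow> 'a) \<Rightarrow> (nat \<Rightarrow> 'm) \<Rightarrow> 'a" where
  "code_point T \<omega> x = (\<Sum>k. word_map T (initial x k) (\<omega> (initial x (Suc k))))"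

definition projected_measure ::
  "('m \<Rightarrow> 'a::euclidean_space \<Rightarrow> 'a) \<Rightarrow> (nat \<Rightarrow> 'm) measure \<Rightarrow> ('m list \<Rightarrow> 'a) \<Rightarrow> 'a measure" where
  "projected_measure T \<mu> \<omega> = distr \<mu> borel (code_point T \<omega>)"

text \<open>\<open>|z|\<^sup>-\<^sup>s\<close> with value \<open>\<infinity>\<close> at \<open>z = 0\<close> for \<open>s > 0\<close>, and constantly 1 for \<open>s = 0\<close>
  (note that \<^term>\<open>0 powr s = (0::real)\<close> for all \<open>s\<close>).\<close>

definition riesz_kernel :: "real \<Rightarrow> 'a::real_normed_vector \<Rightarrow> ennreal" where
  "riesz_kernel s z = (if s = 0 then 1 else inverse (ennreal (norm z powr s)))"

end

theory Submission
  imports Defs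
begin

text \<open>Along \<open>\<mu>\<close>-typical sequences \<open>log (\<phi>\<^sup>s(T\<^bsub>x|k\<^esub>) / \<mu>(C\<^bsub>x|k\<^esub>))\<close> grows linearly with slope
  \<open>-P(s,1)\<close>: it is subadditive up to a constant, \<open>\<mu>\<close> is quasi-Bernoulli and hence ergodic, and Kingman's theorem
  applies.  For \<open>s < min d\<^sub>1 N\<close> this makes the expected \<open>s\<close>-potential of \<open>\<mu>\<^sup>\<omega>\<close> finite at the image of a typical
  sequence, so that balls have mass at most a constant times \<open>r\<^sup>s\<close>.  For \<open>d\<^sub>1 < s \<le> N\<close>, cutting the image of
  each cylinder into pieces of diameter comparable to a singular value shows by Borel--Cantelli that
  balls have mass at least a constant times \<open>r\<^sup>s\<close>; for \<open>s > N\<close> a cubic grid gives the same.  Hence the local dimension exists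
  and equals \<open>min d\<^sub>1 N\<close>, and \<open>d\<^sub>1\<close> is at most the left limit of \<open>d\<^sub>q\<close> at 1 because \<open>d\<^sub>q\<close> is non-increasing.\<close>

section \<open>Singular values\<close>

text \<open>Two distortions shape the argument. \<phi>^s is only shown to be submultiplicative up to
  a constant, because volumes of parallelepipeds replace exterior powers, and \<mu> is
  multiplicative on cylinders only up to a constant. Both errors point the same way: log
  \<phi>^s(T_w) and -log \<mu>(C_w) are each subadditive up to an additive constant, hence so is
  their sum \<open>logratio\<close>, for every s >= 0. The pressure for q <= 1 and the behaviour
  along typical sequences are both read off from this one function of words. The lower bound on ball
  masses holds for every admissible \<omega>, since the cells are cut with \<omega> fixed; only the
  upper bound, which rests on an expected potential, costs a \<open>\<P>\<close>-null set. Carrying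
  almost sure statements from code space to the projected measure requires a measurable set of
  points, which is why radii, exponents and constants are first restricted to countable
  families.\<close>

text \<open>The quadratic form \<open>x \<bullet> A x\<close> attains its maximum on the unit sphere
  of \<open>S\<close>, and the first-order condition at a maximiser \<open>v\<close> says that the
  residual \<open>A v - c *\<^sub>R v\<close>, which stays in \<open>S\<close>, vanishes.\<close>

lemma self_adjoint_eigenvector:
  fixes A :: "'a::euclidean_space \<Rightarrow> 'a"
  assumes A: "linear A" and sym: "\<And>x y. A x \<bullet> y = x \<bullet> A y"
    and S: "subspace S" "A ` S \<subseteq> S" "S \<noteq> {0}"
  obtains v c where "v \<in> S" "norm v = 1" "A v = c *\<^sub>R v"
proof -
  obtain u where u: "u \<in> S" "u \<noteq> 0" using S subspace_0 by auto
  have "(1 / norm u) *\<^sub>R u \<in> S \<inter> sphere 0 1" using u S by (auto simp: subspace_scale)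
  then have ne: "S \<inter> sphere 0 1 \<noteq> {}" by blast
  have comp: "compact (S \<inter> sphere 0 1)"
    using closed_subspace[OF S(1)] compact_sphere by (metis closed_Int_compact)
  have cont: "continuous_on (S \<inter> sphere 0 1) (\<lambda>x. x \<bullet> A x)"
    by (intro continuous_intros linear_continuous_on linear_linear[THEN iffD2] A)
  obtain v where v: "v \<in> S \<inter> sphere 0 1" "\<And>x. x \<in> S \<inter> sphere 0 1 \<Longrightarrow> x \<bullet> A x \<le> v \<bullet> A v"
    using continuous_attains_sup[OF comp ne cont] by blast
  define c where "c = v \<bullet> A v"
  have max: "x \<bullet> A x \<le> c * (x \<bullet> x)" if "x \<in> S" for x
  proof (cases "x = 0")
    case False
    have "(1 / norm x) *\<^sub>R x \<in> S \<inter> sphere 0 1" using that False S by (auto simp: subspace_scale)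
    from v(2)[OF this] have "(x \<bullet> A x) / (norm x)\<^sup>2 \<le> c"
      using A by (simp add: c_def linear_scale power2_eq_square)
    then show ?thesis using False by (simp add: field_simps power2_norm_eq_inner)
  qed (use A in \<open>simp add: linear_0\<close>)
  define w where "w = A v - c *\<^sub>R v"
  have wS: "w \<in> S" using v S unfolding w_def by (auto intro!: subspace_diff subspace_scale)
  define k where "k = c * (w \<bullet> w) - w \<bullet> A w"
  \<comment> \<open>Maximality is tested at \<open>v + t *\<^sub>R w\<close>. The left side is of
    first order in \<open>t\<close> and the right side of second order, which leaves no room for
    \<open>w \<bullet> w > 0\<close>.\<close>
  have ineq: "2 * t * (w \<bullet> w) \<le> t\<^sup>2 * k" for t
  proof -
    have "v + t *\<^sub>R w \<in> S" using v wS S by (auto intro!: subspace_add subspace_scale)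
    from max[OF this] have "(v + t *\<^sub>R w) \<bullet> (A v + t *\<^sub>R A w) \<le> c * ((v + t *\<^sub>R w) \<bullet> (v + t *\<^sub>R w))"
      using A by (simp add: linear_add linear_scale)
    moreover have "v \<bullet> A w = w \<bullet> A v" by (metis sym inner_commute)
    moreover have "v \<bullet> v = 1" using v by (simp add: norm_eq_1)
    moreover have "w \<bullet> A v = w \<bullet> w + c * (w \<bullet> v)" unfolding w_def by (simp add: algebra_simps)
    ultimately show ?thesis
      unfolding k_def by (simp add: algebra_simps power2_eq_square c_def[symmetric] inner_commute[of v w])
  qed
  have "w \<bullet> w \<le> 0"
  proof (rule ccontr)
    assume a: "\<not> ?thesis"
    show False
    proof (cases "k \<le> 0")
      case True then show ?thesis using ineq[of 1] a by simp
    next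
      case False
      \<comment> \<open>The value \<open>t = (w \<bullet> w) / k\<close> minimises
        \<open>t\<^sup>2 * k - 2 * t * (w \<bullet> w)\<close>.\<close>
      have "2 * ((w \<bullet> w) / k) * (w \<bullet> w) \<le> ((w \<bullet> w) / k)\<^sup>2 * k" using ineq .
      then have "2 * (w \<bullet> w)\<^sup>2 \<le> (w \<bullet> w)\<^sup>2" using False by (simp add: field_simps power2_eq_square)
      then show False using a by (simp add: power2_eq_square mult_le_0_iff)
    qed
  qed
  then have "A v = c *\<^sub>R v" unfolding w_def by (metis inner_gt_zero_iff leD right_minus_eq)
  then show ?thesis using that v by auto
qed

text \<open>Splitting off one eigenvector leaves its orthogonal complement inside \<open>S\<close>,
  which is again invariant because \<open>A\<close> is self-adjoint; the dimension drops, so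
  induction applies.\<close>

lemma self_adjoint_eigenbasis:
  fixes A :: "'a::euclidean_space \<Rightarrow> 'a"
  assumes A: "linear A" and sym: "\<And>x y. A x \<bullet> y = x \<bullet> A y"
    and S: "subspace S" "A ` S \<subseteq> S"
  shows "\<exists>B. pairwise orthogonal B \<and> (\<forall>b\<in>B. norm b = 1 \<and> (\<exists>c. A b = c *\<^sub>R b)) \<and> span B = S"
  using S
proof (induction "dim S" arbitrary: S rule: less_induct)
  case less
  show ?case
  proof (cases "S = {0}")
    case True
    show ?thesis by (rule exI[of _ "{}"]) (simp add: True)
  next
    case False
    obtain v c where v: "v \<in> S" "norm v = 1" "A v = c *\<^sub>R v"
      using self_adjoint_eigenvector[OF A sym less.prems False] by blast
    define S' where "S' = S \<inter> {x. v \<bullet> x = 0}"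
    have sub: "subspace S'" unfolding S'_def using less.prems subspace_hyperplane
      by (intro subspace_inter) auto
    have inv: "A ` S' \<subseteq> S'"
    proof clarify
      fix x assume x: "x \<in> S'"
      then have "v \<bullet> A x = 0" using sym[of v x] v by (simp add: S'_def)
      then show "A x \<in> S'" using x less.prems by (auto simp: S'_def)
    qed
    have "v \<notin> S'" using v(2) by (auto simp: S'_def)
    then have "S' \<subset> S" using v unfolding S'_def by blast
    then have "dim S' < dim S" using sub less.prems
      by (metis dim_psubset span_eq_iff)
    from less.hyps[OF this sub inv] obtain B where
      B: "pairwise orthogonal B" "\<forall>b\<in>B. norm b = 1 \<and> (\<exists>c. A b = c *\<^sub>R b)" "span B = S'" by blast
    have orth: "v \<bullet> b = 0" if "b \<in> B" for b
      using span_base[OF that] B(3) by (auto simp: S'_def)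
    have "S \<subseteq> span (insert v B)"
    proof
      fix x assume x: "x \<in> S"
      have "v \<bullet> v = 1" using v by (simp add: norm_eq_1)
      then have "x - (v \<bullet> x) *\<^sub>R v \<in> S'"
        using x v less.prems by (auto simp: S'_def inner_diff_right subspace_diff subspace_scale)
      then show "x \<in> span (insert v B)" using B(3) by (metis span_breakdown_eq)
    qed
    moreover have "span (insert v B) \<subseteq> S"
    proof (rule span_minimal)
      show "insert v B \<subseteq> S" using v B(3) span_superset[of B] by (auto simp: S'_def)
    qed (use less.prems in auto)
    ultimately have "span (insert v B) = S" by blast
    moreover have "pairwise orthogonal (insert v B)"
      using B(1) orth by (auto simp: pairwise_insert orthogonal_def inner_commute)
    ultimately show ?thesis using B v by (intro exI[of _ "insert v B"]) auto
  qed
qed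

section \<open>Orthonormal lists, singular vectors and min-max bounds\<close>

definition orthonormal :: "'a::real_inner list \<Rightarrow> bool" where
  "orthonormal us \<longleftrightarrow> distinct us \<and> pairwise orthogonal (set us) \<and> (\<forall>u\<in>set us. norm u = 1)"

lemma orthonormal_Nil [simp]: "orthonormal []"
  by (simp add: orthonormal_def)

lemma orthonormal_independent:
  assumes "orthonormal (us :: 'a::euclidean_space list)"
  shows "independent (set us)"
  using assms unfolding orthonormal_def
  by (intro pairwise_orthogonal_independent) auto

lemma dim_span_orthonormal:
  assumes "orthonormal (us :: 'a::euclidean_space list)"
  shows "dim (span (set us)) = length us"
  using orthonormal_independent[OF assms] assms
  by (simp add: dim_eq_card_independent orthonormal_def distinct_card)

lemma orthonormal_subseq:
  assumes "orthonormal us" "set vs \<subseteq> set us" "distinct vs"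
  shows "orthonormal vs"
  using assms unfolding orthonormal_def by (meson pairwise_subset subsetD)

lemma orthonormal_span_expand:
  assumes us: "orthonormal (us :: 'a::euclidean_space list)" and x: "x \<in> span (set us)"
  shows "(\<Sum>u\<in>set us. (x \<bullet> u) *\<^sub>R u) = x"
  using us x by (intro orthonormal_basis_expand) (auto simp: orthonormal_def)

lemma norm_sum_orthogonal:
  assumes "finite I" "\<And>i j. i \<in> I \<Longrightarrow> j \<in> I \<Longrightarrow> i \<noteq> j \<Longrightarrow> f i \<bullet> f j = 0"
  shows "(norm (\<Sum>i\<in>I. f i))\<^sup>2 = (\<Sum>i\<in>I. (norm (f i))\<^sup>2)"
proof -
  have "(norm (\<Sum>i\<in>I. f i))\<^sup>2 = (\<Sum>i\<in>I. \<Sum>j\<in>I. f j \<bullet> f i)"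
    by (simp only: power2_norm_eq_inner inner_sum_left inner_sum_right)
  also have "\<dots> = (\<Sum>i\<in>I. \<Sum>j\<in>I. if j = i then f i \<bullet> f i else 0)"
    using assms(2) by (intro sum.cong refl) (metis (full_types))
  finally show ?thesis using assms(1) by (simp add: power2_norm_eq_inner)
qed

lemma sorted_wrt_concat_replicate:
  assumes "sorted_wrt (\<ge>) (xs :: 'a::preorder list)"
  shows "sorted_wrt (\<ge>) (concat (map (\<lambda>a. replicate (n a) a) xs))"
  using assms
proof (induction xs)
  case (Cons a xs)
  have "sorted_wrt (\<ge>) (replicate k a)" for k by (induction k) auto
  with Cons show ?case by (auto simp: sorted_wrt_append)
qed simp

text \<open>The right singular vectors of a singular value decomposition, in decreasing order. Left
  singular vectors are not named: the mutual orthogonality of the images \<open>T e\<close> does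
  their work, and this form also makes sense when some images vanish.\<close>

definition singular_basis :: "('a::euclidean_space \<Rightarrow> 'a) \<Rightarrow> 'a list \<Rightarrow> bool" where
  "singular_basis T es \<longleftrightarrow> orthonormal es \<and> length es = DIM('a) \<and> span (set es) = UNIV \<and>
     singular_values T = map (\<lambda>e. norm (T e)) es \<and> sorted_wrt (\<ge>) (singular_values T) \<and>
     (\<forall>e\<in>set es. \<forall>e'\<in>set es. e \<noteq> e' \<longrightarrow> T e \<bullet> T e' = 0)"

lemma singular_basisD:
  assumes "singular_basis (T :: 'a::euclidean_space \<Rightarrow> 'a) es"
  shows "orthonormal es" "length es = DIM('a)" "span (set es) = UNIV"
    "singular_values T = map (\<lambda>e. norm (T e)) es" "sorted_wrt (\<ge>) (singular_values T)"
    "\<And>e e'. e \<in> set es \<Longrightarrow> e' \<in> set es \<Longrightarrow> e \<noteq> e' \<Longrightarrow> T e \<bullet> T e' = 0"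
  using assms unfolding singular_basis_def by blast+

text \<open>An orthonormal eigenbasis of the Gram map has eigenvalue
  \<open>(norm (T b))\<^sup>2\<close> at \<open>b\<close>. The work lies in matching it with
  \<open>singular_values\<close>, which counts dimensions of eigenspaces: each eigenspace is spanned
  by the basis vectors whose images have the corresponding norm.\<close>

lemma singular_basis_exists:
  fixes T :: "'a::euclidean_space \<Rightarrow> 'a"
  assumes T: "linear T"
  shows "\<exists>es. singular_basis T es"
proof -
  have adj: "x \<bullet> adjoint T y = T x \<bullet> y" for x y by (rule adjoint_works[OF T])
  define A where "A = (\<lambda>x. adjoint T (T x))"
  have A: "linear A"
    unfolding A_def using linear_compose[OF T adjoint_linear[OF T]] by (simp add: o_def)
  have inA: "A x \<bullet> y = T x \<bullet> T y" for x y
    by (metis A_def adj inner_commute)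
  have "A x \<bullet> y = x \<bullet> A y" for x y
    by (metis inA inner_commute)
  from self_adjoint_eigenbasis[OF A this subspace_UNIV] obtain B where
    B: "pairwise orthogonal B" "\<And>b. b\<in>B \<Longrightarrow> norm b = 1" "\<And>b. b\<in>B \<Longrightarrow> \<exists>c. A b = c *\<^sub>R b"
      "span B = UNIV" by auto
  have "0 \<notin> B" using B(2) by force
  then have indB: "independent B" using B(1) pairwise_orthogonal_independent by blast
  have finB: "finite B" using indB independent_imp_finite by blast
  have eig: "A b = (norm (T b))\<^sup>2 *\<^sub>R b" if "b \<in> B" for b
  proof -
    obtain c where c: "A b = c *\<^sub>R b" using B(3) \<open>b \<in> B\<close> by blast
    have "A b \<bullet> b = (norm (T b))\<^sup>2" by (simp add: inA power2_norm_eq_inner)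
    moreover have "A b \<bullet> b = c" using c B(2)[OF that] by (simp add: norm_eq_1)
    ultimately show ?thesis using c by simp
  qed
  define E where "E a = {b \<in> B. norm (T b) = a}" for a
  define Av where "Av = {a. 0 \<le> a \<and> gram_eigenspace T (a\<^sup>2) \<noteq> {0}}"
  have zero: "0 \<in> gram_eigenspace T c" for c
    using linear_0[OF A] by (simp add: gram_eigenspace_def A_def)
  have orth: "v \<bullet> b = 0"
    if "v \<in> gram_eigenspace T (a\<^sup>2)" "b \<in> B" "norm (T b) \<noteq> a" "a \<ge> 0" for v a b
  proof -
    have "A v = a\<^sup>2 *\<^sub>R v" using that(1) by (simp add: gram_eigenspace_def A_def)
    then have "a\<^sup>2 * (v \<bullet> b) = A v \<bullet> b" by simp
    also have "\<dots> = v \<bullet> A b" by (metis inA inner_commute)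
    also have "\<dots> = (norm (T b))\<^sup>2 * (v \<bullet> b)" using eig[OF that(2)] by simp
    finally have "(a\<^sup>2 - (norm (T b))\<^sup>2) * (v \<bullet> b) = 0" by (simp add: algebra_simps)
    moreover have "a\<^sup>2 \<noteq> (norm (T b))\<^sup>2" using that by (simp add: power2_eq_iff_nonneg)
    ultimately show ?thesis by simp
  qed
  have expand: "(\<Sum>b\<in>B. (x \<bullet> b) *\<^sub>R b) = x" for x
  proof -
    obtain l where l: "set l = B" "distinct l" using finite_distinct_list[OF finB] by blast
    then have "orthonormal l" using B by (simp add: orthonormal_def)
    from orthonormal_span_expand[OF this] show ?thesis using B l by simp
  qed
  have E_eq: "gram_eigenspace T (a\<^sup>2) = span (E a)" if "a \<ge> 0" for a
  proof
    show "gram_eigenspace T (a\<^sup>2) \<subseteq> span (E a)"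
    proof
      fix v assume v: "v \<in> gram_eigenspace T (a\<^sup>2)"
      have "v = (\<Sum>b\<in>B. (v \<bullet> b) *\<^sub>R b)" by (rule expand[symmetric])
      also have "\<dots> = (\<Sum>b\<in>E a. (v \<bullet> b) *\<^sub>R b)"
        using orth[OF v] that finB by (intro sum.mono_neutral_right) (auto simp: E_def)
      also have "\<dots> \<in> span (E a)" by (intro span_sum span_scale span_base)
      finally show "v \<in> span (E a)" .
    qed
    have "gram_eigenspace T (a\<^sup>2) = {x. A x = a\<^sup>2 *\<^sub>R x}" by (simp add: gram_eigenspace_def A_def)
    then have "subspace (gram_eigenspace T (a\<^sup>2))"
      using A by (auto simp: subspace_def linear_0 linear_add linear_scale algebra_simps)
    moreover have "E a \<subseteq> gram_eigenspace T (a\<^sup>2)"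
      using eig by (auto simp: E_def gram_eigenspace_def A_def)
    ultimately show "span (E a) \<subseteq> gram_eigenspace T (a\<^sup>2)" by (rule span_minimal[rotated])
  qed
  have indE: "independent (E a)" for a using indB by (rule independent_mono) (auto simp: E_def)
  have dimE: "dim (gram_eigenspace T (a\<^sup>2)) = card (E a)" if "a \<ge> 0" for a
    using E_eq[OF that] indE by (simp add: dim_eq_card_independent)
  have Av_eq: "Av = (\<lambda>b. norm (T b)) ` B"
  proof safe
    fix a assume a: "a \<in> Av"
    then have "E a \<noteq> {}" using E_eq unfolding Av_def by auto
    then show "a \<in> (\<lambda>b. norm (T b)) ` B" by (auto simp: E_def)
  next
    fix b assume b: "b \<in> B"
    have "b \<in> gram_eigenspace T ((norm (T b))\<^sup>2)" using eig[OF b] by (simp add: gram_eigenspace_def A_def)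
    moreover have "b \<noteq> 0" using \<open>0 \<notin> B\<close> b by blast
    ultimately show "norm (T b) \<in> Av" unfolding Av_def by auto
  qed
  have finAv: "finite Av" using Av_eq finB by simp
  have "\<forall>a. \<exists>l. set l = E a \<and> distinct l"
    using finB by (auto simp: E_def intro: finite_distinct_list)
  then obtain bas where bas: "\<And>a. set (bas a) = E a" "\<And>a. distinct (bas a)" by metis
  define as where "as = rev (sorted_list_of_set Av)"
  have as: "set as = Av" "distinct as" "sorted_wrt (\<ge>) as"
    using finAv by (auto simp: as_def sorted_wrt_rev)
  \<comment> \<open>The basis is listed in the order in which \<open>singular_values\<close> runs
    through the distinct values, so that the two lists agree entry by entry.\<close>
  define es where "es = concat (map bas as)"
  have set_es: "set es = B"
    using Av_eq by (auto simp: es_def as bas E_def)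
  have dist_es: "distinct es"
    unfolding es_def using as(2)
  proof (induction as)
    case (Cons a l)
    then show ?case using bas by (auto simp: E_def)
  qed simp
  have sv: "singular_values T = map (\<lambda>e. norm (T e)) es"
  proof -
    have "singular_values T = concat (map (\<lambda>a. replicate (dim (gram_eigenspace T (a\<^sup>2))) a) as)"
      by (simp add: singular_values_def as_def Av_def)
    also have "map (\<lambda>a. replicate (dim (gram_eigenspace T (a\<^sup>2))) a) as
        = map (\<lambda>a. map (\<lambda>e. norm (T e)) (bas a)) as"
    proof (rule map_cong[OF refl])
      fix a assume "a \<in> set as"
      then have a: "a \<ge> 0" using as by (simp add: Av_def)
      have "map (\<lambda>e. norm (T e)) (bas a) = map (\<lambda>e. a) (bas a)"
        using bas by (auto simp: E_def)
      also have "\<dots> = replicate (length (bas a)) a" by (simp add: map_replicate_const)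
      also have "length (bas a) = card (E a)" by (metis bas distinct_card)
      finally show "replicate (dim (gram_eigenspace T (a\<^sup>2))) a = map (\<lambda>e. norm (T e)) (bas a)"
        using dimE[OF a] by simp
    qed
    finally show ?thesis by (simp add: es_def map_concat o_def)
  qed
  show ?thesis
    unfolding singular_basis_def
  proof (intro exI conjI ballI impI)
    show es: "orthonormal es" using B set_es dist_es by (simp add: orthonormal_def)
    show sp: "span (set es) = UNIV" using set_es B by simp
    show "length es = DIM('a)" using dim_span_orthonormal[OF es] sp by simp
    show "singular_values T = map (\<lambda>e. norm (T e)) es" by (rule sv)
    show "sorted_wrt (\<ge>) (singular_values T)"
      unfolding singular_values_def
      by (rule sorted_wrt_concat_replicate) (use as in \<open>simp add: as_def Av_def\<close>)
    show "T e \<bullet> T e' = 0" if "e \<in> set es" "e' \<in> set es" "e \<noteq> e'" for e e'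
    proof -
      have "T e \<bullet> T e' = A e \<bullet> e'" by (simp add: inA)
      also have "\<dots> = (norm (T e))\<^sup>2 * (e \<bullet> e')" using eig that set_es by simp
      also have "e \<bullet> e' = 0" using that B(1) set_es by (auto simp: pairwise_def orthogonal_def)
      finally show ?thesis by simp
    qed
  qed
qed

lemma singular_values_facts:
  fixes T :: "'a::euclidean_space \<Rightarrow> 'a"
  assumes T: "linear T"
  shows length_singular_values: "length (singular_values T) = DIM('a)"
    and singular_values_antimono: "i \<le> j \<Longrightarrow> j < DIM('a) \<Longrightarrow> singular_values T ! j \<le> singular_values T ! i"
    and singular_values_attained: "i < DIM('a) \<Longrightarrow> \<exists>e. norm e = 1 \<and> singular_values T ! i = norm (T e)"
proof -
  obtain es where "singular_basis T es" using singular_basis_exists[OF T] by blast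
  note es = singular_basisD[OF this]
  show l: "length (singular_values T) = DIM('a)" using es by simp
  show "i \<le> j \<Longrightarrow> j < DIM('a) \<Longrightarrow> singular_values T ! j \<le> singular_values T ! i"
    using es(5) l by (cases "i = j") (auto simp: sorted_wrt_iff_nth_less)
  show "i < DIM('a) \<Longrightarrow> \<exists>e. norm e = 1 \<and> singular_values T ! i = norm (T e)"
    using es(1,2) by (intro exI[of _ "es ! i"]) (auto simp: es(4) orthonormal_def)
qed

text \<open>One half of the Courant-Fischer principle. The singular vectors of index at least
  \<open>j\<close> (counted from 0) span a space of codimension \<open>j\<close>, which must meet
  \<open>U\<close>; on it \<open>T\<close> stretches by at most the singular value of index
  \<open>j\<close>.\<close>

lemma singular_value_upper_minmax:
  fixes T :: "'a::euclidean_space \<Rightarrow> 'a"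
  assumes T: "linear T" and U: "subspace U" "j < dim U"
  shows "\<exists>v\<in>U. v \<noteq> 0 \<and> norm (T v) \<le> singular_values T ! j * norm v"
proof -
  obtain es where "singular_basis T es" using singular_basis_exists[OF T] by blast
  note es = singular_basisD[OF this]
  define fs where "fs = drop j es"
  have "set fs \<subseteq> set es" unfolding fs_def by (rule set_drop_subset)
  moreover have "distinct fs" using es(1) by (simp add: fs_def orthonormal_def)
  ultimately have fs: "set fs \<subseteq> set es" "orthonormal fs" using orthonormal_subseq[OF es(1)] by auto
  have j: "j < DIM('a)" using U dim_subset_UNIV[of U] by linarith
  have dimW: "dim (span (set fs)) = DIM('a) - j"
    using dim_span_orthonormal[OF fs(2)] es(2) by (simp add: fs_def)
  have "dim {x + y |x y. x \<in> U \<and> y \<in> span (set fs)} + dim (U \<inter> span (set fs)) = dim U + dim (span (set fs))"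
    by (rule dim_sums_Int) (use U in auto)
  moreover have "dim {x + y |x y. x \<in> U \<and> y \<in> span (set fs)} \<le> DIM('a)" by (rule dim_subset_UNIV)
  ultimately have "dim (U \<inter> span (set fs)) > 0" using dimW U j by linarith
  have "\<not> U \<inter> span (set fs) \<subseteq> {0}"
  proof
    assume "U \<inter> span (set fs) \<subseteq> {0}"
    then have "dim (U \<inter> span (set fs)) = 0" by (simp only: dim_eq_0)
    with \<open>dim (U \<inter> span (set fs)) > 0\<close> show False by (simp only: less_irrefl)
  qed
  then obtain v where v: "v \<in> U" "v \<in> span (set fs)" "v \<noteq> 0" by blast
  have bound: "norm (T e) \<le> singular_values T ! j" if e: "e \<in> set fs" for e
  proof -
    obtain i where i: "i < length fs" "e = fs ! i" using e by (metis in_set_conv_nth)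
    then have "e = es ! (j + i)" "j + i < DIM('a)" using es(2) by (auto simp: fs_def)
    then have "norm (T e) = singular_values T ! (j + i)" using es(2,4) by simp
    also have "\<dots> \<le> singular_values T ! j"
      using singular_values_antimono[OF T] \<open>j + i < DIM('a)\<close> by simp
    finally show ?thesis .
  qed
  have sv0: "0 \<le> singular_values T ! j" using es(2,4) j by simp
  have Tv: "T v = (\<Sum>e\<in>set fs. (v \<bullet> e) *\<^sub>R T e)"
    using arg_cong[OF orthonormal_span_expand[OF fs(2) v(2)], of T] by (simp add: T linear_sum linear_scale)
  have nv: "(\<Sum>e\<in>set fs. (norm ((v \<bullet> e) *\<^sub>R e))\<^sup>2) = (norm v)\<^sup>2"
  proof -
    have "(norm (\<Sum>e\<in>set fs. (v \<bullet> e) *\<^sub>R e))\<^sup>2 = (\<Sum>e\<in>set fs. (norm ((v \<bullet> e) *\<^sub>R e))\<^sup>2)"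
      using fs(2) by (intro norm_sum_orthogonal) (auto simp: orthonormal_def pairwise_def orthogonal_def)
    then show ?thesis by (simp only: orthonormal_span_expand[OF fs(2) v(2)])
  qed
  have "(norm (T v))\<^sup>2 = (\<Sum>e\<in>set fs. (norm ((v \<bullet> e) *\<^sub>R T e))\<^sup>2)"
    unfolding Tv by (rule norm_sum_orthogonal) (use es(6) fs(1) in auto)
  also have "\<dots> = (\<Sum>e\<in>set fs. (v \<bullet> e)\<^sup>2 * (norm (T e))\<^sup>2)" by (simp add: power_mult_distrib)
  also have "\<dots> \<le> (\<Sum>e\<in>set fs. (v \<bullet> e)\<^sup>2 * (singular_values T ! j)\<^sup>2)"
    using bound by (intro sum_mono mult_left_mono power_mono) auto
  also have "\<dots> = (\<Sum>e\<in>set fs. (norm ((v \<bullet> e) *\<^sub>R e))\<^sup>2 * (singular_values T ! j)\<^sup>2)"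
    using fs(2) by (intro sum.cong) (auto simp: orthonormal_def power_mult_distrib)
  also have "\<dots> = (norm v)\<^sup>2 * (singular_values T ! j)\<^sup>2" by (simp only: nv flip: sum_distrib_right)
  finally have "(norm (T v))\<^sup>2 \<le> (singular_values T ! j * norm v)\<^sup>2"
    by (simp only: power_mult_distrib mult.commute)
  then have "norm (T v) \<le> singular_values T ! j * norm v"
    by (rule power2_le_imp_le) (use sv0 in simp)
  then show ?thesis using v by blast
qed

text \<open>Pull the span of the top \<open>j + 1\<close> singular vectors of \<open>T\<close> back
  through \<open>S\<close> and apply the min-max bound for \<open>T \<circ> S\<close> there. It
  shows that appending one letter to a word shrinks any given singular value by a bounded factor at
  most, so the scales used for balls leave no large gaps.\<close>

lemma singular_value_comp_right:
  fixes S T :: "'a::euclidean_space \<Rightarrow> 'a"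
  assumes T: "linear T" and S: "linear S" "bij S"
    and b: "\<And>v. b * norm v \<le> norm (S v)" "b > 0" and j: "j < DIM('a)"
  shows "b * singular_values T ! j \<le> singular_values (T \<circ> S) ! j"
proof -
  obtain es where "singular_basis T es" using singular_basis_exists[OF T] by blast
  note es = singular_basisD[OF this]
  define fs where "fs = take (Suc j) es"
  have "set fs \<subseteq> set es" unfolding fs_def by (rule set_take_subset)
  moreover have "distinct fs" using es(1) by (simp add: fs_def orthonormal_def)
  ultimately have fs: "set fs \<subseteq> set es" "orthonormal fs" using orthonormal_subseq[OF es(1)] by auto
  have inv: "linear (inv S)" "inj (inv S)" "\<And>x. S (inv S x) = x"
    using S by (auto simp: bij_is_surj surj_f_inv_f bij_imp_bij_inv bij_is_inj
        intro: inj_linear_imp_inv_linear)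
  define U where "U = inv S ` span (set fs)"
  have U: "subspace U" unfolding U_def using inv by (intro linear_subspace_image) auto
  have "dim U = dim (span (set fs))" unfolding U_def
    using inv by (metis dim_image_eq inj_on_subset subset_UNIV)
  also have "\<dots> = Suc j" using dim_span_orthonormal[OF fs(2)] es(2) j by (simp add: fs_def)
  finally have "j < dim U" by simp
  have TS: "linear (T \<circ> S)" using T S by (simp add: linear_compose)
  obtain v where v: "v \<in> U" "v \<noteq> 0" "norm ((T \<circ> S) v) \<le> singular_values (T \<circ> S) ! j * norm v"
    using singular_value_upper_minmax[OF TS U \<open>j < dim U\<close>] by blast
  define u where "u = S v"
  have u: "u \<in> span (set fs)" using v(1) inv by (auto simp: U_def u_def)
  have bound: "norm (T e) \<ge> singular_values T ! j" if e: "e \<in> set fs" for e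
  proof -
    obtain i where i: "i < length fs" "e = fs ! i" using e by (metis in_set_conv_nth)
    then have "e = es ! i" "i \<le> j" "i < DIM('a)" using es(2) j by (auto simp: fs_def)
    then have "norm (T e) = singular_values T ! i" using es(2,4) by simp
    also have "\<dots> \<ge> singular_values T ! j"
      using singular_values_antimono[OF T \<open>i \<le> j\<close> j] by simp
    finally show ?thesis .
  qed
  have sv0: "0 \<le> singular_values T ! j" using es(2,4) j by simp
  have Tu: "T u = (\<Sum>e\<in>set fs. (u \<bullet> e) *\<^sub>R T e)"
    using arg_cong[OF orthonormal_span_expand[OF fs(2) u], of T] by (simp add: T linear_sum linear_scale)
  have "(norm u)\<^sup>2 = (norm (\<Sum>e\<in>set fs. (u \<bullet> e) *\<^sub>R e))\<^sup>2" using orthonormal_span_expand[OF fs(2) u] by simp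
  also have "\<dots> = (\<Sum>e\<in>set fs. (norm ((u \<bullet> e) *\<^sub>R e))\<^sup>2)"
    using fs(2) by (intro norm_sum_orthogonal) (auto simp: orthonormal_def pairwise_def orthogonal_def)
  finally have "(singular_values T ! j)\<^sup>2 * (norm u)\<^sup>2 = (\<Sum>e\<in>set fs. (u \<bullet> e)\<^sup>2 * (singular_values T ! j)\<^sup>2)"
    using fs(2) by (simp add: power_mult_distrib orthonormal_def sum_distrib_left mult.commute)
  also have "\<dots> \<le> (\<Sum>e\<in>set fs. (u \<bullet> e)\<^sup>2 * (norm (T e))\<^sup>2)"
    using bound sv0 by (intro sum_mono mult_left_mono power_mono) auto
  also have "\<dots> = (\<Sum>e\<in>set fs. (norm ((u \<bullet> e) *\<^sub>R T e))\<^sup>2)" by (simp add: power_mult_distrib)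
  also have "\<dots> = (norm (T u))\<^sup>2"
    unfolding Tu by (rule norm_sum_orthogonal[symmetric]) (use es(6) fs(1) in auto)
  finally have "(singular_values T ! j * norm u)\<^sup>2 \<le> (norm (T u))\<^sup>2" by (simp add: power_mult_distrib)
  then have "singular_values T ! j * norm u \<le> norm (T u)" by (rule power2_le_imp_le) simp
  moreover have "singular_values T ! j * (b * norm v) \<le> singular_values T ! j * norm u"
    using b(1)[of v] sv0 by (intro mult_left_mono) (auto simp: u_def)
  ultimately have "(b * singular_values T ! j) * norm v \<le> singular_values (T \<circ> S) ! j * norm v"
    using v(3) by (simp add: u_def mult_ac)
  then show ?thesis using v(2) by simp
qed

section \<open>Orthogonal components and volumes of parallelepipeds\<close>

definition perp :: "'a::euclidean_space set \<Rightarrow> 'a \<Rightarrow> 'a" where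
  "perp S x = (SOME z. x - z \<in> span S \<and> (\<forall>w\<in>span S. w \<bullet> z = 0))"

lemma perp_props: "x - perp S x \<in> span S" "w \<in> span S \<Longrightarrow> w \<bullet> perp S x = 0"
proof -
  obtain y z where yz: "y \<in> span S" "\<And>w. w \<in> span S \<Longrightarrow> orthogonal z w" "x = y + z"
    using orthogonal_subspace_decomp_exists[of S x] by metis
  have "\<exists>z. x - z \<in> span S \<and> (\<forall>w\<in>span S. w \<bullet> z = 0)"
    by (rule exI[of _ z]) (use yz in \<open>simp add: orthogonal_def inner_commute\<close>)
  from someI_ex[OF this, folded perp_def]
  show "x - perp S x \<in> span S" "w \<in> span S \<Longrightarrow> w \<bullet> perp S x = 0" by blast+
qed

lemma perp_eqI:
  assumes "x - z \<in> span S" "\<And>w. w \<in> span S \<Longrightarrow> w \<bullet> z = 0"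
  shows "perp S x = z"
proof -
  have d: "z - perp S x \<in> span S"
    using span_diff[OF perp_props(1)[of x S] assms(1)] by simp
  have "(z - perp S x) \<bullet> (z - perp S x) = 0"
    using assms(2)[OF d] perp_props(2)[OF d, of x] by (simp add: inner_diff_right)
  then show ?thesis by simp
qed

lemma perp_span_cong:
  assumes "span S = span S'"
  shows "perp S = perp S'"
  unfolding perp_def assms ..

lemma perp_eq_0: "x \<in> span S \<Longrightarrow> perp S x = 0"
  by (rule perp_eqI) auto

lemma perp_add_scale: "y \<in> span S \<Longrightarrow> perp S (y + c *\<^sub>R x) = c *\<^sub>R perp S x"
proof (rule perp_eqI)
  assume y: "y \<in> span S"
  have "y + c *\<^sub>R x - c *\<^sub>R perp S x = y + c *\<^sub>R (x - perp S x)" by (simp add: algebra_simps)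
  also have "\<dots> \<in> span S" using y perp_props(1)[of x S] by (intro span_add span_scale)
  finally show "y + c *\<^sub>R x - c *\<^sub>R perp S x \<in> span S" .
qed (simp add: perp_props)

lemma norm_perp_le:
  assumes "y \<in> span S"
  shows "norm (perp S x) \<le> norm (x - y)"
proof -
  define u where "u = x - y - perp S x"
  have "(x - perp S x) - y \<in> span S" by (intro span_diff perp_props assms)
  then have "u \<in> span S" by (simp add: u_def algebra_simps)
  then have "u \<bullet> perp S x = 0" by (rule perp_props)
  then have "(norm (u + perp S x))\<^sup>2 = (norm u)\<^sup>2 + (norm (perp S x))\<^sup>2"
    by (intro norm_add_Pythagorean) (simp add: orthogonal_def)
  then have "(norm (perp S x))\<^sup>2 \<le> (norm (u + perp S x))\<^sup>2" by simp
  also have "u + perp S x = x - y" by (simp add: u_def)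
  finally show ?thesis by (rule power2_le_imp_le) simp
qed

text \<open>One Gram-Schmidt step: removing from \<open>perp S a\<close> its component along
  \<open>perp S b\<close> leaves height times base, whose square is a 2 by 2 Gram determinant. The
  determinant is symmetric in \<open>a\<close> and \<open>b\<close>, which makes the volume
  independent of the order of orthogonalization.\<close>

lemma perp_insert_area:
  "(norm (perp (insert b S) a) * norm (perp S b))\<^sup>2
     = (norm (perp S a))\<^sup>2 * (norm (perp S b))\<^sup>2 - (perp S a \<bullet> perp S b)\<^sup>2"
proof (cases "perp S b = 0")
  case False
  define a' b' where ab: "a' = perp S a" "b' = perp S b"
  define c where "c = (a' \<bullet> b') / (b' \<bullet> b')"
  have bb: "b' \<bullet> b' \<noteq> 0" using False by (simp add: ab)
  define z where "z = a' - c *\<^sub>R b'"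
  have mono: "span S \<subseteq> span (insert b S)" by (rule span_mono) blast
  have a': "a - a' \<in> span S" and b': "b - b' \<in> span S" unfolding ab by (rule perp_props)+
  have zS: "u \<bullet> z = 0" if "u \<in> span S" for u
    unfolding z_def ab inner_diff_right inner_scaleR_right
      perp_props(2)[OF that, of a] perp_props(2)[OF that, of b] by simp
  have b'z: "b' \<bullet> z = 0"
    unfolding z_def inner_diff_right inner_scaleR_right inner_commute[of b' a'] using bb by (simp add: c_def)
  have bz: "b \<bullet> z = 0" using zS[OF b'] b'z by (simp add: inner_diff_left)
  have z: "perp (insert b S) a = z"
  proof (rule perp_eqI)
    have "b - (b - b') \<in> span (insert b S)"
      by (intro span_diff span_base subsetD[OF mono b']) blast
    then have "(a - a') + c *\<^sub>R b' \<in> span (insert b S)"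
      using subsetD[OF mono a'] by (intro span_add span_scale) simp_all
    moreover have "a - z = (a - a') + c *\<^sub>R b'" by (simp add: z_def)
    ultimately show "a - z \<in> span (insert b S)" by (simp only:)
    fix w assume "w \<in> span (insert b S)"
    then obtain k where k: "w - k *\<^sub>R b \<in> span S" unfolding span_breakdown_eq by blast
    have "w \<bullet> z = (w - k *\<^sub>R b) \<bullet> z + k * (b \<bullet> z)" by (simp only: inner_diff_left inner_scaleR_left)
    also have "\<dots> = 0" unfolding zS[OF k] bz by simp
    finally show "w \<bullet> z = 0" .
  qed
  have D: "c * (b' \<bullet> b') = a' \<bullet> b'" using bb by (simp add: c_def)
  have "(norm (a' - c *\<^sub>R b'))\<^sup>2 = a' \<bullet> a' - c * (a' \<bullet> b') - (c * (a' \<bullet> b') - c * (c * (b' \<bullet> b')))"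
    unfolding power2_norm_eq_inner by (simp only: inner_diff_left inner_diff_right inner_scaleR_left inner_scaleR_right inner_commute[of b' a'] right_diff_distrib)
  also have "\<dots> = a' \<bullet> a' - c * (a' \<bullet> b')" by (simp only: D)
  finally have "(norm (a' - c *\<^sub>R b'))\<^sup>2 * (b' \<bullet> b') = (a' \<bullet> a' - c * (a' \<bullet> b')) * (b' \<bullet> b')" by (simp only:)
  also have "\<dots> = (a' \<bullet> a') * (b' \<bullet> b') - (c * (b' \<bullet> b')) * (a' \<bullet> b')" by (simp add: algebra_simps)
  also have "\<dots> = (a' \<bullet> a') * (b' \<bullet> b') - (a' \<bullet> b')\<^sup>2" by (simp only: D power2_eq_square)
  finally have "(norm (a' - c *\<^sub>R b'))\<^sup>2 * (b' \<bullet> b') = (a' \<bullet> a') * (b' \<bullet> b') - (a' \<bullet> b')\<^sup>2" .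
  then show ?thesis unfolding z z_def ab[symmetric] by (simp add: power_mult_distrib power2_norm_eq_inner)
qed simp

lemma perp_swap:
  "norm (perp (insert b S) a) * norm (perp S b) = norm (perp (insert a S) b) * norm (perp S a)"
proof -
  have "(norm (perp (insert b S) a) * norm (perp S b))\<^sup>2 = (norm (perp (insert a S) b) * norm (perp S a))\<^sup>2"
    unfolding perp_insert_area inner_commute[of "perp S a" "perp S b"] by (simp only: mult.commute)
  then show ?thesis by (simp add: power2_eq_iff_nonneg)
qed

text \<open>Volumes of parallelepipeds, computed by orthogonalization, take the place of exterior powers in the
  proof that \<open>\<alpha>\<^sub>1 \<dots> \<alpha>\<^sub>j\<close> is submultiplicative up to a constant.\<close>

primrec vol :: "'a::euclidean_space list \<Rightarrow> real" where
  "vol [] = 1"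
| "vol (v # vs) = norm (perp (set vs) v) * vol vs"

lemma vol_nonneg: "0 \<le> vol vs"
  by (induction vs) auto

lemma vol_move: "vol (xs @ a # ys) = vol (a # xs @ ys)"
proof (induction xs)
  case (Cons x xs)
  have s: "set (xs @ a # ys) = insert a (set (xs @ ys))" by auto
  have "vol ((x # xs) @ a # ys) = norm (perp (insert a (set (xs @ ys))) x) * (norm (perp (set (xs @ ys)) a) * vol (xs @ ys))"
    using Cons by (simp only: append_Cons vol.simps s)
  also have "\<dots> = norm (perp (insert x (set (xs @ ys))) a) * (norm (perp (set (xs @ ys)) x) * vol (xs @ ys))"
    using perp_swap[of a "set (xs @ ys)" x] by (simp only: mult.assoc[symmetric])
  finally show ?case by simp
qed simp

lemma vol_orthogonal: "sorted_wrt (\<lambda>a b. a \<bullet> b = 0) vs \<Longrightarrow> vol vs = prod_list (map norm vs)"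
proof (induction vs)
  case (Cons v vs)
  have "w \<bullet> v = 0" if "w \<in> span (set vs)" for w
    using that
  proof (induction rule: span_induct)
    case base
    show ?case using subspace_hyperplane[of v] by (simp add: inner_commute)
  next
    case step then show ?case using Cons.prems by (auto simp: inner_commute)
  qed
  then have "perp (set vs) v = v" by (intro perp_eqI) (auto simp: span_zero)
  then show ?case using Cons by simp
qed simp

lemma vol_linear_image_0:
  assumes S: "linear S" and "vol vs = 0"
  shows "vol (map S vs) = 0"
  using assms(2)
proof (induction vs)
  case (Cons v vs)
  show ?case
  proof (cases "vol vs = 0")
    case False
    then have "perp (set vs) v = 0" using Cons.prems by simp
    then have "v \<in> span (set vs)" using perp_props(1)[of v "set vs"] by simp
    then have "S v \<in> span (S ` set vs)" using linear_span_image[OF S] by auto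
    then show ?thesis by (simp add: perp_eq_0)
  qed (use Cons in simp)
qed simp

text \<open>Gram-Schmidt replaces each vector by a multiple of a unit vector modulo the span of its
  successors in the list, and a linear map preserves such relations. Hence the volumes before and
  after \<open>S\<close> differ by the same normalising factors, and the distortion of
  \<open>S\<close> can be measured on an orthonormal list.\<close>

lemma vol_linear_image:
  assumes S: "linear S" and "vol vs \<noteq> 0"
  shows "\<exists>us. orthonormal us \<and> length us = length vs \<and> span (set us) = span (set vs) \<and>
           vol (map S vs) = vol vs * vol (map S us)"
  using assms(2)
proof (induction vs)
  case (Cons v vs)
  then obtain us where us: "orthonormal us" "length us = length vs" "span (set us) = span (set vs)"
      "vol (map S vs) = vol vs * vol (map S us)" by auto
  define z where "z = perp (set vs) v"
  have z0: "z \<noteq> 0" using Cons.prems by (auto simp: z_def)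
  define u where "u = (1 / norm z) *\<^sub>R z"
  have nz: "norm z *\<^sub>R u = z" using z0 by (simp add: u_def)
  have vz: "v - norm z *\<^sub>R u \<in> span (set us)"
    using perp_props(1)[of v "set vs"] unfolding nz us(3) by (simp only: z_def)
  have uo: "w \<bullet> u = 0" if "w \<in> span (set us)" for w
    using perp_props(2)[of w "set vs" v] that us(3) by (simp add: u_def z_def)
  have nu: "norm u = 1" using z0 by (simp add: u_def)
  have "u \<notin> set us" using uo[of u] nu span_base[of u "set us"] by auto
  then have on: "orthonormal (u # us)"
    using us(1) nu uo span_base[of _ "set us"]
    by (auto simp: orthonormal_def pairwise_insert orthogonal_def inner_commute)
  have sp: "span (set (u # us)) = span (set (v # vs))"
  proof -
    have "span (insert v (set us)) = span (insert u (set us))"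
    proof -
      have vin: "v \<in> span (insert u (set us))"
        unfolding span_breakdown_eq using vz by blast
      have mono: "span (set us) \<subseteq> span (insert v (set us))" by (rule span_mono) blast
      have "v - (v - norm z *\<^sub>R u) \<in> span (insert v (set us))"
        by (intro span_diff subsetD[OF mono vz] span_base) blast
      then have "z \<in> span (insert v (set us))" by (simp add: nz)
      then have "u \<in> span (insert v (set us))" unfolding u_def by (rule span_scale)
      moreover have "set us \<subseteq> span (insert v (set us))" "set us \<subseteq> span (insert u (set us))"
        by (auto intro: span_base)
      moreover have "u \<in> span (insert u (set us))" "v \<in> span (insert v (set us))"
        by (simp_all add: span_base)
      ultimately show ?thesis using vin by (simp add: span_eq)
    qed
    moreover have "span (insert v (set us)) = span (insert v (set vs))" unfolding span_insert us(3) ..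
    ultimately show ?thesis by (simp only: list.set)
  qed
  have spS: "span (S ` set us) = span (S ` set vs)"
    by (simp only: linear_span_image[OF S] us(3))
  \<comment> \<open>Modulo the span of the other images, \<open>S v\<close> is \<open>norm z\<close>
    times \<open>S u\<close>; this is the factor that \<open>v\<close> contributes to
    \<open>vol\<close>.\<close>
  have "S v = S (v - norm z *\<^sub>R u) + norm z *\<^sub>R S u"
    using S by (simp add: linear_diff linear_scale)
  moreover have "S (v - norm z *\<^sub>R u) \<in> span (S ` set us)"
    using vz linear_span_image[OF S] by blast
  ultimately have "perp (S ` set us) (S v) = norm z *\<^sub>R perp (S ` set us) (S u)"
    by (simp add: perp_add_scale)
  then have "vol (map S (v # vs)) = vol (v # vs) * vol (map S (u # us))"
    using us(4) perp_span_cong[OF spS] by (simp add: z_def)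
  then show ?case using on sp us(2) by (intro exI[of _ "u # us"]) auto
qed auto

text \<open>The span of \<open>us\<close> contains a vector \<open>v\<close> that \<open>T\<close>
  stretches by at most the smallest of the singular values involved. Some member \<open>u\<close> of
  \<open>us\<close> has a sizeable coordinate in \<open>v\<close>, so the height of
  \<open>T u\<close> over the other images is controlled by \<open>norm (T v)\<close>. Removing
  \<open>u\<close> and inducting costs a factor \<open>DIM('a)\<close> per vector, where exterior
  powers would give factor 1.\<close>

lemma vol_orthonormal_image_le:
  fixes T :: "'a::euclidean_space \<Rightarrow> 'a"
  assumes T: "linear T" and "orthonormal us"
  shows "vol (map T us) \<le> real DIM('a) ^ length us * (\<Prod>i<length us. singular_values T ! i)"
  using assms(2)
proof (induction "length us" arbitrary: us)
  case (Suc j)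
  have dimU: "dim (span (set us)) = Suc j" using dim_span_orthonormal Suc by metis
  then have jd: "Suc j \<le> DIM('a)" using dim_subset_UNIV by metis
  obtain v where v: "v \<in> span (set us)" "v \<noteq> 0" "norm (T v) \<le> singular_values T ! j * norm v"
    using singular_value_upper_minmax[OF T subspace_span, of j "set us"] dimU by auto
  \<comment> \<open>Pigeonhole on coordinates: \<open>norm v\<close> is at most the sum of at most
    \<open>DIM('a)\<close> absolute coordinates.\<close>
  have "\<exists>u\<in>set us. norm v \<le> real DIM('a) * \<bar>v \<bullet> u\<bar>"
  proof (rule ccontr)
    assume "\<not> ?thesis"
    then have less: "\<bar>v \<bullet> u\<bar> \<le> norm v / DIM('a)" if "u \<in> set us" for u
      using that by (simp add: field_simps not_le less_imp_le)
    obtain u0 where u0: "u0 \<in> set us" using Suc(2) by (metis list.set_sel(1) list.size(3) nat.distinct(1))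
    have "norm v = norm (\<Sum>u\<in>set us. (v \<bullet> u) *\<^sub>R u)" by (simp only: orthonormal_span_expand[OF Suc(3) v(1)])
    also have "\<dots> \<le> (\<Sum>u\<in>set us. \<bar>v \<bullet> u\<bar>)"
      using Suc(3) by (intro order.trans[OF norm_sum]) (auto simp: orthonormal_def)
    also have "\<dots> < (\<Sum>u\<in>set us. norm v / DIM('a))"
    proof (rule sum_strict_mono_ex1)
      show "\<exists>a\<in>set us. \<bar>v \<bullet> a\<bar> < norm v / DIM('a)"
        using u0 \<open>\<not> (\<exists>u\<in>set us. norm v \<le> real DIM('a) * \<bar>v \<bullet> u\<bar>)\<close>
        by (intro bexI[OF _ u0]) (simp add: field_simps not_le)
    qed (use less in auto)
    also have "\<dots> = card (set us) * (norm v / DIM('a))" by simp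
    also have "\<dots> \<le> DIM('a) * (norm v / DIM('a))"
      using jd Suc card_length[of us] by (intro mult_right_mono) auto
    finally show False by simp
  qed
  then obtain u where u: "u \<in> set us" "norm v \<le> real DIM('a) * \<bar>v \<bullet> u\<bar>" by blast
  obtain xs ys where xy: "us = xs @ u # ys" using u(1) by (meson split_list)
  have on: "orthonormal (xs @ ys)"
    by (rule orthonormal_subseq[OF Suc(3)]) (use Suc(3) xy in \<open>auto simp: orthonormal_def\<close>)
  have len: "length (xs @ ys) = j" using xy Suc(2) by simp
  define c where "c = v \<bullet> u"
  have c0: "c \<noteq> 0" using u(2) v(2) by (auto simp: c_def)
  have sets: "set us = insert u (set (xs @ ys))" "u \<notin> set (xs @ ys)"
    using xy Suc(3) by (auto simp: orthonormal_def)
  have "c *\<^sub>R u + (\<Sum>e\<in>set (xs @ ys). (v \<bullet> e) *\<^sub>R e) = v"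
    using orthonormal_span_expand[OF Suc(3) v(1)] sets by (simp add: c_def)
  moreover have "(\<Sum>e\<in>set (xs @ ys). (v \<bullet> e) *\<^sub>R e) \<in> span (set (xs @ ys))"
    by (intro span_sum span_scale span_base)
  ultimately have "v - c *\<^sub>R u \<in> span (set (xs @ ys))" by (metis add_diff_cancel_left')
  then have "(- 1 / c) *\<^sub>R (v - c *\<^sub>R u) \<in> span (set (xs @ ys))" by (rule span_scale)
  also have "(- 1 / c) *\<^sub>R (v - c *\<^sub>R u) = u - (1 / c) *\<^sub>R v" using c0 by (simp add: algebra_simps)
  finally have "T (u - (1 / c) *\<^sub>R v) \<in> span (T ` set (xs @ ys))" using linear_span_image[OF T] by blast
  then have "T u - (1 / c) *\<^sub>R T v \<in> span (set (map T (xs @ ys)))"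
    using T by (simp add: linear_diff linear_scale image_Un)
  \<comment> \<open>\<open>u\<close> equals \<open>(1 / c) *\<^sub>R v\<close> modulo the span of
    the other vectors, so the height of \<open>T u\<close> is at most the norm of
    \<open>(1 / c) *\<^sub>R T v\<close>.\<close>
  then have "norm (perp (set (map T (xs @ ys))) (T u)) \<le> norm (T u - (T u - (1 / c) *\<^sub>R T v))"
    by (rule norm_perp_le)
  also have "\<dots> = norm (T v) / \<bar>c\<bar>" by simp
  also have "\<dots> \<le> (singular_values T ! j * norm v) / \<bar>c\<bar>" using v(3) by (simp add: divide_right_mono)
  also have "\<dots> \<le> (singular_values T ! j * (DIM('a) * \<bar>c\<bar>)) / \<bar>c\<bar>"
  proof -
    have "0 \<le> singular_values T ! j"
      using singular_values_attained[OF T, of j] jd by force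
    then show ?thesis using u(2) by (intro divide_right_mono mult_left_mono) (auto simp: c_def)
  qed
  also have "\<dots> = DIM('a) * singular_values T ! j" using c0 by simp
  finally have p: "norm (perp (set (map T (xs @ ys))) (T u)) \<le> DIM('a) * singular_values T ! j" .
  have "vol (map T us) = norm (perp (set (map T (xs @ ys))) (T u)) * vol (map T (xs @ ys))"
    using vol_move[of "map T xs" "T u" "map T ys"] by (simp add: xy)
  also have "\<dots> \<le> (DIM('a) * singular_values T ! j) * (real DIM('a) ^ j * (\<Prod>i<j. singular_values T ! i))"
    using p Suc(1)[of "xs @ ys"] on len vol_nonneg by (intro mult_mono) (auto intro: order.trans[OF norm_ge_zero])
  finally show ?case using Suc(2) by (simp flip: Suc(2) add: mult_ac)
qed simp

lemma vol_singular_vectors: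
  fixes T :: "'a::euclidean_space \<Rightarrow> 'a"
  assumes T: "linear T" and j: "j \<le> DIM('a)"
  shows "\<exists>us. orthonormal us \<and> length us = j \<and> vol (map T us) = (\<Prod>i<j. singular_values T ! i)"
proof -
  obtain es where "singular_basis T es" using singular_basis_exists[OF T] by blast
  note es = singular_basisD[OF this]
  have on: "orthonormal (take j es)"
    using es(1) by (intro orthonormal_subseq[OF es(1)]) (auto simp: orthonormal_def dest: in_set_takeD)
  have "sorted_wrt (\<lambda>a b. a \<bullet> b = 0) (map T (take j es))"
    using es(1) unfolding sorted_wrt_iff_nth_less
    by (auto simp: orthonormal_def nth_eq_iff_index_eq intro!: es(6))
  then have "vol (map T (take j es)) = prod_list (map norm (map T (take j es)))" by (rule vol_orthogonal)
  also have "map norm (map T (take j es)) = take j (singular_values T)" by (simp add: es(4) take_map o_def)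
  also have "prod_list (take j (singular_values T)) = (\<Prod>i<j. singular_values T ! i)"
    using j length_singular_values[OF T] by (simp add: prod.list_conv_set_nth atLeast0LessThan)
  finally show ?thesis using on es(2) j by (intro exI[of _ "take j es"]) auto
qed

text \<open>The product on the left is the volume of the image of the top singular vectors of
  \<open>S \<circ> T\<close>. It factors through \<open>T\<close> and an orthonormal list fed to
  \<open>S\<close>; each of the two volume bounds contributes one factor
  \<open>DIM('a) ^ j\<close>.\<close>

lemma singular_values_prod_comp_le:
  fixes S T :: "'a::euclidean_space \<Rightarrow> 'a"
  assumes S: "linear S" and T: "linear T" and j: "j \<le> DIM('a)"
  shows "(\<Prod>i<j. singular_values (S \<circ> T) ! i)
    \<le> (real DIM('a) ^ j)\<^sup>2 * (\<Prod>i<j. singular_values S ! i) * (\<Prod>i<j. singular_values T ! i)"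
proof -
  have nn: "0 \<le> (\<Prod>i<j. singular_values R ! i)" if "linear R" for R :: "'a \<Rightarrow> 'a"
  proof (rule prod_nonneg)
    fix i assume "i \<in> {..<j}"
    then show "0 \<le> singular_values R ! i" using singular_values_attained[OF that, of i] j by force
  qed
  obtain us where us: "orthonormal us" "length us = j"
    "vol (map (S \<circ> T) us) = (\<Prod>i<j. singular_values (S \<circ> T) ! i)"
    using vol_singular_vectors[OF linear_compose[OF T S] j] by blast
  show ?thesis
  proof (cases "vol (map T us) = 0")
    case True
    then have "vol (map (S \<circ> T) us) = 0" using vol_linear_image_0[OF S True] by simp
    then have "(\<Prod>i<j. singular_values (S \<circ> T) ! i) = 0" using us(3) by simp
    then show ?thesis using nn[OF S] nn[OF T] by (simp only:) simp
  next
    case False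
    obtain ws where ws: "orthonormal ws" "length ws = j"
      "vol (map S (map T us)) = vol (map T us) * vol (map S ws)"
      using vol_linear_image[OF S False] us(2) by auto
    have "vol (map T us) * vol (map S ws) \<le> (real DIM('a) ^ j * (\<Prod>i<j. singular_values T ! i)) *
       (real DIM('a) ^ j * (\<Prod>i<j. singular_values S ! i))"
      using vol_orthonormal_image_le[OF T us(1)] vol_orthonormal_image_le[OF S ws(1)] us(2) ws(2)
        vol_nonneg nn[OF T] by (intro mult_mono) auto
    then show ?thesis using us(3) ws(3) by (simp add: power2_eq_square mult_ac)
  qed
qed

section \<open>The singular value function as a weighted product\<close>

text \<open>The exponent with which the singular value of index \<open>i\<close>, counted from 0,
  enters \<phi>^s: 1, then the fractional remainder, then 0 for s up to \<open>d\<close>, and s/d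
  throughout beyond that. With it ln \<phi>^s is linear in the logarithms of the singular values, so
  both regimes of s are treated at once.\<close>

definition sv_weight :: "nat \<Rightarrow> real \<Rightarrow> nat \<Rightarrow> real" where
  "sv_weight d s i = (if s \<le> real d then max 0 (min 1 (s - real i)) else s / real d)"

lemma sv_weight_nonneg: "0 \<le> s \<Longrightarrow> 0 \<le> sv_weight d s i"
  by (auto simp: sv_weight_def)

lemma sv_weight_le: "0 < d \<Longrightarrow> sv_weight d s i \<le> max 1 (s / real d)"
  by (auto simp: sv_weight_def)

lemma sv_weight_antimono: "i \<le> j \<Longrightarrow> sv_weight d s j \<le> sv_weight d s i"
  by (auto simp: sv_weight_def)

lemma sv_weight_mono:
  assumes "s \<le> s'" "0 < d"
  shows "sv_weight d s i \<le> sv_weight d s' i"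
proof (cases "s' \<le> real d")
  case False
  show ?thesis
  proof (cases "s \<le> real d")
    case True
    have "1 \<le> s' / real d" using False assms by simp
    then show ?thesis using True False by (auto simp: sv_weight_def)
  next
    case s: False
    have "s / real d \<le> s' / real d" using assms by (intro divide_right_mono) auto
    then show ?thesis using False s by (auto simp: sv_weight_def)
  qed
qed (use assms in \<open>auto simp: sv_weight_def\<close>)

lemma sv_weight_sum:
  assumes "0 \<le> s" "0 < d"
  shows "(\<Sum>i<d. sv_weight d s i) = s"
proof -
  have *: "(\<Sum>i<n. max 0 (min 1 (s - real i))) = min s (real n)" for n
    using assms(1) by (induction n) (auto simp: max_def min_def)
  show ?thesis using assms *[of d] by (cases "s \<le> real d") (auto simp: sv_weight_def)
qed

lemma exp_mult_ln: "0 < x \<Longrightarrow> exp (a * ln x) = x powr (a :: real)"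
  by (simp add: powr_def)

lemma ln_prod_pos:
  fixes f :: "nat \<Rightarrow> real"
  assumes "\<And>i. i < n \<Longrightarrow> 0 < f i"
  shows "ln (\<Prod>i<n. f i) = (\<Sum>i<n. ln (f i))"
proof (rule ln_prod)
  fix i assume "i \<in> {..<n}"
  then show "f i \<noteq> 0" using assms[of i] by simp
qed simp

lemma sv_fun_eq_exp:
  fixes T :: "'a::euclidean_space \<Rightarrow> 'a"
  assumes T: "linear T" and pos: "\<And>i. i < DIM('a) \<Longrightarrow> 0 < singular_values T ! i" and s: "0 \<le> s"
  shows "sv_fun s T = exp (\<Sum>i<DIM('a). sv_weight DIM('a) s i * ln (singular_values T ! i))"
proof -
  have prod_take: "prod_list (take n (singular_values T)) = (\<Prod>i<n. singular_values T ! i)" if "n \<le> DIM('a)" for n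
    using that length_singular_values[OF T] by (simp add: prod.list_conv_set_nth atLeast0LessThan)
  consider "s = 0" | "0 < s" "s \<le> DIM('a)" | "DIM('a) < s" using s by linarith
  then show ?thesis
  proof cases
    case 1
    then show ?thesis by (simp add: sv_fun_def sv_weight_def)
  next
    case 2
    define p where "p = nat \<lceil>s\<rceil> - 1"
    have p: "nat \<lceil>s\<rceil> = Suc p" using 2 by (simp add: p_def)
    have ps: "real p < s" "s \<le> real p + 1" using p 2 by linarith+
    have pd: "p < DIM('a)" using p 2(2) by linarith
    have "(\<Sum>i<DIM('a). sv_weight DIM('a) s i * ln (singular_values T ! i))
        = (\<Sum>i<Suc p. sv_weight DIM('a) s i * ln (singular_values T ! i))"
      using pd ps 2 by (intro sum.mono_neutral_right) (auto simp: sv_weight_def)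
    also have "\<dots> = (\<Sum>i<p. ln (singular_values T ! i)) + (s - real p) * ln (singular_values T ! p)"
      using pd ps 2 by (auto simp: sv_weight_def intro!: sum.cong)
    also have "exp \<dots> = (\<Prod>i<p. exp (ln (singular_values T ! i))) * exp ((s - real p) * ln (singular_values T ! p))"
      by (simp add: exp_add exp_sum)
    also have "exp ((s - real p) * ln (singular_values T ! p)) = (singular_values T ! p) powr (s - real p)"
      using pos[OF pd] by (simp add: powr_def)
    also have "(\<Prod>i<p. exp (ln (singular_values T ! i))) = (\<Prod>i<p. singular_values T ! i)"
      using pos pd by (intro prod.cong) auto
    finally show ?thesis using 2 p pd prod_take[of p] by (simp add: sv_fun_def Let_def)
  next
    case 3
    have "(\<Sum>i<DIM('a). sv_weight DIM('a) s i * ln (singular_values T ! i))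
       = s / DIM('a) * (\<Sum>i<DIM('a). ln (singular_values T ! i))"
      using 3 by (simp add: sv_weight_def sum_distrib_left)
    also have "(\<Sum>i<DIM('a). ln (singular_values T ! i)) = ln (\<Prod>i<DIM('a). singular_values T ! i)"
      using pos by (rule ln_prod_pos[symmetric])
    finally have "exp (\<Sum>i<DIM('a). sv_weight DIM('a) s i * ln (singular_values T ! i))
      = (\<Prod>i<DIM('a). singular_values T ! i) powr (s / DIM('a))"
      using prod_pos[of "{..<DIM('a)}" "\<lambda>i. singular_values T ! i"] pos by (metis exp_mult_ln lessThan_iff)
    moreover have "prod_list (singular_values T) = (\<Prod>i<DIM('a). singular_values T ! i)"
      using prod_take[of "DIM('a)"] length_singular_values[OF T] by simp
    ultimately show ?thesis using 3 s by (simp add: sv_fun_def)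
  qed
qed

text \<open>Abel summation: nonnegative decreasing weights are combinations of indicators of initial
  segments, with nonnegative coefficients of total at most \<open>W\<close>. Bounds on partial sums
  are therefore enough.\<close>

lemma weighted_sum_le:
  fixes w z :: "nat \<Rightarrow> real"
  assumes "\<And>i. i < n \<Longrightarrow> 0 \<le> w i \<and> w i \<le> W" "\<And>i j. i \<le> j \<Longrightarrow> j < n \<Longrightarrow> w j \<le> w i"
    and "\<And>j. j \<le> n \<Longrightarrow> (\<Sum>i<j. z i) \<le> C" "0 \<le> C" "0 \<le> W"
  shows "(\<Sum>i<n. w i * z i) \<le> W * C"
  using assms(1,2,3,5)
proof (induction n arbitrary: w W)
  case 0
  then show ?case using assms(4) by simp
next
  case (Suc n)
  \<comment> \<open>Subtracting the last weight from all of them leaves decreasing nonnegative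
    weights on \<open>n\<close> indices; what was subtracted multiplies one full partial
    sum.\<close>
  have IH: "(\<Sum>i<n. (w i - w n) * z i) \<le> (W - w n) * C"
    using Suc.prems by (intro Suc.IH) (auto simp: less_Suc_eq_le)
  have "(\<Sum>i<Suc n. w i * z i) = (\<Sum>i<n. (w i - w n) * z i) + w n * (\<Sum>i<Suc n. z i)"
    by (simp add: algebra_simps sum_subtractf sum_distrib_left)
  also have "\<dots> \<le> (W - w n) * C + w n * C"
    using IH Suc.prems(1)[of n] Suc.prems(3)[of "Suc n"] by (intro add_mono mult_left_mono) auto
  finally show ?case by (simp add: algebra_simps)
qed

lemma singular_values_ge:
  fixes T :: "'a::euclidean_space \<Rightarrow> 'a"
  assumes T: "linear T" and "\<And>v. b * norm v \<le> norm (T v)" "i < DIM('a)"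
  shows "b \<le> singular_values T ! i"
  using singular_values_attained[OF T assms(3)] assms(2) by (metis mult.right_neutral)

lemma singular_values_le:
  fixes T :: "'a::euclidean_space \<Rightarrow> 'a"
  assumes T: "linear T" and "\<And>v. norm (T v) \<le> b * norm v" "i < DIM('a)"
  shows "singular_values T ! i \<le> b"
  using singular_values_attained[OF T assms(3)] assms(2) by (metis mult.right_neutral)

lemma ln_sv_fun:
  fixes T :: "'a::euclidean_space \<Rightarrow> 'a"
  assumes T: "linear T" and pos: "\<And>i. i < DIM('a) \<Longrightarrow> 0 < singular_values T ! i" and s: "0 \<le> s"
  shows "0 < sv_fun s T"
    "ln (sv_fun s T) = (\<Sum>i<DIM('a). sv_weight DIM('a) s i * ln (singular_values T ! i))"
  by (simp_all add: sv_fun_eq_exp[OF assms])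

text \<open>Raising s to s' adds nonnegative weights of total s' - s, and every logarithm of a
  singular value lies between \<open>ln b\<close> and \<open>ln a\<close>. This two-sided estimate
  is the source of the strict monotonicity and of the Lipschitz continuity of the pressure in
  s.\<close>

lemma ln_sv_fun_diff:
  fixes T :: "'a::euclidean_space \<Rightarrow> 'a"
  assumes T: "linear T" and b: "0 < b" "\<And>v. b * norm v \<le> norm (T v)" "\<And>v. norm (T v) \<le> a * norm v"
    and s: "0 \<le> s" "s \<le> s'"
  shows "(s' - s) * ln b \<le> ln (sv_fun s' T) - ln (sv_fun s T)"
    "ln (sv_fun s' T) - ln (sv_fun s T) \<le> (s' - s) * ln a"
proof -
  define w where "w i = sv_weight DIM('a) s' i - sv_weight DIM('a) s i" for i
  have pos: "0 < singular_values T ! i" if "i < DIM('a)" for i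
    using singular_values_ge[OF T b(2) that] b(1) by simp
  have eq: "ln (sv_fun s' T) - ln (sv_fun s T) = (\<Sum>i<DIM('a). w i * ln (singular_values T ! i))"
    using ln_sv_fun(2)[OF T pos s(1)] ln_sv_fun(2)[OF T pos, of s'] s
    by (simp add: w_def sum_subtractf left_diff_distrib)
  have w0: "0 \<le> w i" for i using sv_weight_mono[OF s(2)] by (simp add: w_def)
  have wsum: "(\<Sum>i<DIM('a). w i) = s' - s"
    using s sv_weight_sum[of s "DIM('a)"] sv_weight_sum[of s' "DIM('a)"] by (simp add: w_def sum_subtractf)
  have "(\<Sum>i<DIM('a). w i * ln b) \<le> (\<Sum>i<DIM('a). w i * ln (singular_values T ! i))"
    using singular_values_ge[OF T b(2)] b(1) pos w0 by (intro sum_mono mult_left_mono) auto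
  then show "(s' - s) * ln b \<le> ln (sv_fun s' T) - ln (sv_fun s T)"
    by (simp only: eq wsum flip: sum_distrib_right)
  have "(\<Sum>i<DIM('a). w i * ln (singular_values T ! i)) \<le> (\<Sum>i<DIM('a). w i * ln a)"
  proof (intro sum_mono mult_left_mono w0)
    fix i assume "i \<in> {..<DIM('a)}"
    then show "ln (singular_values T ! i) \<le> ln a"
      using singular_values_le[OF T b(3), of i] pos[of i] by simp
  qed
  then show "ln (sv_fun s' T) - ln (sv_fun s T) \<le> (s' - s) * ln a"
    by (simp only: eq wsum flip: sum_distrib_right)
qed

text \<open>The largest possible weight times the logarithm of the worst constant in
  \<open>singular_values_prod_comp_le\<close>, that with j = d.\<close>

definition sv_const :: "nat \<Rightarrow> real \<Rightarrow> real" where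
  "sv_const d s = max 1 (s / real d) * ln ((real d ^ d)\<^sup>2)"

text \<open>For integer exponents this is the bound on products of leading singular values. Those
  bounds are exactly bounds on partial sums, and Abel summation against the decreasing weights
  carries them to every s, fractional or larger than the dimension.\<close>

lemma ln_sv_fun_comp_le:
  fixes S T :: "'a::euclidean_space \<Rightarrow> 'a"
  assumes S: "linear S" and T: "linear T"
    and posS: "\<And>i. i < DIM('a) \<Longrightarrow> 0 < singular_values S ! i"
    and posT: "\<And>i. i < DIM('a) \<Longrightarrow> 0 < singular_values T ! i"
    and pos: "\<And>i. i < DIM('a) \<Longrightarrow> 0 < singular_values (S \<circ> T) ! i" and s: "0 \<le> s"
  shows "ln (sv_fun s (S \<circ> T)) \<le> ln (sv_fun s S) + ln (sv_fun s T) + sv_const DIM('a) s"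
proof -
  let ?d = "DIM('a)"
  define z where "z i = ln (singular_values (S \<circ> T) ! i) - ln (singular_values S ! i) - ln (singular_values T ! i)" for i
  have C0: "0 \<le> ln ((real ?d ^ ?d)\<^sup>2)" by (intro ln_ge_zero one_le_power) auto
  have z: "(\<Sum>i<j. z i) \<le> ln ((real ?d ^ ?d)\<^sup>2)" if j: "j \<le> ?d" for j
  proof -
    have P: "0 < (\<Prod>i<j. singular_values S ! i)" "0 < (\<Prod>i<j. singular_values T ! i)"
        "0 < (\<Prod>i<j. singular_values (S \<circ> T) ! i)"
      using posS posT pos j by (auto intro!: prod_pos)
    have D: "1 \<le> (real ?d ^ j)\<^sup>2" by (intro one_le_power) auto
    have "ln (\<Prod>i<j. singular_values (S \<circ> T) ! i) \<le>
      ln ((real ?d ^ j)\<^sup>2 * (\<Prod>i<j. singular_values S ! i) * (\<Prod>i<j. singular_values T ! i))"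
      using singular_values_prod_comp_le[OF S T j] P by (intro ln_mono) auto
    also have "\<dots> = ln ((real ?d ^ j)\<^sup>2) + ln (\<Prod>i<j. singular_values S ! i) + ln (\<Prod>i<j. singular_values T ! i)"
    proof -
      have "ln (x * y * y') = ln x + ln y + ln y'" if "0 < x" "0 < y" "0 < y'" for x y y' :: real
        using that by (simp add: ln_mult)
      then show ?thesis using P D by (meson less_le_trans zero_less_one)
    qed
    also have "ln ((real ?d ^ j)\<^sup>2) \<le> ln ((real ?d ^ ?d)\<^sup>2)"
      using D j by (intro ln_mono power_mono power_increasing) auto
    finally have "ln (\<Prod>i<j. singular_values (S \<circ> T) ! i) - ln (\<Prod>i<j. singular_values S ! i)
       - ln (\<Prod>i<j. singular_values T ! i) \<le> ln ((real ?d ^ ?d)\<^sup>2)" by simp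
    also have "ln (\<Prod>i<j. singular_values (S \<circ> T) ! i) = (\<Sum>i<j. ln (singular_values (S \<circ> T) ! i))"
      by (rule ln_prod_pos) (use pos j in simp)
    also have "ln (\<Prod>i<j. singular_values S ! i) = (\<Sum>i<j. ln (singular_values S ! i))"
      by (rule ln_prod_pos) (use posS j in simp)
    also have "ln (\<Prod>i<j. singular_values T ! i) = (\<Sum>i<j. ln (singular_values T ! i))"
      by (rule ln_prod_pos) (use posT j in simp)
    finally show ?thesis by (simp only: z_def sum_subtractf)
  qed
  have "(\<Sum>i<?d. sv_weight ?d s i * z i) \<le> max 1 (s / real ?d) * ln ((real ?d ^ ?d)\<^sup>2)"
  proof (rule weighted_sum_le)
    show "0 \<le> sv_weight ?d s i \<and> sv_weight ?d s i \<le> max 1 (s / real ?d)" for i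
      using sv_weight_nonneg[OF s] sv_weight_le by auto
  qed (use z C0 sv_weight_antimono in auto)
  moreover have "(\<Sum>i<?d. sv_weight ?d s i * z i) = ln (sv_fun s (S \<circ> T)) - ln (sv_fun s S) - ln (sv_fun s T)"
    by (simp only: z_def sum_subtractf right_diff_distrib ln_sv_fun(2)[OF S posS s]
        ln_sv_fun(2)[OF T posT s] ln_sv_fun(2)[OF linear_compose[OF T S] pos s])
  ultimately show ?thesis by (simp add: sv_const_def)
qed

section \<open>Grids on ellipsoids\<close>

lemma card_floor_interval:
  assumes "0 \<le> r"
  shows "real (card {\<lfloor>- r\<rfloor>..\<lfloor>r :: real\<rfloor>}) \<le> 2 * r + 2"
proof -
  have "\<lfloor>- r\<rfloor> \<le> \<lfloor>r\<rfloor>" using assms by (intro floor_mono) auto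
  then have "real (card {\<lfloor>- r\<rfloor>..\<lfloor>r\<rfloor>}) = of_int (\<lfloor>r\<rfloor> - \<lfloor>- r\<rfloor> + 1)" by simp
  also have "\<dots> \<le> 2 * r + 2" by linarith
  finally show ?thesis .
qed

text \<open>The grid on the ellipsoid \<open>T (cball 0 R)\<close> has mesh \<open>\<alpha>\<^sub>p\<close> and runs only along its \<open>p\<close> longest axes.\<close>

lemma ellipsoid_partition:
  fixes T :: "'a::euclidean_space \<Rightarrow> 'a"
  assumes T: "linear T" and pos: "\<And>i. i < DIM('a) \<Longrightarrow> 0 < singular_values T ! i"
    and R: "0 < R" and p: "p < DIM('a)"
  defines "a \<equiv> singular_values T ! p"
  shows "\<exists>(h :: 'a \<Rightarrow> nat \<Rightarrow> int) J. finite J \<and> (\<forall>x. norm x \<le> R \<longrightarrow> h (T x) \<in> J)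
     \<and> real (card J) \<le> (2 * R + 2) ^ p * (\<Prod>i<p. singular_values T ! i / a)
     \<and> (\<forall>j. {y. h y = j} \<in> sets borel)
     \<and> (\<forall>x y. norm x \<le> R \<longrightarrow> norm y \<le> R \<longrightarrow> h (T x) = h (T y) \<longrightarrow>
          dist (T x) (T y) \<le> real DIM('a) * (1 + 2 * R) * a)"
proof -
  let ?sv = "\<lambda>i. singular_values T ! i"
  obtain es where "singular_basis T es" using singular_basis_exists[OF T] by blast
  note es = singular_basisD[OF this]
  have a: "0 < a" using pos p by (simp add: a_def)
  have sva: "a \<le> ?sv i" if "i \<le> p" for i using singular_values_antimono[OF T that p] by (simp add: a_def)
  have nTe: "norm (T (es ! i)) = ?sv i" if "i < DIM('a)" for i using that es(2,4) by simp
  have expand: "(\<Sum>e\<in>set es. (x \<bullet> e) *\<^sub>R e) = x" for x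
    by (rule orthonormal_span_expand[OF es(1)]) (simp add: es(3))
  have Tx: "T x = (\<Sum>e\<in>set es. (x \<bullet> e) *\<^sub>R T e)" for x
    using arg_cong[OF expand[of x], of T] T by (simp add: linear_sum linear_scale)
  have inn: "T x \<bullet> T e = (x \<bullet> e) * (norm (T e))\<^sup>2" if e: "e \<in> set es" for x e
  proof -
    have "T x \<bullet> T e = (\<Sum>e'\<in>set es. (x \<bullet> e') * (T e' \<bullet> T e))"
      by (subst Tx) (simp add: inner_sum_left)
    also have "\<dots> = (\<Sum>e'\<in>set es. if e' = e then (x \<bullet> e) * (T e \<bullet> T e) else 0)"
      using es(6) e by (intro sum.cong) auto
    finally show ?thesis using e by (simp add: power2_norm_eq_inner)
  qed
  \<comment> \<open>On \<open>T x\<close> this is the coordinate of the point along the axis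
    \<open>T (es ! i)\<close>, measured in units of the mesh \<open>a\<close>; it is defined on all
    of space so that the cells are Borel sets.\<close>
  define q where "q i y = (y \<bullet> T (es ! i)) / (?sv i * a)" for i y
  have q: "q i (T x) = (x \<bullet> es ! i) * ?sv i / a" if "i < DIM('a)" for i x
  proof -
    have "es ! i \<in> set es" using that es(2) by simp
    then show ?thesis using inn[of "es ! i" x] nTe[OF that] pos[OF that] a
      by (simp add: q_def power2_eq_square)
  qed
  have xe: "\<bar>x \<bullet> es ! i\<bar> \<le> norm x" if "i < DIM('a)" for x i
  proof -
    have "norm (es ! i) = 1" using that es(1,2) by (simp add: orthonormal_def)
    then show ?thesis using Cauchy_Schwarz_ineq2[of x "es ! i"] by simp
  qed
  define h :: "'a \<Rightarrow> nat \<Rightarrow> int" where "h y = (\<lambda>i\<in>{..<p}. \<lfloor>q i y\<rfloor>)" for y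
  define r where "r i = R * ?sv i / a" for i
  define J where "J = (\<Pi>\<^sub>E i\<in>{..<p}. {\<lfloor>- r i\<rfloor>..\<lfloor>r i\<rfloor>})"
  have r0: "0 \<le> r i" if "i < DIM('a)" for i using R a pos[OF that] by (simp add: r_def)
  have "finite J" unfolding J_def by (intro finite_PiE) auto
  moreover have "h (T x) \<in> J" if x: "norm x \<le> R" for x
    unfolding h_def J_def
  proof (rule restrict_PiE_iff[THEN iffD2], rule ballI)
    fix i assume "i \<in> {..<p}"
    then have i: "i < DIM('a)" using p by simp
    have "\<bar>q i (T x)\<bar> = \<bar>x \<bullet> es ! i\<bar> * ?sv i / a"
      using q[OF i] a pos[OF i] by (simp add: abs_mult)
    also have "\<dots> \<le> r i" unfolding r_def using xe[OF i, of x] x a pos[OF i]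
      by (intro divide_right_mono mult_right_mono) auto
    finally show "\<lfloor>q i (T x)\<rfloor> \<in> {\<lfloor>- r i\<rfloor>..\<lfloor>r i\<rfloor>}" by (auto intro!: floor_mono)
  qed
  moreover have "real (card J) \<le> (2 * R + 2) ^ p * (\<Prod>i<p. ?sv i / a)"
  proof -
    have "real (card J) = (\<Prod>i<p. real (card {\<lfloor>- r i\<rfloor>..\<lfloor>r i\<rfloor>}))"
      by (simp add: J_def card_PiE)
    also have "\<dots> \<le> (\<Prod>i<p. (2 * R + 2) * (?sv i / a))"
    proof (rule prod_mono)
      fix i assume i: "i \<in> {..<p}"
      have "1 \<le> ?sv i / a" using sva[of i] a i by simp
      \<comment> \<open>Along the first \<open>p\<close> axes the semi-axis is at least the mesh, so
        the additive 2 is absorbed into the factor.\<close>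
      then have "2 * r i + 2 \<le> (2 * R + 2) * (?sv i / a)" by (simp add: r_def algebra_simps)
      moreover have "real (card {\<lfloor>- r i\<rfloor>..\<lfloor>r i\<rfloor>}) \<le> 2 * r i + 2"
        using r0[of i] i p by (intro card_floor_interval) auto
      ultimately show "0 \<le> real (card {\<lfloor>- r i\<rfloor>..\<lfloor>r i\<rfloor>}) \<and> real (card {\<lfloor>- r i\<rfloor>..\<lfloor>r i\<rfloor>}) \<le> (2 * R + 2) * (?sv i / a)"
        by simp
    qed
    also have "\<dots> = (2 * R + 2) ^ p * (\<Prod>i<p. ?sv i / a)" by (simp only: prod.distrib prod_constant card_lessThan)
    finally show ?thesis .
  qed
  moreover have "{y. h y = j} \<in> sets borel" for j
  proof (cases "j \<in> extensional {..<p}")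
    case True
    have "{y. h y = j} = {y \<in> space borel. \<forall>i\<in>{..<p}. \<lfloor>q i y\<rfloor> = j i}"
      using True by (auto simp: h_def fun_eq_iff extensional_def restrict_def)
    also have "\<dots> \<in> sets borel"
    proof (rule sets.sets_Collect_finite_All)
      fix i
      have "q i \<in> borel_measurable borel" unfolding q_def by measurable
      then have "(\<lambda>y. \<lfloor>q i y\<rfloor>) \<in> measurable borel (count_space UNIV)" by measurable
      then have "(\<lambda>y. \<lfloor>q i y\<rfloor>) -` {j i} \<inter> space borel \<in> sets borel" by (rule measurable_sets) simp
      then show "{y \<in> space borel. \<lfloor>q i y\<rfloor> = j i} \<in> sets borel" by (simp add: vimage_def Int_def)
    qed auto
    finally show ?thesis .
  next
    case False
    then have "{y. h y = j} = {}" by (auto simp: h_def)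
    then show ?thesis by simp
  qed
  moreover have "dist (T x) (T y) \<le> real DIM('a) * (1 + 2 * R) * a"
    if xy: "norm x \<le> R" "norm y \<le> R" "h (T x) = h (T y)" for x y
  proof -
    \<comment> \<open>Along a gridded axis two points of one cell differ by at most one mesh. Along
      the remaining axes nothing was cut, but the ellipsoid itself is no wider than
      \<open>2 * R * a\<close> there.\<close>
    have each: "norm (((x - y) \<bullet> e) *\<^sub>R T e) \<le> (1 + 2 * R) * a" if e: "e \<in> set es" for e
    proof -
      obtain i where i: "i < DIM('a)" "e = es ! i" using e es(2) by (metis in_set_conv_nth)
      have n: "norm (((x - y) \<bullet> e) *\<^sub>R T e) = \<bar>(x - y) \<bullet> es ! i\<bar> * ?sv i" using nTe[OF i(1)] i(2) by simp
      show ?thesis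
      proof (cases "i < p")
        case True
        have "h (T x) i = h (T y) i" using xy(3) by simp
        then have "\<lfloor>q i (T x)\<rfloor> = \<lfloor>q i (T y)\<rfloor>" using True by (simp add: h_def)
        then have "\<bar>q i (T x) - q i (T y)\<bar> \<le> 1" by linarith
        also have "q i (T x) - q i (T y) = ((x - y) \<bullet> es ! i) * ?sv i / a"
          using q[OF i(1)] by (simp add: inner_diff_left left_diff_distrib diff_divide_distrib)
        finally have "\<bar>(x - y) \<bullet> es ! i\<bar> * ?sv i \<le> a" using a pos[OF i(1)] by (simp add: abs_mult)
        also have "a \<le> (1 + 2 * R) * a" using a R by (simp add: algebra_simps)
        finally show ?thesis using n by simp
      next
        case False
        have "\<bar>(x - y) \<bullet> es ! i\<bar> * ?sv i \<le> (2 * R) * a"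
        proof (rule mult_mono)
          have "norm (x - y) \<le> 2 * R" using xy norm_triangle_ineq4[of x y] by simp
          then show "\<bar>(x - y) \<bullet> es ! i\<bar> \<le> 2 * R" using xe[OF i(1), of "x - y"] by simp
          show "?sv i \<le> a" using singular_values_antimono[OF T, of p i] False i by (simp add: a_def)
        qed (use pos[OF i(1)] R in auto)
        also have "\<dots> \<le> (1 + 2 * R) * a" using a R by (simp add: algebra_simps)
        finally show ?thesis using n by simp
      qed
    qed
    have "dist (T x) (T y) = norm (T (x - y))" using T by (simp add: dist_norm linear_diff)
    also have "\<dots> \<le> (\<Sum>e\<in>set es. norm (((x - y) \<bullet> e) *\<^sub>R T e))" by (subst Tx) (rule norm_sum)
    also have "\<dots> \<le> (\<Sum>e\<in>set es. (1 + 2 * R) * a)" by (intro sum_mono each)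
    also have "\<dots> = real DIM('a) * (1 + 2 * R) * a"
      using es(1,2) by (simp add: orthonormal_def distinct_card)
    finally show ?thesis .
  qed
  ultimately show ?thesis by blast
qed

section \<open>Quasi-Bernoulli measures on code space\<close>

lemma length_initial [simp]: "length (initial x n) = n"
  by (simp add: initial_def)

lemma nth_initial [simp]: "i < n \<Longrightarrow> initial x n ! i = x i"
  by (simp add: initial_def)

lemma initial_0 [simp]: "initial x 0 = []"
  by (simp add: initial_def)

lemma shift_funpow: "(shift ^^ k) x = (\<lambda>n. x (n + k))"
  by (induction k) (auto simp: shift_def)

lemma initial_eq_iff: "initial x n = initial y n \<longleftrightarrow> (\<forall>i<n. x i = y i)"
  by (auto simp: list_eq_iff_nth_eq)

lemma initial_add: "initial x (k + n) = initial x k @ initial ((shift ^^ k) x) n"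
  by (auto simp: list_eq_iff_nth_eq nth_append shift_funpow)

lemma initial_Suc: "initial x (Suc k) = initial x k @ [x k]"
  by (simp add: initial_def)

lemma initial_Suc_Cons: "initial x (Suc k) = x 0 # initial (shift x) k"
  using initial_add[of x 1 k] by (simp add: initial_def)

lemma take_initial: "m \<le> n \<Longrightarrow> take m (initial x n) = initial x m"
  by (auto simp: list_eq_iff_nth_eq)

lemma cylinder_Nil [simp]: "cylinder [] = UNIV"
  by (auto simp: cylinder_def)

lemma mem_cylinder: "x \<in> cylinder w \<longleftrightarrow> initial x (length w) = w"
  by (simp add: cylinder_def)

lemma cylinder_append: "cylinder (u @ v) = cylinder u \<inter> (shift ^^ length u) -` cylinder v"
  by (auto simp: mem_cylinder initial_add)

lemma cylinder_nonempty: "\<exists>x. x \<in> cylinder w"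
proof
  show "(\<lambda>i. if i < length w then w ! i else undefined) \<in> cylinder w"
    by (auto simp: mem_cylinder list_eq_iff_nth_eq)
qed

lemma cylinder_disjoint: "length u = length v \<Longrightarrow> u \<noteq> v \<Longrightarrow> cylinder u \<inter> cylinder v = {}"
  unfolding cylinder_def by (metis (mono_tags, lifting) disjoint_iff mem_Collect_eq)

lemma finite_words [simp]: "finite {w :: 'm::finite list. length w = n}"
  using finite_lists_length_eq[of "UNIV :: 'm set" n] by simp

lemma countable_words: "countable (UNIV :: 'm::finite list set)"
  using countable_lists[of "UNIV :: 'm set"] by (simp add: countable_finite)

lemma space_code_borel [simp]: "space code_borel = UNIV"
  by (simp add: code_borel_def space_measure_of_conv)

lemma UNIV_sets_code_borel [simp]: "UNIV \<in> sets code_borel"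
  using sets.top[of code_borel] by simp

text \<open>The open ball of radius (1/2)^n around \<open>x\<close> is the cylinder of its first n +
  1 letters, and there are only countably many words, so every open set is a countable union of
  cylinders.\<close>

lemma sets_code_borel: "sets (code_borel :: (nat \<Rightarrow> 'm::finite) measure) = sigma_sets UNIV (range cylinder)"
proof -
  interpret C: Metric_space "UNIV :: (nat \<Rightarrow> 'm) set" code_dist by (rule Metric_space_code_dist)
  have op: "openin code_topology U \<longleftrightarrow> (\<forall>x\<in>U. \<exists>r>0. \<forall>y. code_dist x y < r \<longrightarrow> y \<in> U)" for U :: "(nat \<Rightarrow> 'm) set"
    unfolding code_topology_def C.openin_mtopology by (auto simp: subset_iff)
  have cyl: "openin code_topology (cylinder w)" for w :: "'m list"
    unfolding op
  proof
    fix x assume x: "x \<in> cylinder w"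
    show "\<exists>r>0. \<forall>y. code_dist x y < r \<longrightarrow> y \<in> cylinder w"
    proof (intro exI[of _ "(1/2) ^ length w"] conjI allI impI)
      fix y assume "code_dist x y < (1 / 2) ^ length w"
      then have "initial x (length w) = initial y (length w)"
        by (simp add: code_dist_less_iff initial_eq_iff)
      then show "y \<in> cylinder w" using x by (simp add: mem_cylinder)
    qed simp
  qed
  have union: "U = (\<Union>w\<in>{w. cylinder w \<subseteq> U}. cylinder w)" if U: "openin code_topology U" for U :: "(nat \<Rightarrow> 'm) set"
  proof (intro equalityI subsetI)
    fix x assume "x \<in> U"
    then obtain r where r: "r > 0" "\<And>y. code_dist x y < r \<Longrightarrow> y \<in> U" using U op by metis
    obtain n where n: "(1/2 :: real) ^ n < r" using real_arch_pow_inv[OF r(1), of "1/2"] by auto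
    have "cylinder (initial x (Suc n)) \<subseteq> U"
    proof
      fix y assume "y \<in> cylinder (initial x (Suc n))"
      then have "\<forall>k\<le>n. x k = y k" by (auto simp: mem_cylinder initial_eq_iff)
      then have "code_dist x y < (1/2) ^ n" by (simp add: code_dist_less_iff)
      then show "y \<in> U" using r(2) n by simp
    qed
    moreover have "x \<in> cylinder (initial x (Suc n))" by (simp add: mem_cylinder)
    ultimately show "x \<in> (\<Union>w\<in>{w. cylinder w \<subseteq> U}. cylinder w)" by blast
  qed auto
  have "sigma_sets UNIV {U. openin code_topology U} = sigma_sets UNIV (range (cylinder :: 'm list \<Rightarrow> _))"
  proof (rule sigma_sets_eqI)
    fix U :: "(nat \<Rightarrow> 'm) set" assume "U \<in> {U. openin code_topology U}"
    then have U: "U = (\<Union>w\<in>{w. cylinder w \<subseteq> U}. cylinder w)" using union by auto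
    have "countable {w :: 'm list. cylinder w \<subseteq> U}" using countable_words countable_subset by blast
    then have "(\<Union>w\<in>{w. cylinder w \<subseteq> U}. cylinder w) \<in> sigma_sets UNIV (range cylinder)"
      by (intro sigma_sets_UNION) auto
    then show "U \<in> sigma_sets UNIV (range cylinder)" using U by metis
  qed (use cyl in auto)
  then show ?thesis by (simp add: code_borel_def sets_measure_of_conv)
qed

lemma cylinder_sets [measurable]: "cylinder w \<in> sets (code_borel :: (nat \<Rightarrow> 'm::finite) measure)"
  unfolding sets_code_borel by auto

lemma measurable_initial [measurable]:
  "(\<lambda>x :: nat \<Rightarrow> 'm::finite. initial x n) \<in> measurable code_borel (count_space UNIV)"
  unfolding measurable_count_space_eq2_countable
proof (intro conjI ballI)
  fix w :: "'m list"
  have "(\<lambda>x. initial x n) -` {w} = (if length w = n then cylinder w else {})"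
    by (auto simp: mem_cylinder)
  then show "(\<lambda>x. initial x n) -` {w} \<inter> space code_borel \<in> sets code_borel" by simp
qed auto

lemma measurable_shift [measurable]: "shift \<in> measurable (code_borel :: (nat \<Rightarrow> 'm::finite) measure) code_borel"
proof (rule measurable_sigma_sets[OF sets_code_borel])
  fix A :: "(nat \<Rightarrow> 'm) set" assume "A \<in> range cylinder"
  then obtain w where w: "A = cylinder w" by auto
  have "shift -` A = (\<Union>i. cylinder (i # w))"
    unfolding w by (simp add: mem_cylinder set_eq_iff initial_Suc_Cons)
  then show "shift -` A \<inter> space code_borel \<in> sets code_borel" by auto
qed auto

lemma measurable_shift_funpow [measurable]:
  "shift ^^ n \<in> measurable (code_borel :: (nat \<Rightarrow> 'm::finite) measure) code_borel"
  by (induction n) (auto simp: id_def intro: measurable_comp)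

text \<open>One clopen set has to serve both measures, since it is used to compare them. The sets
  that can be so approximated contain the cylinders and are closed under complements and countable
  unions, the latter by truncating the union to finitely many sets.\<close>

lemma clopen_approximation:
  fixes M N :: "(nat \<Rightarrow> 'm::finite) measure"
  assumes M: "finite_measure M" "sets M = sets code_borel" and N: "finite_measure N" "sets N = sets code_borel"
    and A: "A \<in> sets code_borel" and e: "e > 0"
  shows "\<exists>n W. measure M (sym_diff A {x. initial x n \<in> W}) < e \<and> measure N (sym_diff A {x. initial x n \<in> W}) < e"
proof -
  interpret M: finite_measure M by fact
  interpret N: finite_measure N by fact
  note [measurable_cong] = M(2) N(2)
  have clop: "{x. initial x n \<in> W} \<in> sets code_borel" for n and W :: "'m list set"
  proof -
    have "{x \<in> space code_borel. initial x n \<in> W} \<in> sets code_borel" by measurable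
    then show ?thesis by simp
  qed
  have "A \<in> sigma_sets UNIV (range cylinder)" using A sets_code_borel by blast
  then show ?thesis using e
  proof (induction arbitrary: e rule: sigma_sets.induct)
    case (Basic a)
    then obtain w where w: "a = cylinder w" by auto
    have "cylinder w = {x. initial x (length w) \<in> {w}}" by (auto simp: mem_cylinder)
    then have "sym_diff a {x. initial x (length w) \<in> {w}} = {}" using w by auto
    then show ?case using Basic.prems by (metis measure_empty)
  next
    case Empty
    have "sym_diff {} {x. initial x 0 \<in> ({} :: 'm list set)} = {}" by auto
    then show ?case using Empty.prems by (metis measure_empty)
  next
    case (Compl a)
    from Compl.IH[OF Compl.prems] obtain n W where
      "measure M (sym_diff a {x. initial x n \<in> W}) < e \<and> measure N (sym_diff a {x. initial x n \<in> W}) < e" by blast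
    moreover have "sym_diff (UNIV - a) {x. initial x n \<in> - W} = sym_diff a {x. initial x n \<in> W}" by auto
    ultimately show ?case by metis
  next
    case (Union a)
    have meas: "a i \<in> sets code_borel" for i using Union.hyps sets_code_borel by blast
    define U where "U = (\<Union>i. a i)"
    define P where "P k = (\<Union>i<k. a i)" for k
    have Pm: "P k \<in> sets code_borel" for k unfolding P_def using meas by auto
    have Um: "U \<in> sets code_borel" unfolding U_def using meas by auto
    have inc: "incseq P" unfolding incseq_def P_def by (intro allI impI UN_mono) auto
    have UP: "(\<Union>k. P k) = U" by (auto simp: U_def P_def)
    have "(\<lambda>k. measure M (P k)) \<longlonglongrightarrow> measure M U"
      using M.finite_Lim_measure_incseq[of P] Pm inc UP M(2) by auto
    then have 1: "\<forall>\<^sub>F k in sequentially. measure M U - e/2 < measure M (P k)"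
      using Union.prems by (intro order_tendstoD) auto
    have "(\<lambda>k. measure N (P k)) \<longlonglongrightarrow> measure N U"
      using N.finite_Lim_measure_incseq[of P] Pm inc UP N(2) by auto
    then have 2: "\<forall>\<^sub>F k in sequentially. measure N U - e/2 < measure N (P k)"
      using Union.prems by (intro order_tendstoD) auto
    obtain k where k: "measure M U - e/2 < measure M (P k)" "measure N U - e/2 < measure N (P k)"
      using eventually_happens'[OF _ eventually_conj[OF 1 2]] by auto
    have PU: "P k \<subseteq> U" using UP by auto
    have dM: "measure M (U - P k) < e/2" using M.finite_measure_Diff[of U "P k"] Um Pm PU k M(2) by simp
    have dN: "measure N (U - P k) < e/2" using N.finite_measure_Diff[of U "P k"] Um Pm PU k N(2) by simp
    \<comment> \<open>The \<open>k\<close> remaining sets may together contribute at most half of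
      the allowed error; the tail of the union contributes the other half.\<close>
    define d where "d = e / (2 * real k + 2)"
    have d: "d > 0" "k * d \<le> e/2" using Union.prems by (auto simp: d_def field_simps)
    have "\<forall>i. \<exists>n W. measure M (sym_diff (a i) {x. initial x n \<in> W}) < d \<and> measure N (sym_diff (a i) {x. initial x n \<in> W}) < d"
      using Union.IH d(1) by blast
    then obtain n W where nW: "\<And>i. measure M (sym_diff (a i) {x. initial x (n i) \<in> W i}) < d"
      "\<And>i. measure N (sym_diff (a i) {x. initial x (n i) \<in> W i}) < d" by metis
    \<comment> \<open>A common word length on which all the finitely many approximating sets
      depend.\<close>
    define l where "l = (\<Sum>i<k. n i)"
    have l: "n i \<le> l" if "i < k" for i unfolding l_def using that by (intro member_le_sum) auto
    define V where "V = {w. \<exists>i<k. take (n i) w \<in> W i}"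
    have V: "{x. initial x l \<in> V} = (\<Union>i<k. {x. initial x (n i) \<in> W i})"
      using l by (auto simp: V_def take_initial)
    have sub: "sym_diff U {x. initial x l \<in> V} \<subseteq> (U - P k) \<union> (\<Union>i<k. sym_diff (a i) {x. initial x (n i) \<in> W i})"
      unfolding V by (auto simp: U_def P_def)
    have bound: "measure L (sym_diff U {x. initial x l \<in> V}) < e"
      if L: "finite_measure L" "sets L = sets code_borel" "measure L (U - P k) < e/2"
        "\<And>i. measure L (sym_diff (a i) {x. initial x (n i) \<in> W i}) < d" for L
    proof -
      interpret L: finite_measure L by fact
      have sd: "sym_diff (a i) {x. initial x (n i) \<in> W i} \<in> sets L" for i
        using meas clop L(2) by auto
      have "measure L (sym_diff U {x. initial x l \<in> V}) \<le>
          measure L ((U - P k) \<union> (\<Union>i<k. sym_diff (a i) {x. initial x (n i) \<in> W i}))"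
        using sub sd Um Pm L(2) by (intro L.finite_measure_mono) auto
      also have "\<dots> \<le> measure L (U - P k) + measure L (\<Union>i<k. sym_diff (a i) {x. initial x (n i) \<in> W i})"
        using sd Um Pm L(2) by (intro measure_Un_le) auto
      also have "measure L (\<Union>i<k. sym_diff (a i) {x. initial x (n i) \<in> W i})
          \<le> (\<Sum>i<k. measure L (sym_diff (a i) {x. initial x (n i) \<in> W i}))"
        using sd by (intro measure_UNION_le) auto
      also have "\<dots> \<le> (\<Sum>i<k. d)" using L(4) by (intro sum_mono less_imp_le)
      finally show ?thesis using L(3) d by simp
    qed
    show ?case using bound[OF M dM nW(1)] bound[OF N dN nW(2)] unfolding U_def by blast
  qed
qed

lemma measure_clopen:
  fixes M :: "(nat \<Rightarrow> 'm::finite) measure"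
  assumes "finite_measure M" "sets M = sets code_borel"
  shows "measure M {x. initial x n \<in> W} = (\<Sum>w\<in>{w\<in>W. length w = n}. measure M (cylinder w))"
proof -
  interpret finite_measure M by fact
  have fin: "finite {w\<in>W. length w = n}" using finite_words[of n] by (rule rev_finite_subset) auto
  have "{x. initial x n \<in> W} = (\<Union>w\<in>{w\<in>W. length w = n}. cylinder w)"
  proof (intro set_eqI iffI)
    fix x assume "x \<in> {x. initial x n \<in> W}"
    then have "initial x n \<in> {w\<in>W. length w = n}" "x \<in> cylinder (initial x n)" by (simp_all add: mem_cylinder)
    then show "x \<in> (\<Union>w\<in>{w\<in>W. length w = n}. cylinder w)" by blast
  next
    fix x assume "x \<in> (\<Union>w\<in>{w\<in>W. length w = n}. cylinder w)"
    then obtain w where "w \<in> W" "length w = n" "initial x (length w) = w" unfolding mem_cylinder[symmetric] by blast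
    then show "x \<in> {x. initial x n \<in> W}" by (metis mem_Collect_eq)
  qed
  also have "measure M \<dots> = (\<Sum>w\<in>{w\<in>W. length w = n}. measure M (cylinder w))"
  proof (rule finite_measure_finite_Union[OF fin])
    show "disjoint_family_on cylinder {w \<in> W. length w = n}"
      unfolding disjoint_family_on_def by (intro ballI impI cylinder_disjoint) simp_all
  qed (simp add: assms(2) image_subset_iff)
  finally show ?thesis .
qed

text \<open>The inequality adds up over disjoint cylinders of equal length, hence holds for clopen
  sets, and survives approximation in both measures. It is applied to measures obtained by
  restricting \<open>\<mu>\<close> to a set.\<close>

lemma measure_le_by_cylinders:
  fixes M N :: "(nat \<Rightarrow> 'm::finite) measure"
  assumes M: "finite_measure M" "sets M = sets code_borel" and N: "finite_measure N" "sets N = sets code_borel"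
    and K: "0 \<le> K" and le: "\<And>w. measure M (cylinder w) \<le> K * measure N (cylinder w)"
    and A: "A \<in> sets code_borel"
  shows "measure M A \<le> K * measure N A"
proof (rule field_le_epsilon)
  interpret M: finite_measure M by fact
  interpret N: finite_measure N by fact
  fix e :: real assume e: "0 < e"
  \<comment> \<open>The approximation error enters once on the left and, multiplied by
    \<open>K\<close>, once on the right.\<close>
  define d where "d = e / (1 + K)"
  have "(1 + K) * d = e" using K by (simp add: d_def)
  moreover have "d + K * d = (1 + K) * d" by (simp only: ring_distribs mult_1)
  ultimately have d: "d > 0" "d + K * d = e" using e K by (simp_all only:) (simp add: d_def)
  obtain n W where nW: "measure M (sym_diff A {x. initial x n \<in> W}) < d" "measure N (sym_diff A {x. initial x n \<in> W}) < d"
    using clopen_approximation[OF M N A d(1)] by blast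
  let ?F = "{x. initial x n \<in> W}"
  have F: "?F \<in> sets code_borel"
  proof -
    have "{x \<in> space code_borel. initial x n \<in> W} \<in> sets code_borel" by measurable
    then show ?thesis by simp
  qed
  have MF: "measure M ?F \<le> K * measure N ?F"
    unfolding measure_clopen[OF M] measure_clopen[OF N] sum_distrib_left by (intro sum_mono le)
  have "measure M A \<le> measure M (?F \<union> sym_diff A ?F)"
    using A F M(2) by (intro M.finite_measure_mono) auto
  also have "\<dots> \<le> measure M ?F + measure M (sym_diff A ?F)"
    using A F M(2) by (intro measure_Un_le) auto
  finally have 1: "measure M A \<le> measure M ?F + d" using nW by simp
  have "measure N ?F \<le> measure N (A \<union> sym_diff A ?F)"
    using A F N(2) by (intro N.finite_measure_mono) auto
  also have "\<dots> \<le> measure N A + measure N (sym_diff A ?F)"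
    using A F N(2) by (intro measure_Un_le) auto
  finally have 2: "measure N ?F \<le> measure N A + d" using nW by simp
  have "measure M A \<le> K * (measure N A + d) + d"
    using 1 MF mult_left_mono[OF 2 K] by linarith
  then show "measure M A \<le> K * measure N A + e" using d(2) by (simp add: algebra_simps)
qed

section \<open>Approximate independence and ergodicity\<close>

locale quasi_bernoulli = prob_space \<mu> for \<mu> :: "(nat \<Rightarrow> 'm::finite) measure" +
  fixes c :: real
  assumes sets_mu [measurable_cong, simp]: "sets \<mu> = sets code_borel"
    and shift_inv: "shift_invariant \<mu>"
    and c_ge_1: "1 \<le> c"
    and append_le: "measure \<mu> (cylinder (u @ v)) \<le> c * measure \<mu> (cylinder u) * measure \<mu> (cylinder v)"
    and append_ge: "measure \<mu> (cylinder u) * measure \<mu> (cylinder v) \<le> c * measure \<mu> (cylinder (u @ v))"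
    and cylinder_pos: "0 < measure \<mu> (cylinder w)"
begin

lemma space_mu [simp]: "space \<mu> = UNIV"
  using sets_eq_imp_space_eq[OF sets_mu] by simp

lemma fin_mu: "finite_measure \<mu>"
  by unfold_locales

lemma sum_cylinders: "(\<Sum>w | length w = n. measure \<mu> (cylinder w)) = 1"
  using measure_clopen[OF fin_mu sets_mu, of n UNIV] prob_space by simp

lemma distr_shift: "distr \<mu> \<mu> shift = \<mu>"
proof (rule measure_eqI)
  fix A assume "A \<in> sets (distr \<mu> \<mu> shift)"
  then have A: "A \<in> sets \<mu>" by simp
  then have "emeasure (distr \<mu> \<mu> shift) A = emeasure \<mu> (shift -` A)"
    by (subst emeasure_distr) (auto simp: measurable_cong_sets[OF sets_mu sets_mu])
  then show "emeasure (distr \<mu> \<mu> shift) A = emeasure \<mu> A"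
    using shift_inv A by (auto simp: shift_invariant_def)
qed simp

lemma distr_shift_funpow: "distr \<mu> \<mu> (shift ^^ n) = \<mu>"
proof (induction n)
  case 0
  then show ?case by (simp add: id_def distr_id2)
next
  case (Suc n)
  have "distr \<mu> \<mu> (shift ^^ Suc n) = distr (distr \<mu> \<mu> (shift ^^ n)) \<mu> shift"
    by (subst distr_distr) (auto simp: measurable_cong_sets[OF sets_mu sets_mu])
  then show ?case by (simp only: Suc distr_shift)
qed

lemma integral_shift_funpow:
  assumes "f \<in> borel_measurable code_borel"
  shows "integral\<^sup>L \<mu> (\<lambda>x. f ((shift ^^ n) x) :: real) = integral\<^sup>L \<mu> f"
proof -
  have "integral\<^sup>L \<mu> f = integral\<^sup>L (distr \<mu> \<mu> (shift ^^ n)) f" by (simp add: distr_shift_funpow)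
  also have "\<dots> = integral\<^sup>L \<mu> (\<lambda>x. f ((shift ^^ n) x))"
    using assms by (intro integral_distr) (auto simp: measurable_cong_sets[OF sets_mu sets_mu] measurable_cong_sets[OF sets_mu refl])
  finally show ?thesis by simp
qed

lemma integrable_bounded:
  assumes "f \<in> borel_measurable code_borel" "\<And>x. \<bar>f x :: real\<bar> \<le> B"
  shows "integrable \<mu> f"
  using assms by (intro integrable_const_bound[of _ B]) (auto simp: measurable_cong_sets[OF sets_mu refl])

lemma integral_initial:
  fixes F :: "'m list \<Rightarrow> real"
  shows "integrable \<mu> (\<lambda>x. F (initial x n))"
    "integral\<^sup>L \<mu> (\<lambda>x. F (initial x n)) = (\<Sum>w | length w = n. measure \<mu> (cylinder w) * F w)"
proof -
  have eq: "F (initial x n) = (\<Sum>w | length w = n. F w * indicator (cylinder w) x)" for x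
  proof -
    have "(\<Sum>w | length w = n. F w * indicator (cylinder w) x) = (\<Sum>w | length w = n. if w = initial x n then F w else 0)"
      by (intro sum.cong) (auto simp: indicator_def mem_cylinder)
    then show ?thesis by simp
  qed
  have int: "integrable \<mu> (\<lambda>x. F w * indicator (cylinder w) x)" for w :: "'m list"
    by (intro integrable_mult_right integrable_real_indicator) (auto simp: less_top[symmetric])
  show "integrable \<mu> (\<lambda>x. F (initial x n))" unfolding eq using int by (intro Bochner_Integration.integrable_sum)
  have "integral\<^sup>L \<mu> (\<lambda>x. F (initial x n)) = (\<Sum>w | length w = n. integral\<^sup>L \<mu> (\<lambda>x. F w * indicator (cylinder w) x))"
    unfolding eq using int by (intro Bochner_Integration.integral_sum)
  also have "\<dots> = (\<Sum>w | length w = n. measure \<mu> (cylinder w) * F w)" by (simp add: mult.commute)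
  finally show "integral\<^sup>L \<mu> (\<lambda>x. F (initial x n)) = (\<Sum>w | length w = n. measure \<mu> (cylinder w) * F w)" .
qed

text \<open>As a function of \<open>E\<close>, the measure on the right is that of the restriction
  of \<open>\<mu>\<close> to the cylinder, pushed forward by a power of the shift. On cylinders the
  claim is \<open>append_ge\<close>, and comparison on cylinders extends to all Borel sets.\<close>

lemma cylinder_preimage_ge:
  assumes E: "E \<in> sets code_borel"
  shows "measure \<mu> (cylinder u) * measure \<mu> E \<le> c * measure \<mu> (cylinder u \<inter> (shift ^^ length u) -` E)"
proof -
  let ?D = "density \<mu> (indicator (cylinder u))"
  define N where "N = distr ?D code_borel (shift ^^ length u)"
  have mD: "shift ^^ length u \<in> measurable ?D code_borel"
    by (simp add: measurable_cong_sets[of ?D code_borel])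
  have N: "emeasure N A = emeasure \<mu> (cylinder u \<inter> (shift ^^ length u) -` A)" if A: "A \<in> sets code_borel" for A
  proof -
    have pre: "(shift ^^ length u) -` A \<in> sets \<mu>"
      using measurable_sets[OF measurable_shift_funpow A, of "length u"] by simp
    have "emeasure N A = emeasure ?D ((shift ^^ length u) -` A)"
      unfolding N_def using A by (subst emeasure_distr[OF mD]) auto
    also have "\<dots> = emeasure \<mu> (cylinder u \<inter> (shift ^^ length u) -` A)"
      using pre by (intro emeasure_restricted) auto
    finally show ?thesis .
  qed
  have Nm: "measure N A = measure \<mu> (cylinder u \<inter> (shift ^^ length u) -` A)" if A: "A \<in> sets code_borel" for A
    using N[OF A] by (simp add: measure_def)
  have Nf: "finite_measure N"
  proof (rule finite_measureI)
    have "emeasure N UNIV \<noteq> \<infinity>" by (simp add: N)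
    then show "emeasure N (space N) \<noteq> \<infinity>" by (simp add: N_def)
  qed
  have Ns: "sets N = sets code_borel" by (simp add: N_def)
  have le: "measure \<mu> (cylinder w) \<le> (c / measure \<mu> (cylinder u)) * measure N (cylinder w)" for w
    using append_ge[of u w] cylinder_pos[of u] by (simp add: Nm cylinder_append field_simps)
  have "0 \<le> c / measure \<mu> (cylinder u)" using c_ge_1 by simp
  from measure_le_by_cylinders[OF fin_mu sets_mu Nf Ns this le E]
  have "measure \<mu> E \<le> (c / measure \<mu> (cylinder u)) * measure N E" .
  then show ?thesis using cylinder_pos[of u] Nm[OF E] by (simp add: field_simps)
qed

text \<open>If \<open>A\<close> has positive measure, independence up to a constant gives
  \<open>\<sigma>^{-n} A\<close>, hence also \<open>A\<close>, a fixed proportion of every cylinder.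
  So \<open>\<mu>\<close> is dominated by a multiple of its restriction to \<open>A\<close>, and
  that restriction does not charge the complement. Only an inclusion is asked of \<open>A\<close>,
  as this is what the exceptional set of a subadditive cocycle provides.\<close>

lemma ergodic:
  assumes A: "A \<in> sets code_borel" and inv: "shift -` A \<subseteq> A"
  shows "measure \<mu> A = 0 \<or> measure \<mu> A = 1"
proof (rule disjCI)
  assume "measure \<mu> A \<noteq> 1"
  have invn: "(shift ^^ n) -` A \<subseteq> A" for n
  proof (induction n)
    case (Suc n)
    have "(shift ^^ Suc n) -` A = (shift ^^ n) -` (shift -` A)" by auto
    also have "\<dots> \<subseteq> (shift ^^ n) -` A" using inv by blast
    finally show ?case using Suc by blast
  qed simp
  show "measure \<mu> A = 0"
  proof (rule ccontr)
    assume "measure \<mu> A \<noteq> 0"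
    then have pos: "0 < measure \<mu> A" by (simp add: zero_less_measure_iff)
    define N where "N = density \<mu> (indicator A)"
    have N: "measure N B = measure \<mu> (A \<inter> B)" if "B \<in> sets code_borel" for B
    proof -
      have "emeasure N B = emeasure \<mu> (A \<inter> B)"
        unfolding N_def using that A by (intro emeasure_restricted) auto
      then show ?thesis by (simp add: measure_def)
    qed
    have Nf: "finite_measure N"
    proof (rule finite_measureI)
      have "emeasure N (space N) = emeasure \<mu> (A \<inter> UNIV)"
        unfolding N_def using A emeasure_restricted[of A \<mu> UNIV] by simp
      then show "emeasure N (space N) \<noteq> \<infinity>" by simp
    qed
    have Ns: "sets N = sets code_borel" by (simp add: N_def)
    have le: "measure \<mu> (cylinder w) \<le> (c / measure \<mu> A) * measure N (cylinder w)" for w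
    proof -
      have "measure \<mu> (cylinder w) * measure \<mu> A \<le> c * measure \<mu> (cylinder w \<inter> (shift ^^ length w) -` A)"
        by (rule cylinder_preimage_ge[OF A])
      also have "\<dots> \<le> c * measure \<mu> (A \<inter> cylinder w)"
        using c_ge_1 A invn by (intro mult_left_mono finite_measure_mono) auto
      finally show ?thesis using pos by (simp add: N field_simps)
    qed
    have cA: "- A \<in> sets code_borel" using A sets.compl_sets[of A code_borel] by (simp add: Compl_eq_Diff_UNIV)
    have "0 \<le> c / measure \<mu> A" using c_ge_1 by simp
    from measure_le_by_cylinders[OF fin_mu sets_mu Nf Ns this le cA]
    have "measure \<mu> (- A) \<le> (c / measure \<mu> A) * measure N (- A)" .
    also have "measure N (- A) = 0" using N[OF \<open>- A \<in> sets code_borel\<close>] by simp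
    finally have "measure \<mu> (- A) \<le> 0" by simp
    moreover have "measure \<mu> (- A) = 1 - measure \<mu> A" using prob_compl[of A] A by (simp add: Compl_eq_Diff_UNIV)
    ultimately show False using \<open>measure \<mu> A \<noteq> 1\<close> prob_le_1[of A] by linarith
  qed
qed

end

section \<open>Fekete's lemma and the subadditive ergodic theorem\<close>

lemma fekete:
  fixes a :: "nat \<Rightarrow> real"
  assumes sub: "\<And>m n. a (m + n) \<le> a m + a n" and lb: "\<And>n. - K * real n \<le> a n"
  shows "\<exists>l. (\<lambda>n. a n / real n) \<longlonglongrightarrow> l \<and> (\<forall>n. l * real n \<le> a n)"
proof -
  define l where "l = (INF n\<in>{1..}. a n / real n)"
  have bdd: "bdd_below ((\<lambda>n. a n / real n) ` {1..})"
  proof (rule bdd_belowI2)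
    fix n :: nat assume "n \<in> {1..}"
    then show "- K \<le> a n / real n" using lb[of n] by (simp add: field_simps)
  qed
  have low: "l \<le> a n / real n" if "n \<ge> 1" for n
    unfolding l_def using bdd that by (intro cINF_lower) auto
  have a0: "0 \<le> a 0" using lb[of 0] by simp
  have mult: "a (q * n + r) \<le> real q * a n + a r" for q n r
  proof (induction q)
    case (Suc q)
    have "a (Suc q * n + r) \<le> a n + a (q * n + r)" using sub[of n "q * n + r"] by (simp add: add.assoc)
    then show ?case using Suc by (simp add: algebra_simps)
  qed simp
  have "(\<lambda>n. a n / real n) \<longlonglongrightarrow> l"
  proof (rule LIMSEQ_I)
    fix e :: real assume e: "0 < e"
    have "\<exists>n\<in>{1..}. a n / real n < l + e / 2"
    proof (rule ccontr)
      assume "\<not> ?thesis"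
      then have "l + e / 2 \<le> l" unfolding l_def by (intro cINF_greatest) (auto simp: not_less l_def)
      then show False using e by simp
    qed
    then obtain k where k: "k \<ge> 1" "a k / real k < l + e / 2" by auto
    \<comment> \<open>Division with remainder by \<open>k\<close> leaves a tail of fewer than
      \<open>k\<close> indices and a rounding error of at most \<open>\<bar>a k\<bar>\<close>;
      \<open>D\<close> bounds both uniformly.\<close>
    define D where "D = (MAX r\<in>{..k}. \<bar>a r\<bar>) + \<bar>a k\<bar>"
    have D: "\<bar>a r\<bar> + \<bar>a k\<bar> \<le> D" if "r < k" for r unfolding D_def using that by (intro add_right_mono Max_ge) auto
    obtain n0 where n0: "D / (e / 2) < real n0" using reals_Archimedean2 by blast
    have "norm (a n / real n - l) < e" if n: "n \<ge> max 1 n0" for n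
    proof -
      have n1: "n \<ge> 1" using n by simp
      define q r where "q = n div k" "r = n mod k"
      have nq: "n = q * k + r" "r < k" using k by (auto simp: q_r_def)
      have "a n \<le> real q * a k + a r" using mult[of q k r] nq by simp
      also have "real q * a k = real n * (a k / real k) - real r * (a k / real k)"
        using k(1) by (subst nq(1)) (simp add: field_simps)
      also have "- (real r * (a k / real k)) \<le> \<bar>a k\<bar>"
      proof -
        have "\<bar>real r * (a k / real k)\<bar> = (real r / real k) * \<bar>a k\<bar>" by (simp add: abs_mult)
        also have "\<dots> \<le> 1 * \<bar>a k\<bar>" using nq(2) by (intro mult_right_mono) auto
        finally show ?thesis by linarith
      qed
      then have "real n * (a k / real k) - real r * (a k / real k) + a r \<le> real n * (a k / real k) + D"
        using D[OF nq(2)] by linarith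
      finally have "a n \<le> real n * (a k / real k) + D" by simp
      also have "\<dots> < real n * (l + e / 2) + D" using k(2) n1 by (intro add_strict_right_mono mult_strict_left_mono) auto
      also have "D < real n * (e / 2)"
      proof -
        have "D / (e / 2) < real n" using n0 n by simp
        then show ?thesis using e by (simp add: field_simps)
      qed
      then have "real n * (l + e / 2) + D < real n * (l + e)" by (simp add: algebra_simps)
      finally have "a n / real n < l + e" using n1 by (simp add: field_simps)
      then show ?thesis using low[OF n1] e by (simp add: abs_less_iff)
    qed
    then show "\<exists>no. \<forall>n\<ge>no. norm (a n / real n - l) < e" by blast
  qed
  moreover have "l * real n \<le> a n" for n
    using low[of n] a0 by (cases "n = 0") (auto simp: field_simps)
  ultimately show ?thesis by blast
qed

context quasi_bernoulli
begin

lemma prob_UNIV [simp]: "measure \<mu> UNIV = 1"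
  using prob_space by simp

text \<open>The averaging argument of Katznelson and Weiss: if \<open>G n < \<beta> n\<close> happens infinitely often, then it
  happens almost everywhere by ergodicity, and an orbit is covered up to a small proportion by
  disjoint blocks of bounded length on which the average of \<open>G\<close> is less than \<open>\<beta>\<close>.\<close>

lemma subadditive_cocycle_ge:
  fixes G :: "nat \<Rightarrow> (nat \<Rightarrow> 'm) \<Rightarrow> real"
  assumes meas [measurable]: "\<And>n. G n \<in> borel_measurable code_borel"
    and sub: "\<And>m n x. G (m + n) x \<le> G m x + G n ((shift ^^ m) x)"
    and bound: "\<And>n x. \<bar>G n x\<bar> \<le> K * real n"
    and lam: "\<And>n. lam * real n \<le> integral\<^sup>L \<mu> (G n)"
    and beta: "\<beta> < lam"
  shows "AE x in \<mu>. \<forall>\<^sub>F n in sequentially. \<beta> * real n \<le> G n x"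
proof -
  define \<gamma> where "\<gamma> = (\<beta> + lam) / 2"
  have g: "\<beta> < \<gamma>" "\<gamma> < lam" using beta by (auto simp: \<gamma>_def)
  have K: "0 \<le> K" using bound[of 1 undefined] by simp
  \<comment> \<open>The margin \<open>1 / (real k + 1)\<close> is existentially quantified so that
    \<open>A\<close> absorbs preimages under the shift: prepending a letter costs a bounded amount,
    which the passage from \<open>k\<close> to \<open>Suc k\<close> pays for once \<open>n\<close>
    is large.\<close>
  define A where "A = {x. \<exists>k::nat. \<exists>\<^sub>F n in sequentially. G n x < (\<gamma> - 1 / (real k + 1)) * real n}"
  have "{x \<in> space code_borel. \<exists>k::nat. \<forall>N. \<exists>n\<ge>N. G n x < (\<gamma> - 1 / (real k + 1)) * real n} \<in> sets code_borel"
    by measurable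
  then have A: "A \<in> sets code_borel" by (simp add: A_def frequently_sequentially)
  have inv: "shift -` A \<subseteq> A"
  proof
    fix x assume "x \<in> shift -` A"
    then obtain k where k: "\<exists>\<^sub>F n in sequentially. G n (shift x) < (\<gamma> - 1 / (real k + 1)) * real n"
      by (auto simp: A_def)
    define d where "d = 1 / (real k + 1) - 1 / (real (Suc k) + 1)"
    have d: "d > 0" unfolding d_def by (simp add: divide_strict_left_mono)
    define b where "b = \<gamma> - 1 / (real (Suc k) + 1)"
    have bd: "\<gamma> - 1 / (real k + 1) = b - d" by (simp add: b_def d_def)
    obtain n0 where n0: "(K + \<bar>b\<bar>) / d < real n0" using reals_Archimedean2 by blast
    have "\<exists>n'\<ge>N. G n' x < b * real n'" for N
    proof -
      obtain n where n: "n \<ge> max N n0" "G n (shift x) < (b - d) * real n"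
        using k unfolding bd frequently_sequentially by meson
      have "(K + \<bar>b\<bar>) / d < real n" using n0 n(1) by simp
      then have "K + \<bar>b\<bar> < d * real n" using d by (simp add: field_simps)
      moreover have "G (Suc n) x \<le> G 1 x + G n (shift x)" using sub[of 1 n x] by simp
      moreover have "G 1 x \<le> K" using bound[of 1 x] by simp
      ultimately have "G (Suc n) x < b * real (Suc n)" using n(2) by (simp add: algebra_simps)
      then show ?thesis using n(1) by (intro exI[of _ "Suc n"]) auto
    qed
    then have "\<exists>\<^sub>F n in sequentially. G n x < (\<gamma> - 1 / (real (Suc k) + 1)) * real n"
      unfolding frequently_sequentially b_def by blast
    then show "x \<in> A" unfolding A_def by blast
  qed
  have "measure \<mu> A \<noteq> 1"
  proof
    assume A1: "measure \<mu> A = 1"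
    define D where "D = K + \<bar>\<gamma>\<bar>"
    have D0: "0 \<le> D" using K by (simp add: D_def)
    \<comment> \<open>The points at which no good block of length at most \<open>N\<close> starts.
      They decrease to a set disjoint from \<open>A\<close>, so their measure tends to 0 if
      \<open>A\<close> has full measure.\<close>
    define B where "B N = {x. \<forall>n\<in>{1..N}. \<gamma> * real n \<le> G n x}" for N
    have B: "B N \<in> sets code_borel" for N
    proof -
      have "{x \<in> space code_borel. \<forall>n\<in>{1..N}. \<gamma> * real n \<le> G n x} \<in> sets code_borel" by measurable
      then show ?thesis by (simp add: B_def)
    qed
    have "decseq B" by (auto simp: decseq_def B_def)
    then have "(\<lambda>N. measure \<mu> (B N)) \<longlonglongrightarrow> measure \<mu> (\<Inter>N. B N)"
      using B by (intro finite_Lim_measure_decseq) auto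
    moreover have "measure \<mu> (\<Inter>N. B N) = 0"
    proof -
      have sub: "(\<Inter>N. B N) \<subseteq> - A"
      proof
        fix x assume x: "x \<in> (\<Inter>N. B N)"
        have ge: "\<gamma> * real n \<le> G n x" if "n \<ge> 1" for n
        proof -
          have "x \<in> B n" using x by blast
          then show ?thesis using that by (simp add: B_def)
        qed
        show "x \<in> - A"
        proof
          assume "x \<in> A"
          then obtain k n where n: "n \<ge> 1" "G n x < (\<gamma> - 1 / (real (k::nat) + 1)) * real n"
            unfolding A_def frequently_sequentially by blast
          have "(\<gamma> - 1 / (real k + 1)) * real n \<le> \<gamma> * real n" by (intro mult_right_mono) auto
          then show False using n ge[OF n(1)] by linarith
        qed
      qed
      have "measure \<mu> (\<Inter>N. B N) \<le> measure \<mu> (- A)"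
        using sub A sets.compl_sets[of A code_borel] by (intro finite_measure_mono) (auto simp: Compl_eq_Diff_UNIV)
      also have "\<dots> = 0" using prob_compl[of A] A A1 by (simp add: Compl_eq_Diff_UNIV)
      finally show ?thesis by (simp add: measure_le_0_iff)
    qed
    ultimately have "(\<lambda>N. measure \<mu> (B N)) \<longlonglongrightarrow> 0" by simp
    \<comment> \<open>The threshold is chosen so that visits to \<open>B N\<close>, at cost
      \<open>D\<close> each, use up on average at most half of the gap between
      \<open>\<gamma>\<close> and \<open>lam\<close>.\<close>
    moreover have "0 < (lam - \<gamma>) / (2 * (D + 1))" using g D0 by simp
    ultimately have "\<forall>\<^sub>F N in sequentially. measure \<mu> (B N) < (lam - \<gamma>) / (2 * (D + 1))" by (rule order_tendstoD)
    then obtain N where N: "measure \<mu> (B N) < (lam - \<gamma>) / (2 * (D + 1))" by (auto simp: eventually_sequentially)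
    let ?I = "\<lambda>x. indicator (B N) x :: real"
    \<comment> \<open>Read the orbit from the left: outside \<open>B N\<close> a good block is
      consumed at rate \<open>\<gamma>\<close>; inside \<open>B N\<close> a single letter is skipped
      at an extra cost of at most \<open>D\<close>; the last stretch of length at most
      \<open>N\<close> costs at most \<open>D * real N\<close>.\<close>
    have greedy: "G L x \<le> \<gamma> * real L + D * (\<Sum>j<L. ?I ((shift ^^ j) x)) + D * real N" for L x
    proof (induction L arbitrary: x rule: less_induct)
      case (less L)
      have S0: "0 \<le> D * (\<Sum>j<L. ?I ((shift ^^ j) x))" using D0 by (intro mult_nonneg_nonneg sum_nonneg) auto
      show ?case
      proof (cases "L \<le> N")
        case True
        have "G L x \<le> K * real L" using bound[of L x] by simp
        also have "\<dots> \<le> \<gamma> * real L + D * real L"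
        proof -
          have "0 \<le> (\<gamma> + \<bar>\<gamma>\<bar>) * real L" by (intro mult_nonneg_nonneg) auto
          then show ?thesis by (simp add: D_def algebra_simps)
        qed
        also have "D * real L \<le> D * real N" using True D0 by (intro mult_left_mono) auto
        finally show ?thesis using S0 by simp
      next
        case False
        show ?thesis
        proof (cases "x \<in> B N")
          case True
          obtain L' where L': "L = Suc L'" using False by (cases L) auto
          have "G L x \<le> G 1 x + G L' (shift x)" using sub[of 1 L' x] L' by simp
          also have "G 1 x \<le> K" using bound[of 1 x] by simp
          also have "G L' (shift x) \<le> \<gamma> * real L' + D * (\<Sum>j<L'. ?I ((shift ^^ j) (shift x))) + D * real N"
            using less L' by simp
          also have "(\<Sum>j<L'. ?I ((shift ^^ j) (shift x))) = (\<Sum>j<L. ?I ((shift ^^ j) x)) - 1"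
            using True unfolding L' by (subst sum.lessThan_Suc_shift) (simp add: funpow_swap1)
          finally show ?thesis unfolding L' D_def by (simp add: algebra_simps)
        next
          case nB: False
          then obtain n where n: "n \<in> {1..N}" "G n x < \<gamma> * real n" by (auto simp: B_def not_le)
          then have nL: "n < L" "0 < n" using False by auto
          have "G L x \<le> G n x + G (L - n) ((shift ^^ n) x)" using sub[of n "L - n" x] nL by simp
          also have "G (L - n) ((shift ^^ n) x) \<le> \<gamma> * real (L - n) + D * (\<Sum>j<L - n. ?I ((shift ^^ j) ((shift ^^ n) x))) + D * real N"
            using nL by (intro less.IH) simp
          also have "(\<Sum>j<L - n. ?I ((shift ^^ j) ((shift ^^ n) x))) = (\<Sum>j\<in>{n..<L}. ?I ((shift ^^ j) x))"
            using nL by (intro sum.reindex_bij_witness[of _ "\<lambda>j. j - n" "\<lambda>j. j + n"]) (auto simp: funpow_add)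
          also have "\<dots> \<le> (\<Sum>j<L. ?I ((shift ^^ j) x))" by (intro sum_mono2) auto
          finally have "G L x \<le> G n x + (\<gamma> * real (L - n) + D * (\<Sum>j<L. ?I ((shift ^^ j) x)) + D * real N)"
            using D0 by (simp add: mult_left_mono)
          moreover have "\<gamma> * real (L - n) = \<gamma> * real L - \<gamma> * real n" using nL by (simp add: of_nat_diff algebra_simps)
          ultimately show ?thesis using n(2) by simp
        qed
      qed
    qed
    have Im: "?I \<in> borel_measurable code_borel" using B by measurable
    have Ij: "(\<lambda>x. ?I ((shift ^^ j) x)) \<in> borel_measurable code_borel" for j
      using measurable_compose[OF measurable_shift_funpow Im] .
    have Iint: "integrable \<mu> (\<lambda>x. ?I ((shift ^^ j) x))" for j
      by (rule integrable_bounded[OF Ij, of _ 1]) (auto simp: indicator_def)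
    \<comment> \<open>Integration with shift invariance turns the pointwise estimate into a bound on
      the mean of \<open>G L\<close>, which contradicts the lower bound \<open>lam * real L\<close>
      once \<open>L\<close> is large.\<close>
    have main: "lam * real L \<le> \<gamma> * real L + D * (real L * measure \<mu> (B N)) + D * real N" for L
    proof -
      have "lam * real L \<le> integral\<^sup>L \<mu> (G L)" by (rule lam)
      also have "\<dots> \<le> integral\<^sup>L \<mu> (\<lambda>x. \<gamma> * real L + D * (\<Sum>j<L. ?I ((shift ^^ j) x)) + D * real N)"
        using greedy Iint integrable_bounded[OF meas bound]
        by (intro integral_mono) auto
      also have "\<dots> = \<gamma> * real L + D * (\<Sum>j<L. integral\<^sup>L \<mu> (\<lambda>x. ?I ((shift ^^ j) x))) + D * real N"
        using Iint by simp
      also have "(\<Sum>j<L. integral\<^sup>L \<mu> (\<lambda>x. ?I ((shift ^^ j) x))) = (\<Sum>j<L. measure \<mu> (B N))"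
        using integral_shift_funpow[OF Im] B by simp
      finally show ?thesis by simp
    qed
    have small: "D * measure \<mu> (B N) \<le> (lam - \<gamma>) / 2"
    proof -
      have "D * measure \<mu> (B N) \<le> (D + 1) * ((lam - \<gamma>) / (2 * (D + 1)))" using N D0 by (intro mult_mono) auto
      also have "\<dots> = (lam - \<gamma>) / 2" using D0 by (simp add: field_simps)
      finally show ?thesis .
    qed
    obtain L :: nat where L: "D * real N / ((lam - \<gamma>) / 2) < real L" using reals_Archimedean2 by blast
    have "D * real N < (lam - \<gamma>) / 2 * real L" using L g by (simp add: field_simps)
    moreover have "real L * (D * measure \<mu> (B N)) \<le> real L * ((lam - \<gamma>) / 2)"
      using small by (intro mult_left_mono) auto
    ultimately show False using main[of L] by (simp add: algebra_simps)
  qed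
  then have "measure \<mu> A = 0" using ergodic[OF A inv] by blast
  then have "AE x in \<mu>. x \<notin> A" using A by (intro AE_not_in) (auto simp: null_sets_def emeasure_eq_measure)
  then show ?thesis
  proof (rule AE_mp, intro AE_I2 impI)
    fix x assume x: "x \<notin> A"
    obtain k :: nat where "1 / (\<gamma> - \<beta>) < real k" using reals_Archimedean2 by blast
    then have k: "1 / (real k + 1) < \<gamma> - \<beta>" using g by (simp add: field_simps)
    have "\<forall>\<^sub>F n in sequentially. (\<gamma> - 1 / (real k + 1)) * real n \<le> G n x"
      using x by (auto simp: A_def not_frequently not_less)
    then show "\<forall>\<^sub>F n in sequentially. \<beta> * real n \<le> G n x"
    proof eventually_elim
      case (elim n)
      have "\<beta> * real n \<le> (\<gamma> - 1 / (real k + 1)) * real n" using k by (intro mult_right_mono) auto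
      then show ?case using elim by linarith
    qed
  qed
qed

text \<open>Cutting a word into blocks of length \<open>k\<close> can be done at \<open>k\<close>
  different offsets; added over all offsets, every window of length \<open>k\<close> is counted
  once. The three boundary terms \<open>K * k * k\<close> come from the initial pieces, the final
  tails, and the windows that overrun the first \<open>n\<close> letters.\<close>

lemma subadditive_block_le:
  fixes F :: "'m list \<Rightarrow> real"
  assumes sub: "\<And>u v. F (u @ v) \<le> F u + F v" and bound: "\<And>w. \<bar>F w\<bar> \<le> K * real (length w)"
    and kn: "k \<le> n"
  shows "real k * F (initial x n) \<le> (\<Sum>j<n. F (initial ((shift ^^ j) x) k)) + 3 * K * real k * real k"
proof -
  have K: "0 \<le> K" using bound[of "[undefined]"] by simp
  have bd: "\<bar>F (initial y i)\<bar> \<le> K * real k" if "i \<le> k" for y i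
  proof -
    have "\<bar>F (initial y i)\<bar> \<le> K * real i" using bound[of "initial y i"] by simp
    also have "\<dots> \<le> K * real k" using that K by (intro mult_left_mono) auto
    finally show ?thesis .
  qed
  \<comment> \<open>\<open>Z a\<close> collects the tails that start at
    \<open>a, ..., a + k - 1\<close> and end at \<open>n\<close>. Moving \<open>a\<close> by one
    replaces the first tail by a tail starting \<open>k\<close> letters later, at the price of one
    window.\<close>
  define Z where "Z a = (\<Sum>i<k. F (initial ((shift ^^ (a + i)) x) (n - a - i)))" for a
  have step: "Z a \<le> F (initial ((shift ^^ a) x) k) + Z (Suc a)" if a: "a + k \<le> n" for a
  proof -
    define f where "f i = F (initial ((shift ^^ (a + i)) x) (n - a - i))" for i
    have "Z a = (\<Sum>i<k. f i)" by (simp add: Z_def f_def)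
    also have "\<dots> + f k = f 0 + (\<Sum>i<k. f (Suc i))"
      using sum.lessThan_Suc_shift[of f k] by simp
    also have "(\<Sum>i<k. f (Suc i)) = Z (Suc a)" by (simp add: Z_def f_def)
    finally have "Z a + f k = f 0 + Z (Suc a)" .
    moreover have "f 0 \<le> F (initial ((shift ^^ a) x) k) + f k"
    proof -
      have "initial ((shift ^^ a) x) (n - a) = initial ((shift ^^ a) x) k @ initial ((shift ^^ (a + k)) x) (n - a - k)"
        using initial_add[of "(shift ^^ a) x" k "n - a - k"] a by (simp add: shift_funpow add_ac)
      then show ?thesis using sub by (simp add: f_def)
    qed
    ultimately show ?thesis by simp
  qed
  have tele: "M + k \<le> Suc n \<Longrightarrow> Z 0 \<le> (\<Sum>a<M. F (initial ((shift ^^ a) x) k)) + Z M" for M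
  proof (induction M)
    case (Suc M)
    then show ?case using step[of M] by simp
  qed simp
  define M where "M = Suc n - k"
  have M: "M \<le> n \<or> k = 0" "M + k = Suc n" using kn by (auto simp: M_def)
  have ZM: "Z M \<le> real k * (K * real k)"
  proof -
    have "Z M \<le> (\<Sum>i<k. K * real k)" unfolding Z_def
      using M(2) by (intro sum_mono order.trans[OF abs_ge_self bd]) auto
    then show ?thesis by simp
  qed
  have "real k * F (initial x n) = (\<Sum>i<k. F (initial x n))" by simp
  also have "\<dots> \<le> (\<Sum>i<k. K * real k + F (initial ((shift ^^ i) x) (n - i)))"
  proof (rule sum_mono)
    fix i assume i: "i \<in> {..<k}"
    have "initial x n = initial x i @ initial ((shift ^^ i) x) (n - i)"
      using initial_add[of x i "n - i"] i kn by simp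
    then have "F (initial x n) \<le> F (initial x i) + F (initial ((shift ^^ i) x) (n - i))" using sub by simp
    moreover have "F (initial x i) \<le> K * real k" using bd[of i x] i by auto
    ultimately show "F (initial x n) \<le> K * real k + F (initial ((shift ^^ i) x) (n - i))" by simp
  qed
  also have "\<dots> = real k * (K * real k) + Z 0" by (simp add: Z_def sum.distrib)
  finally have "real k * F (initial x n) \<le> real k * (K * real k) + Z 0" .
  have 1: "real k * F (initial x n) \<le> real k * (K * real k) + (\<Sum>a<M. F (initial ((shift ^^ a) x) k)) + real k * (K * real k)"
  proof -
    have "Z 0 \<le> (\<Sum>a<M. F (initial ((shift ^^ a) x) k)) + Z M" by (rule tele) (simp add: M(2))
    then show ?thesis using ZM \<open>real k * F (initial x n) \<le> real k * (K * real k) + Z 0\<close> by linarith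
  qed
  show ?thesis
  proof (cases "k = 0")
    case False
    then have Mn: "M \<le> n" using M by simp
    \<comment> \<open>The sum is extended to all \<open>n\<close> starting points, so that it
      becomes a Birkhoff sum; the at most \<open>k\<close> windows added are bounded below.\<close>
    have "(\<Sum>a<M. F (initial ((shift ^^ a) x) k)) = (\<Sum>a<n. F (initial ((shift ^^ a) x) k)) - (\<Sum>a\<in>{M..<n}. F (initial ((shift ^^ a) x) k))"
    proof -
      have "{..<n} = {..<M} \<union> {M..<n}" using Mn by auto
      then show ?thesis by (simp add: sum.union_disjoint ivl_disj_int)
    qed
    moreover have "- (\<Sum>a\<in>{M..<n}. F (initial ((shift ^^ a) x) k)) \<le> real k * (K * real k)"
    proof -
      have "- (\<Sum>a\<in>{M..<n}. F (initial ((shift ^^ a) x) k)) \<le> (\<Sum>a\<in>{M..<n}. K * real k)"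
        unfolding sum_negf[symmetric] using bd by (intro sum_mono order.trans[OF abs_ge_minus_self]) auto
      also have "\<dots> = real (n - M) * (K * real k)" by simp
      also have "\<dots> \<le> real k * (K * real k)" using M(2) K False by (intro mult_right_mono) auto
      finally show ?thesis .
    qed
    ultimately show ?thesis using 1 by (simp add: algebra_simps)
  qed (use bound[of "[]"] in simp)
qed

text \<open>The sum of windows is additive along the orbit, so \<open>subadditive_cocycle_ge\<close>
  applies to its negative and bounds it from above. Thus the one-sided ergodic estimate already
  yields the Birkhoff bound needed here.\<close>

lemma subadditive_limsup_le:
  fixes F :: "'m list \<Rightarrow> real"
  assumes sub: "\<And>u v. F (u @ v) \<le> F u + F v" and bound: "\<And>w. \<bar>F w\<bar> \<le> K * real (length w)"
    and k: "1 \<le> k" and less: "(\<Sum>w | length w = k. measure \<mu> (cylinder w) * F w) < \<gamma> * real k"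
  shows "AE x in \<mu>. \<forall>\<^sub>F n in sequentially. F (initial x n) \<le> \<gamma> * real n"
proof -
  define I where "I = (\<Sum>w | length w = k. measure \<mu> (cylinder w) * F w)"
  define f where "f x = F (initial x k)" for x
  have fm: "f \<in> borel_measurable code_borel" unfolding f_def by measurable
  have fb: "\<bar>f x\<bar> \<le> K * real k" for x using bound[of "initial x k"] by (simp add: f_def)
  have fI: "integral\<^sup>L \<mu> f = I" unfolding f_def I_def by (rule integral_initial(2))
  define G where "G n x = - (\<Sum>j<n. f ((shift ^^ j) x))" for n x
  have fj: "(\<lambda>x. f ((shift ^^ j) x)) \<in> borel_measurable code_borel" for j
    using measurable_compose[OF measurable_shift_funpow fm] .
  have Gm: "G n \<in> borel_measurable code_borel" for n unfolding G_def using fj by measurable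
  have Gadd: "G (m + n) x = G m x + G n ((shift ^^ m) x)" for m n x
  proof -
    have "(\<Sum>j<m + n. f ((shift ^^ j) x)) = (\<Sum>j<m. f ((shift ^^ j) x)) + (\<Sum>j<n. f ((shift ^^ (j + m)) x))"
      by (induction n) (auto simp: add_ac)
    then show ?thesis by (simp add: G_def funpow_add)
  qed
  have Gb: "\<bar>G n x\<bar> \<le> (K * real k) * real n" for n x
  proof -
    have "\<bar>G n x\<bar> \<le> (\<Sum>j<n. \<bar>f ((shift ^^ j) x)\<bar>)" unfolding G_def by (simp add: sum_abs)
    also have "\<dots> \<le> (\<Sum>j<n. K * real k)" by (intro sum_mono fb)
    finally show ?thesis by (simp add: mult.commute)
  qed
  have Gi: "- I * real n \<le> integral\<^sup>L \<mu> (G n)" for n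
  proof -
    have "integral\<^sup>L \<mu> (G n) = - (\<Sum>j<n. integral\<^sup>L \<mu> (\<lambda>x. f ((shift ^^ j) x)))"
      unfolding G_def using integrable_bounded[OF fj fb] by simp
    then show ?thesis using integral_shift_funpow[OF fm] fI by simp
  qed
  \<comment> \<open>Half the gap: one \<open>\<delta>\<close> goes into the ergodic estimate and one
    into the boundary terms, and \<open>I + 2 * \<delta> = \<gamma> * real k\<close>.\<close>
  define \<delta> where "\<delta> = (\<gamma> * real k - I) / 2"
  have \<delta>: "0 < \<delta>" using less by (simp add: \<delta>_def I_def)
  have "AE x in \<mu>. \<forall>\<^sub>F n in sequentially. (- I - \<delta>) * real n \<le> G n x"
    by (rule subadditive_cocycle_ge[OF Gm _ Gb Gi]) (use \<delta> Gadd in auto)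
  then show ?thesis
  proof (rule AE_mp, intro AE_I2 impI)
    fix x assume ev: "\<forall>\<^sub>F n in sequentially. (- I - \<delta>) * real n \<le> G n x"
    obtain n0 :: nat where n0: "3 * K * real k * real k / \<delta> < real n0" using reals_Archimedean2 by blast
    show "\<forall>\<^sub>F n in sequentially. F (initial x n) \<le> \<gamma> * real n"
      using ev eventually_ge_at_top[of "max k n0"]
    proof eventually_elim
      case (elim n)
      have "3 * K * real k * real k / \<delta> < real n" using n0 elim(2) by simp
      then have c: "3 * K * real k * real k \<le> \<delta> * real n" using \<delta> by (simp add: field_simps)
      have "real k * F (initial x n) \<le> (\<Sum>j<n. f ((shift ^^ j) x)) + 3 * K * real k * real k"
        unfolding f_def using elim(2) by (intro subadditive_block_le[OF sub bound]) auto
      also have "(\<Sum>j<n. f ((shift ^^ j) x)) \<le> (I + \<delta>) * real n" using elim(1) by (simp add: G_def algebra_simps)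
      finally have "real k * F (initial x n) \<le> (I + \<delta>) * real n + \<delta> * real n" using c by simp
      also have "\<dots> = real k * (\<gamma> * real n)" by (simp add: \<delta>_def field_simps)
      finally show ?case using k by simp
    qed
  qed
qed

text \<open>The constant \<open>C\<close> is absorbed by adding it to \<open>F\<close>, which
  changes nothing after division by \<open>n\<close>. The limit comes from Fekete's lemma for the
  means; the upper bound uses one block length whose mean is nearly optimal, the lower bound the
  averaging argument for cocycles.\<close>

lemma kingman:
  fixes F :: "'m list \<Rightarrow> real"
  assumes sub: "\<And>u v. F (u @ v) \<le> F u + F v + C" and bound: "\<And>w. \<bar>F w\<bar> \<le> K * real (length w) + K"
  shows "\<exists>l. (\<lambda>n. 1 / real n * (\<Sum>w | length w = n. measure \<mu> (cylinder w) * F w)) \<longlonglongrightarrow> l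
    \<and> (\<forall>\<gamma>>l. AE x in \<mu>. \<forall>\<^sub>F n in sequentially. F (initial x n) \<le> \<gamma> * real n)
    \<and> (\<forall>\<beta><l. AE x in \<mu>. \<forall>\<^sub>F n in sequentially. \<beta> * real n \<le> F (initial x n))"
proof -
  have K: "0 \<le> K" using bound[of "[]"] by simp
  \<comment> \<open>The value 0 at the empty word keeps \<open>H\<close> subadditive there and makes
    it bounded by a multiple of the length with no additive term.\<close>
  define H where "H w = (if w = [] then 0 else F w + \<bar>C\<bar>)" for w
  have Hsub: "H (u @ v) \<le> H u + H v" for u v using sub[of u v] by (auto simp: H_def)
  define K' where "K' = 2 * K + \<bar>C\<bar>"
  have Hbound: "\<bar>H w\<bar> \<le> K' * real (length w)" for w
  proof (cases "w = []")
    case False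
    then have "1 \<le> real (length w)" by (cases w) auto
    then have "(K + \<bar>C\<bar>) * 1 \<le> (K + \<bar>C\<bar>) * real (length w)" using K by (intro mult_left_mono) auto
    then show ?thesis using bound[of w] False by (simp add: H_def K'_def algebra_simps)
  qed (simp add: H_def)
  define a where "a n = integral\<^sup>L \<mu> (\<lambda>x. H (initial x n))" for n
  have asum: "a n = (\<Sum>w | length w = n. measure \<mu> (cylinder w) * H w)" for n
    unfolding a_def by (rule integral_initial(2))
  have asub: "a (m + n) \<le> a m + a n" for m n
  proof -
    have Hint: "integrable \<mu> (\<lambda>x. H (initial ((shift ^^ m) x) n))"
    proof (rule integrable_bounded)
      show "(\<lambda>x. H (initial ((shift ^^ m) x) n)) \<in> borel_measurable code_borel"
        using measurable_compose[OF measurable_shift_funpow, of "\<lambda>x. H (initial x n)"] by measurable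
      show "\<bar>H (initial ((shift ^^ m) x) n)\<bar> \<le> K' * real n" for x
        using Hbound[of "initial ((shift ^^ m) x) n"] by simp
    qed
    have "a (m + n) \<le> integral\<^sup>L \<mu> (\<lambda>x. H (initial x m) + H (initial ((shift ^^ m) x) n))"
      unfolding a_def
    proof (rule integral_mono)
      show "integrable \<mu> (\<lambda>x. H (initial x m) + H (initial ((shift ^^ m) x) n))"
        using Hint integral_initial(1)[of H m] by simp
      show "integrable \<mu> (\<lambda>x. H (initial x (m + n)))" by (rule integral_initial(1))
      show "H (initial x (m + n)) \<le> H (initial x m) + H (initial ((shift ^^ m) x) n)" for x
        unfolding initial_add by (rule Hsub)
    qed
    also have "\<dots> = a m + integral\<^sup>L \<mu> (\<lambda>x. H (initial ((shift ^^ m) x) n))"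
      unfolding a_def
      by (rule Bochner_Integration.integral_add[OF integral_initial(1) Hint])
    also have "integral\<^sup>L \<mu> (\<lambda>x. H (initial ((shift ^^ m) x) n)) = a n"
      unfolding a_def by (rule integral_shift_funpow) measurable
    finally show ?thesis .
  qed
  have alb: "- K' * real n \<le> a n" for n
  proof -
    have "integral\<^sup>L \<mu> (\<lambda>x. - K' * real n) \<le> a n" unfolding a_def
    proof (rule integral_mono)
      show "- K' * real n \<le> H (initial x n)" for x using Hbound[of "initial x n"] by simp
    qed (simp_all add: integral_initial(1))
    then show ?thesis by simp
  qed
  obtain l where l: "(\<lambda>n. a n / real n) \<longlonglongrightarrow> l" "\<And>n. l * real n \<le> a n"
    using fekete[of a, OF asub alb] by blast
  have Hn: "H (initial x n) = F (initial x n) + \<bar>C\<bar>" if "n \<ge> 1" for x n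
    using that by (auto simp: H_def dest: arg_cong[where f = length])
  have small: "\<forall>\<^sub>F n in sequentially. \<bar>C\<bar> \<le> e * real n" if e: "e > 0" for e
  proof -
    obtain n0 :: nat where "\<bar>C\<bar> / e < real n0" using reals_Archimedean2 by blast
    then show ?thesis using e
      by (intro eventually_sequentiallyI[of n0]) (simp add: field_simps less_le_trans[THEN less_imp_le])
  qed
  have "(\<lambda>n. 1 / real n * (\<Sum>w | length w = n. measure \<mu> (cylinder w) * F w)) \<longlonglongrightarrow> l"
  proof -
    have "(\<lambda>n. a n / real n - \<bar>C\<bar> / real n) \<longlonglongrightarrow> l - 0"
      by (intro tendsto_diff l(1) lim_const_over_n)
    moreover have "\<forall>\<^sub>F n in sequentially. a n / real n - \<bar>C\<bar> / real n
       = 1 / real n * (\<Sum>w | length w = n. measure \<mu> (cylinder w) * F w)"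
    proof (intro eventually_sequentiallyI[of 1])
      fix n :: nat assume n: "1 \<le> n"
      have "a n = (\<Sum>w | length w = n. measure \<mu> (cylinder w) * F w + \<bar>C\<bar> * measure \<mu> (cylinder w))"
        unfolding asum using n by (intro sum.cong) (auto simp: H_def algebra_simps)
      also have "\<dots> = (\<Sum>w | length w = n. measure \<mu> (cylinder w) * F w) + \<bar>C\<bar>"
        by (simp add: sum.distrib sum_cylinders flip: sum_distrib_left)
      finally show "a n / real n - \<bar>C\<bar> / real n = 1 / real n * (\<Sum>w | length w = n. measure \<mu> (cylinder w) * F w)"
        by (simp add: diff_divide_distrib[symmetric])
    qed
    ultimately show ?thesis by (auto intro: Lim_transform_eventually)
  qed
  moreover have "AE x in \<mu>. \<forall>\<^sub>F n in sequentially. F (initial x n) \<le> \<gamma> * real n" if \<gamma>: "l < \<gamma>" for \<gamma>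
  proof -
    have "\<forall>\<^sub>F n in sequentially. a n / real n < \<gamma> \<and> n \<ge> 1"
      using order_tendstoD(2)[OF l(1) \<gamma>] eventually_ge_at_top[of 1] by eventually_elim simp
    then obtain k where k: "a k / real k < \<gamma>" "1 \<le> k" by (auto simp: eventually_sequentially)
    then have "(\<Sum>w | length w = k. measure \<mu> (cylinder w) * H w) < \<gamma> * real k"
      by (simp add: asum field_simps)
    from subadditive_limsup_le[OF Hsub Hbound k(2) this] show ?thesis
    proof (rule AE_mp, intro AE_I2 impI)
      fix x assume "\<forall>\<^sub>F n in sequentially. H (initial x n) \<le> \<gamma> * real n"
      then show "\<forall>\<^sub>F n in sequentially. F (initial x n) \<le> \<gamma> * real n"
        using eventually_ge_at_top[of 1] by eventually_elim (simp add: Hn)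
    qed
  qed
  moreover have "AE x in \<mu>. \<forall>\<^sub>F n in sequentially. \<beta> * real n \<le> F (initial x n)" if \<beta>: "\<beta> < l" for \<beta>
  proof -
    define \<beta>' where "\<beta>' = (\<beta> + l) / 2"
    have b: "\<beta> < \<beta>'" "\<beta>' < l" using \<beta> by (auto simp: \<beta>'_def)
    have "AE x in \<mu>. \<forall>\<^sub>F n in sequentially. \<beta>' * real n \<le> H (initial x n)"
    proof (rule subadditive_cocycle_ge[where K = K' and lam = l])
      show "(\<lambda>x. H (initial x n)) \<in> borel_measurable code_borel" for n by measurable
      show "\<bar>H (initial x n)\<bar> \<le> K' * real n" for n x using Hbound[of "initial x n"] by simp
      show "H (initial x (m + n)) \<le> H (initial x m) + H (initial ((shift ^^ m) x) n)" for m n x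
        using Hsub by (simp add: initial_add)
      show "l * real n \<le> integral\<^sup>L \<mu> (\<lambda>x. H (initial x n))" for n using l(2) by (simp add: a_def)
    qed (rule b(2))
    then show ?thesis
    proof (rule AE_mp, intro AE_I2 impI)
      fix x assume "\<forall>\<^sub>F n in sequentially. \<beta>' * real n \<le> H (initial x n)"
      moreover have "\<forall>\<^sub>F n in sequentially. \<bar>C\<bar> \<le> (\<beta>' - \<beta>) * real n" using small b by simp
      ultimately show "\<forall>\<^sub>F n in sequentially. \<beta> * real n \<le> F (initial x n)"
        using eventually_ge_at_top[of 1] by eventually_elim (simp add: Hn algebra_simps)
    qed
  qed
  ultimately show ?thesis by blast
qed

end

section \<open>Exponential means\<close>

text \<open>The normalised log-moment of order \<open>t\<close>, whose limit at \<open>t = 0\<close>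
  is the ordinary mean. With t = 1 - q it puts the two cases in the definition of the pressure under
  one formula.\<close>

definition exp_mean :: "'b set \<Rightarrow> ('b \<Rightarrow> real) \<Rightarrow> real \<Rightarrow> ('b \<Rightarrow> real) \<Rightarrow> real" where
  "exp_mean S p t f = (if t = 0 then \<Sum>w\<in>S. p w * f w else ln (\<Sum>w\<in>S. p w * exp (t * f w)) / t)"

lemma exp_mean_sum_pos:
  assumes "finite S" "\<And>w. w \<in> S \<Longrightarrow> 0 < p w" "(\<Sum>w\<in>S. p w) = (1 :: real)"
  shows "0 < (\<Sum>w\<in>S. p w * exp (f w))"
proof -
  have "S \<noteq> {}" using assms(3) by auto
  then show ?thesis using assms(1,2) by (intro sum_pos) auto
qed

lemma exp_mean_add_const:
  assumes "finite S" "\<And>w. w \<in> S \<Longrightarrow> 0 < p w" "(\<Sum>w\<in>S. p w) = 1"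
  shows "exp_mean S p t (\<lambda>w. f w + b) = exp_mean S p t f + b"
proof (cases "t = 0")
  case True
  then show ?thesis using assms(3)
    by (simp add: exp_mean_def distrib_left sum.distrib flip: sum_distrib_right)
next
  case False
  have "(\<Sum>w\<in>S. p w * exp (t * (f w + b))) = (\<Sum>w\<in>S. p w * exp (t * f w)) * exp (t * b)"
    by (simp add: distrib_left exp_add sum_distrib_right mult.assoc)
  also have "ln \<dots> = ln (\<Sum>w\<in>S. p w * exp (t * f w)) + t * b"
    using exp_mean_sum_pos[OF assms, of "\<lambda>w. t * f w"] by (simp add: ln_mult)
  finally show ?thesis using False by (simp add: exp_mean_def add_divide_distrib)
qed

lemma exp_mean_mono:
  assumes "finite S" "\<And>w. w \<in> S \<Longrightarrow> 0 < p w" "(\<Sum>w\<in>S. p w) = 1" "0 \<le> t"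
    and le: "\<And>w. w \<in> S \<Longrightarrow> f w \<le> g w"
  shows "exp_mean S p t f \<le> exp_mean S p t g"
proof (cases "t = 0")
  case True
  then show ?thesis using assms(2) le by (auto simp: exp_mean_def less_imp_le intro!: sum_mono mult_left_mono)
next
  case False
  have "(\<Sum>w\<in>S. p w * exp (t * f w)) \<le> (\<Sum>w\<in>S. p w * exp (t * g w))"
    using assms(2,4) le by (intro sum_mono mult_left_mono) (auto simp: less_imp_le mult_left_mono)
  then have "ln (\<Sum>w\<in>S. p w * exp (t * f w)) \<le> ln (\<Sum>w\<in>S. p w * exp (t * g w))"
    using exp_mean_sum_pos[OF assms(1-3), of "\<lambda>w. t * f w"] by (intro ln_mono) auto
  then show ?thesis using False assms(4) by (simp add: exp_mean_def divide_right_mono)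
qed

lemma exp_mean_const:
  assumes "(\<Sum>w\<in>S. p w) = 1"
  shows "exp_mean S p t (\<lambda>w. b) = b"
  using assms by (simp add: exp_mean_def flip: sum_distrib_right)

text \<open>Bernoulli's inequality x^r >= 1 + r (x - 1) at x = e^y.\<close>

lemma exp_convex_bound:
  assumes "1 \<le> (r::real)"
  shows "1 + r * (exp y - 1) \<le> exp (r * y)"
proof -
  have 1: "exp y * (1 + (r - 1) * y) \<le> exp (r * y)"
  proof -
    have "exp y * (1 + (r - 1) * y) \<le> exp y * exp ((r - 1) * y)"
      by (intro mult_left_mono exp_ge_add_one_self) auto
    also have "\<dots> = exp (r * y)" by (simp add: algebra_simps flip: exp_add)
    finally show ?thesis .
  qed
  have "exp y * (1 - y) \<le> exp y * exp (- y)"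
    using exp_ge_add_one_self[of "- y"] by (intro mult_left_mono) auto
  then have 2: "exp y * (1 - y) \<le> 1" by (simp flip: exp_add)
  have "(r - 1) * (exp y * (1 - y)) \<le> (r - 1) * 1" using assms 2 by (intro mult_left_mono) auto
  then show ?thesis using 1 by (simp add: algebra_simps)
qed

text \<open>Jensen's inequality in normalised form: after subtraction of the mean of order
  \<open>t\<close>, the exponential moment of order \<open>t\<close> is 1, or the plain mean is 0
  when \<open>t = 0\<close>. A tangent-line bound then makes the moment of order \<open>t'\<close>
  at least 1. This is what makes the pressure monotone in q.\<close>

lemma exp_mean_mono_exponent:
  assumes S: "finite S" "\<And>w. w \<in> S \<Longrightarrow> 0 < p w" "(\<Sum>w\<in>S. p w) = 1" and t: "0 \<le> t" "t \<le> t'"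
  shows "exp_mean S p t f \<le> exp_mean S p t' f"
proof (cases "t' = 0")
  case False
  then have t': "0 < t'" using t by simp
  have P': "0 < (\<Sum>w\<in>S. p w * exp (t' * f w))" by (rule exp_mean_sum_pos[OF S])
  define m where "m = exp_mean S p t f"
  have "1 \<le> (\<Sum>w\<in>S. p w * exp (t' * (f w - m)))"
  proof (cases "t = 0")
    case True
    have "(\<Sum>w\<in>S. p w * (1 + t' * (f w - m))) = (\<Sum>w\<in>S. p w) + t' * ((\<Sum>w\<in>S. p w * f w) - (\<Sum>w\<in>S. p w) * m)"
      by (simp add: algebra_simps sum.distrib sum_subtractf sum_distrib_left sum_distrib_right)
    also have "\<dots> = 1" using True S(3) by (simp add: m_def exp_mean_def)
    finally have "1 = (\<Sum>w\<in>S. p w * (1 + t' * (f w - m)))" by simp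
    also have "\<dots> \<le> (\<Sum>w\<in>S. p w * exp (t' * (f w - m)))"
      using S(2) by (intro sum_mono mult_left_mono exp_ge_add_one_self) (auto simp: less_imp_le)
    finally show ?thesis .
  next
    case t0: False
    then have t0: "0 < t" using t by simp
    have P: "0 < (\<Sum>w\<in>S. p w * exp (t * f w))" by (rule exp_mean_sum_pos[OF S])
    have "(\<Sum>w\<in>S. p w * exp (t * (f w - m))) = (\<Sum>w\<in>S. p w * exp (t * f w)) * exp (- (t * m))"
      by (simp add: right_diff_distrib exp_diff sum_distrib_right exp_minus divide_inverse mult.assoc)
    also have "t * m = ln (\<Sum>w\<in>S. p w * exp (t * f w))" using t0 by (simp add: m_def exp_mean_def)
    also have "(\<Sum>w\<in>S. p w * exp (t * f w)) * exp (- ln (\<Sum>w\<in>S. p w * exp (t * f w))) = 1"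
      using P by (simp add: exp_minus)
    finally have one: "(\<Sum>w\<in>S. p w * exp (t * (f w - m))) = 1" .
    define r where "r = t' / t"
    have r: "1 \<le> r" "t' = r * t" using t0 t by (auto simp: r_def)
    have "(\<Sum>w\<in>S. p w * (1 + r * (exp (t * (f w - m)) - 1)))
      = (\<Sum>w\<in>S. p w) + r * ((\<Sum>w\<in>S. p w * exp (t * (f w - m))) - (\<Sum>w\<in>S. p w))"
      by (simp add: distrib_left right_diff_distrib sum.distrib sum_subtractf sum_distrib_left mult_ac)
    also have "\<dots> = 1" using one S(3) by simp
    finally have "1 = (\<Sum>w\<in>S. p w * (1 + r * (exp (t * (f w - m)) - 1)))" by simp
    also have "\<dots> \<le> (\<Sum>w\<in>S. p w * exp (r * (t * (f w - m))))"
      using S(2) r by (intro sum_mono mult_left_mono exp_convex_bound) (auto simp: less_imp_le)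
    finally show ?thesis by (simp add: r mult.assoc)
  qed
  also have "(\<Sum>w\<in>S. p w * exp (t' * (f w - m))) = (\<Sum>w\<in>S. p w * exp (t' * f w)) * exp (- (t' * m))"
    by (simp add: right_diff_distrib exp_diff sum_distrib_right exp_minus divide_inverse mult.assoc)
  finally have "exp (t' * m) \<le> (\<Sum>w\<in>S. p w * exp (t' * f w))" by (simp add: exp_minus field_simps)
  then have "t' * m \<le> ln (\<Sum>w\<in>S. p w * exp (t' * f w))" using P' by (simp add: ln_ge_iff)
  then show ?thesis using t' by (simp add: m_def exp_mean_def field_simps)
qed (use t in auto)

lemma fekete_const:
  fixes a :: "nat \<Rightarrow> real"
  assumes sub: "\<And>m n. a (m + n) \<le> a m + a n + C" and lb: "\<And>n. - K * real n \<le> a n"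
  shows "convergent (\<lambda>n. a n / real n)"
proof -
  define b where "b n = (if n = 0 then 0 else a n + \<bar>C\<bar>)" for n
  have "b (m + n) \<le> b m + b n" for m n using sub[of m n] by (auto simp: b_def)
  moreover have "- K * real n \<le> b n" for n using lb[of n] by (auto simp: b_def)
  ultimately obtain l where l: "(\<lambda>n. b n / real n) \<longlonglongrightarrow> l" using fekete[of b K] by blast
  have "(\<lambda>n. b n / real n - \<bar>C\<bar> / real n) \<longlonglongrightarrow> l - 0"
    by (intro tendsto_diff l lim_const_over_n)
  moreover have "\<forall>\<^sub>F n in sequentially. b n / real n - \<bar>C\<bar> / real n = a n / real n"
    by (intro eventually_sequentiallyI[of 1]) (simp add: b_def flip: diff_divide_distrib)
  ultimately have "(\<lambda>n. a n / real n) \<longlonglongrightarrow> l" by (auto intro: Lim_transform_eventually)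
  then show ?thesis by (rule convergentI)
qed

section \<open>Pressure\<close>

lemma word_map_append: "word_map T (u @ v) = word_map T u \<circ> word_map T v"
  by (induction u) (simp_all add: o_assoc)

lemma sum_words_append:
  "(\<Sum>w :: 'm::finite list | length w = m + n. h w) = (\<Sum>u | length u = m. \<Sum>v | length v = n. h (u @ v))"
proof -
  have "(\<Sum>u | length u = m. \<Sum>v | length v = n. h (u @ v))
    = (\<Sum>(u, v)\<in>{u. length u = m} \<times> {v. length v = n}. h (u @ v))"
    by (rule sum.cartesian_product)
  also have "\<dots> = (\<Sum>w | length w = m + n. h w)"
    by (rule sum.reindex_bij_witness[of _ "\<lambda>w. (take m w, drop m w)" "\<lambda>(u, v). u @ v"]) auto
  finally show ?thesis by simp
qed

text \<open>Exponentials of Birkhoff sums are exactly multiplicative along an orbit. At one point of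
  the cylinder of \<open>u @ v\<close> they compare the masses of \<open>u\<close>, \<open>v\<close>
  and \<open>u @ v\<close>, each at the cost of a factor \<open>a\<close>, which gives
  \<open>a ^ 3\<close>. Empty words are separate, as the Gibbs bound starts at length 1.\<close>

lemma gibbs_imp_quasi_bernoulli:
  fixes \<mu> :: "(nat \<Rightarrow> 'm::finite) measure"
  assumes gibbs: "gibbs_measure \<mu>" and inv: "shift_invariant \<mu>"
  shows "\<exists>c. quasi_bernoulli \<mu> c"
proof -
  let ?p = "\<lambda>w. measure \<mu> (cylinder w)"
  have "prob_space \<mu>" and sets: "sets \<mu> = sets code_borel" using gibbs by (auto simp: gibbs_measure_def)
  then interpret prob_space \<mu> by simp
  have sp: "space \<mu> = UNIV" using sets_eq_imp_space_eq[OF sets] by simp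
  obtain f :: "(nat \<Rightarrow> 'm) \<Rightarrow> real" and Pf a where a: "a > 0" and
    G: "\<And>x k. 1 \<le> k \<Longrightarrow> inverse a \<le> ?p (initial x k) / exp (- real k * Pf + (\<Sum>j<k. f ((shift ^^ j) x)))
       \<and> ?p (initial x k) / exp (- real k * Pf + (\<Sum>j<k. f ((shift ^^ j) x))) \<le> a"
    using gibbs unfolding gibbs_measure_def Let_def by blast
  define e where "e x k = exp (- real k * Pf + (\<Sum>j<k. f ((shift ^^ j) x)))" for x k
  have e0: "0 < e x k" for x k by (simp add: e_def)
  have up: "?p (initial x k) \<le> a * e x k" and lo: "e x k \<le> a * ?p (initial x k)" if "1 \<le> k" for x k
    using G[OF that, of x] e0[of x k] a unfolding e_def[symmetric] by (simp_all add: field_simps)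
  have "inverse a \<le> a" using G[of 1 undefined] by linarith
  then have a1: "1 \<le> a" using a by (metis inverse_le_1_iff linorder_not_le one_le_inverse_iff order_trans less_imp_le)
  have e_add: "e x (n + k) = e x n * e ((shift ^^ n) x) k" for x n k
  proof -
    have "(\<Sum>j<n + k. f ((shift ^^ j) x)) = (\<Sum>j<n. f ((shift ^^ j) x)) + (\<Sum>j<k. f ((shift ^^ (j + n)) x))"
      by (induction k) (auto simp: add_ac)
    then show ?thesis by (simp add: e_def funpow_add algebra_simps flip: exp_add)
  qed
  have pos: "0 < ?p w" for w
  proof (cases "w = []")
    case False
    obtain x where x: "initial x (length w) = w" using cylinder_nonempty[of w] by (auto simp: mem_cylinder)
    have "0 < e x (length w)" by (rule e0)
    also have "\<dots> \<le> a * ?p (initial x (length w))" using False by (intro lo) (cases w, auto)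
    finally show ?thesis using a x by (simp add: zero_less_mult_iff)
  qed (use prob_space sp in simp)
  have c1: "1 \<le> a ^ 3" using a1 by (rule one_le_power)
  have both: "?p (u @ v) \<le> a ^ 3 * ?p u * ?p v \<and> ?p u * ?p v \<le> a ^ 3 * ?p (u @ v)" for u v
  proof (cases "u = [] \<or> v = []")
    case True
    have "?p w \<le> a ^ 3 * ?p w" for w using mult_right_mono[OF c1, of "?p w"] by simp
    then show ?thesis using True prob_space sp by auto
  next
    case False
    obtain x where x: "initial x (length (u @ v)) = u @ v" using cylinder_nonempty[of "u @ v"] by (auto simp: mem_cylinder)
    have xu: "initial x (length u) = u" and xv: "initial ((shift ^^ length u) x) (length v) = v"
      using x by (auto simp: initial_add)
    have l: "1 \<le> length u" "1 \<le> length v" "1 \<le> length (u @ v)" using False by (auto simp: Suc_le_eq)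
    let ?eu = "e x (length u)" and ?ev = "e ((shift ^^ length u) x) (length v)"
    have euv: "e x (length (u @ v)) = ?eu * ?ev" by (simp add: e_add)
    have 1: "?p u \<le> a * ?eu" "?eu \<le> a * ?p u" using up[OF l(1), of x] lo[OF l(1), of x] by (simp_all add: xu)
    have 2: "?p v \<le> a * ?ev" "?ev \<le> a * ?p v"
      using up[OF l(2), of "(shift ^^ length u) x"] lo[OF l(2), of "(shift ^^ length u) x"] by (simp_all add: xv)
    have 3: "?p (u @ v) \<le> a * (?eu * ?ev)" "?eu * ?ev \<le> a * ?p (u @ v)"
      using up[OF l(3), of x] lo[OF l(3), of x] x euv by simp_all
    have "?eu * ?ev \<le> (a * ?p u) * (a * ?p v)" using 1 2 e0 a by (intro mult_mono) (auto simp: less_imp_le)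
    then have "a * (?eu * ?ev) \<le> a * ((a * ?p u) * (a * ?p v))" using a by (intro mult_left_mono) auto
    moreover have "?p u * ?p v \<le> (a * ?eu) * (a * ?ev)" using 1 2 e0 a by (intro mult_mono) (auto simp: less_imp_le)
    moreover have "(a * a) * (?eu * ?ev) \<le> (a * a) * (a * ?p (u @ v))" using 3 a by (intro mult_left_mono) auto
    ultimately show ?thesis using 3 by (simp add: power3_eq_cube mult_ac)
  qed
  have "quasi_bernoulli \<mu> (a ^ 3)"
    by unfold_locales (use sets inv c1 both pos in auto)
  then show ?thesis by blast
qed

locale self_affine = quasi_bernoulli \<mu> c for \<mu> :: "(nat \<Rightarrow> 'm::finite) measure" and c +
  fixes T :: "'m \<Rightarrow> 'a::euclidean_space \<Rightarrow> 'a" and \<kappa> \<iota> :: real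
  assumes linT: "linear (T i)" and bijT: "bij (T i)"
    and \<kappa>: "0 < \<kappa>" "\<kappa> < 1" and \<iota>: "0 < \<iota>" "\<iota> < 1"
    and T_le: "norm (T i v) \<le> \<kappa> * norm v" and T_ge: "\<iota> * norm v \<le> norm (T i v)"
    and card_alphabet: "2 \<le> CARD('m)"
begin

section \<open>Growth of the ratio of singular value function to cylinder mass\<close>

lemma word_map_linear: "linear (word_map T w)"
proof (induction w)
  case (Cons i w)
  then show ?case unfolding word_map.simps by (rule linear_compose[OF _ linT])
next
  case Nil
  show ?case unfolding word_map.simps by (rule linear_id)
qed

lemma word_map_le: "norm (word_map T w v) \<le> \<kappa> ^ length w * norm v"
proof (induction w arbitrary: v)
  case (Cons i w)
  have "norm (T i (word_map T w v)) \<le> \<kappa> * norm (word_map T w v)" by (rule T_le)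
  also have "\<dots> \<le> \<kappa> * (\<kappa> ^ length w * norm v)" using \<kappa> Cons by (intro mult_left_mono) auto
  finally show ?case by (simp add: mult.assoc)
qed simp

lemma word_map_ge: "\<iota> ^ length w * norm v \<le> norm (word_map T w v)"
proof (induction w arbitrary: v)
  case (Cons i w)
  have "\<iota> * (\<iota> ^ length w * norm v) \<le> \<iota> * norm (word_map T w v)" using \<iota> Cons by (intro mult_left_mono) auto
  also have "\<dots> \<le> norm (T i (word_map T w v))" by (rule T_ge)
  finally show ?case by (simp add: mult.assoc)
qed simp

lemma sv_word_ge: "j < DIM('a) \<Longrightarrow> \<iota> ^ length w \<le> singular_values (word_map T w) ! j"
  by (rule singular_values_ge[OF word_map_linear word_map_ge])

lemma sv_word_le: "j < DIM('a) \<Longrightarrow> singular_values (word_map T w) ! j \<le> \<kappa> ^ length w"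
  by (rule singular_values_le[OF word_map_linear word_map_le])

lemma sv_word_pos: "j < DIM('a) \<Longrightarrow> 0 < singular_values (word_map T w) ! j"
  using sv_word_ge[of j w] \<iota> by (meson less_le_trans zero_less_power)

definition logratio :: "real \<Rightarrow> 'm list \<Rightarrow> real" where
  "logratio s w = ln (sv_fun s (word_map T w)) - ln (measure \<mu> (cylinder w))"

lemma sv_word_fun_pos: "0 \<le> s \<Longrightarrow> 0 < sv_fun s (word_map T w)"
  by (rule ln_sv_fun(1)[OF word_map_linear sv_word_pos])

lemma exp_logratio:
  assumes "0 \<le> s"
  shows "exp (logratio s w) = sv_fun s (word_map T w) / measure \<mu> (cylinder w)"
  using sv_word_fun_pos[OF assms] cylinder_pos by (simp add: logratio_def exp_diff)

text \<open>Submultiplicativity of \<phi>^s and supermultiplicativity of the cylinder masses, each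
  up to a constant, push in the same direction.\<close>

lemma logratio_append:
  assumes "0 \<le> s"
  shows "logratio s (u @ v) \<le> logratio s u + logratio s v + (sv_const DIM('a) s + ln c)"
proof -
  have "ln (sv_fun s (word_map T u \<circ> word_map T v)) \<le>
      ln (sv_fun s (word_map T u)) + ln (sv_fun s (word_map T v)) + sv_const DIM('a) s"
    using sv_word_pos[of _ "u @ v"]
    by (intro ln_sv_fun_comp_le word_map_linear sv_word_pos assms) (simp_all add: word_map_append)
  moreover have "ln (measure \<mu> (cylinder u) * measure \<mu> (cylinder v)) \<le> ln (c * measure \<mu> (cylinder (u @ v)))"
    using cylinder_pos append_ge by (intro ln_mono) auto
  ultimately show ?thesis using cylinder_pos[of u] cylinder_pos[of v] cylinder_pos[of "u @ v"] c_ge_1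
    by (simp add: logratio_def word_map_append ln_mult)
qed

lemma logratio_diff:
  assumes "0 \<le> s" "s \<le> s'"
  shows "logratio s w + (s' - s) * (real (length w) * ln \<iota>) \<le> logratio s' w"
    and "logratio s' w \<le> logratio s w + (s' - s) * (real (length w) * ln \<kappa>)"
  using ln_sv_fun_diff[OF word_map_linear[of w] _ word_map_ge word_map_le assms] \<iota> \<kappa>
  by (simp_all add: logratio_def ln_realpow)

text \<open>Given a word, the next letter takes any prescribed value with conditional probability at
  least the minimum divided by \<open>c\<close>. A competing letter therefore always removes a fixed
  proportion; the extra 2 leaves room for \<open>0 < \<theta>\<close>.\<close>

definition \<theta> :: real where
  "\<theta> = 1 - Min (range (\<lambda>i. measure \<mu> (cylinder [i]))) / (2 * c)"

lemma theta_bounds: "0 < \<theta>" "\<theta> < 1"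
proof -
  let ?\<delta> = "Min (range (\<lambda>i. measure \<mu> (cylinder [i])))"
  have "0 < ?\<delta>" using cylinder_pos by (subst Min_gr_iff) auto
  moreover have "?\<delta> \<le> measure \<mu> (cylinder [undefined])" by (intro Min_le) auto
  moreover have "measure \<mu> (cylinder [undefined]) \<le> 1" by (rule prob_le_1)
  ultimately have "0 < ?\<delta>" "?\<delta> < 2 * c" using c_ge_1 by linarith+
  then have "0 < ?\<delta> / (2 * c)" "?\<delta> / (2 * c) < 1" using c_ge_1 by (simp_all del: Min_gr_iff Min_less_iff)
  then show "0 < \<theta>" "\<theta> < 1" by (auto simp: \<theta>_def)
qed

text \<open>With at least two letters, every extension of a word has a sibling that takes away a
  fixed share of the mass.\<close>

lemma cylinder_decay: "measure \<mu> (cylinder w) \<le> \<theta> ^ length w"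
proof (induction w rule: rev_induct)
  case (snoc i w)
  let ?p = "\<lambda>w. measure \<mu> (cylinder w)"
  let ?\<delta> = "Min (range (\<lambda>i. ?p [i]))"
  have "\<exists>j. j \<noteq> i"
  proof (rule ccontr)
    assume "\<nexists>j. j \<noteq> i"
    then have "(UNIV :: 'm set) = {i}" by auto
    then have "CARD('m) = 1" by (metis is_singletonI is_singleton_altdef)
    then show False using card_alphabet by simp
  qed
  then obtain j where j: "j \<noteq> i" by blast
  have "?p (w @ [i]) + ?p (w @ [j]) = measure \<mu> (cylinder (w @ [i]) \<union> cylinder (w @ [j]))"
    using cylinder_disjoint[of "w @ [i]" "w @ [j]"] j by (intro finite_measure_Union[symmetric]) auto
  also have "\<dots> \<le> ?p w"
    by (intro finite_measure_mono) (auto simp: cylinder_append)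
  finally have "?p (w @ [i]) + ?p (w @ [j]) \<le> ?p w" .
  moreover have "?p w * ?\<delta> \<le> c * ?p (w @ [j])"
  proof -
    have "?p w * ?\<delta> \<le> ?p w * ?p [j]" by (intro mult_left_mono Min_le) auto
    then show ?thesis using append_ge[of w "[j]"] by simp
  qed
  moreover have "?p w * ?\<delta> / (2 * c) \<le> ?p w * ?\<delta> / c"
  proof -
    have "0 < ?\<delta>" using cylinder_pos by (subst Min_gr_iff) auto
    then show ?thesis using c_ge_1 cylinder_pos[of w] by (intro divide_left_mono) auto
  qed
  moreover have "?p w * ?\<delta> / c \<le> ?p (w @ [j])" if "?p w * ?\<delta> \<le> c * ?p (w @ [j])"
    using that c_ge_1 by (simp add: pos_divide_le_eq mult.commute)
  ultimately have "?p (w @ [i]) \<le> ?p w - ?p w * ?\<delta> / (2 * c)" by linarith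
  also have "\<dots> = ?p w * \<theta>" by (simp add: \<theta>_def algebra_simps)
  also have "\<dots> \<le> \<theta> ^ length w * \<theta>" using snoc theta_bounds by (intro mult_right_mono) auto
  finally show ?case by (simp add: mult.commute)
qed simp

lemma logratio_0: "logratio 0 w = - ln (measure \<mu> (cylinder w))"
  by (simp add: logratio_def sv_fun_def)

lemma logratio_0_ge: "real (length w) * (- ln \<theta>) \<le> logratio 0 w"
proof -
  have "ln (measure \<mu> (cylinder w)) \<le> ln (\<theta> ^ length w)"
    using cylinder_decay[of w] cylinder_pos[of w] by (intro ln_mono) auto
  then show ?thesis using theta_bounds by (simp add: logratio_0 ln_realpow)
qed

lemma logratio_0_le: "\<exists>M\<ge>0. \<forall>w. logratio 0 w \<le> M * real (length w)"
proof -
  let ?p = "\<lambda>w. measure \<mu> (cylinder w)"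
  define M where "M = Max (range (\<lambda>i. - ln (?p [i]))) + ln c"
  have M: "- ln (?p [i]) + ln c \<le> M" for i unfolding M_def by (intro add_right_mono Max_ge) auto
  have "0 \<le> - ln (?p [undefined])" using cylinder_pos[of "[undefined]"] prob_le_1[of "cylinder [undefined]"]
    by (simp add: ln_le_zero_iff)
  then have "0 \<le> M" using M[of undefined] c_ge_1 ln_ge_zero[of c] by linarith
  moreover have "logratio 0 w \<le> M * real (length w)" for w
  proof (induction w)
    case (Cons i w)
    have "ln (?p [i] * ?p w) \<le> ln (c * ?p (i # w))"
      using append_ge[of "[i]" w] cylinder_pos by (intro ln_mono) auto
    then have "- ln (?p (i # w)) \<le> - ln (?p [i]) + ln c - ln (?p w)"
      using cylinder_pos[of "[i]"] cylinder_pos[of w] cylinder_pos[of "i # w"] c_ge_1 by (simp add: ln_mult)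
    then show ?case using M[of i] Cons by (simp add: logratio_0 algebra_simps)
  qed (simp add: logratio_0)
  ultimately show ?thesis by blast
qed

lemma logratio_bound:
  assumes "0 \<le> s"
  shows "\<exists>K\<ge>0. \<forall>w. \<bar>logratio s w\<bar> \<le> K * real (length w)"
proof -
  obtain M where M: "M \<ge> 0" "\<And>w. logratio 0 w \<le> M * real (length w)" using logratio_0_le by blast
  have li: "ln \<iota> \<le> 0" "ln \<kappa> \<le> 0" "ln \<theta> \<le> 0" using \<iota> \<kappa> theta_bounds by auto
  have "\<bar>logratio s w\<bar> \<le> (M + s * (- ln \<iota>)) * real (length w)" for w
  proof -
    have 1: "s * (real (length w) * ln \<kappa>) \<le> 0" "0 \<le> real (length w) * (- ln \<theta>)"
      using li assms by (auto simp: mult_nonneg_nonpos mult_nonneg_nonneg)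
    have 2: "0 \<le> s * (real (length w) * (- ln \<iota>))" "0 \<le> M * real (length w)"
      using li assms M by (intro mult_nonneg_nonneg; simp)+
    have "logratio s w \<le> M * real (length w)"
      using logratio_diff(2)[of 0 s w] assms M(2)[of w] 1 by simp
    moreover have "- (s * (real (length w) * (- ln \<iota>))) \<le> logratio s w"
      using logratio_diff(1)[of 0 s w] assms logratio_0_ge[of w] 1 by simp
    ultimately show ?thesis using 2 by (simp add: algebra_simps abs_le_iff)
  qed
  moreover have "0 \<le> M + s * (- ln \<iota>)"
    by (intro add_nonneg_nonneg mult_nonneg_nonneg) (use M li assms in auto)
  ultimately show ?thesis by blast
qed

section \<open>Pressure for q at most 1 and its roots\<close>

definition level_mean :: "nat \<Rightarrow> real \<Rightarrow> real \<Rightarrow> real" where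
  "level_mean k t s = exp_mean {w. length w = k} (\<lambda>w. measure \<mu> (cylinder w)) t (logratio s)"

text \<open>Since \<phi>^(1-q) \<mu>^q = \<mu> (\<phi>/\<mu>)^(1-q), the sum in the pressure is an
  average with respect to \<open>\<mu>\<close> of exponentials of \<open>logratio\<close>. The
  denominator q - 1 against 1 - q accounts for the sign.\<close>

lemma pressure_eq:
  assumes s: "0 \<le> s"
  shows "pressure T \<mu> s q = lim (\<lambda>k. - (level_mean k (1 - q) s / real k))"
proof (cases "q = 1")
  case True
  have "measure \<mu> (cylinder w) * ln (inverse (sv_fun s (word_map T w)) * measure \<mu> (cylinder w))
     = - (measure \<mu> (cylinder w) * logratio s w)" for w
    using sv_word_fun_pos[OF s, of w] cylinder_pos[of w] by (simp add: logratio_def ln_mult ln_inverse algebra_simps)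
  then show ?thesis using True
    by (simp add: pressure_def level_mean_def exp_mean_def sum_negf)
next
  case False
  have "sv_fun s (word_map T w) powr (1 - q) * measure \<mu> (cylinder w) powr q
     = measure \<mu> (cylinder w) * exp ((1 - q) * logratio s w)" for w
  proof -
    let ?f = "sv_fun s (word_map T w)" and ?p = "measure \<mu> (cylinder w)"
    have "?f powr (1 - q) * ?p powr q = exp ((1 - q) * ln ?f) * exp (q * ln ?p)"
      using sv_word_fun_pos[OF s, of w] cylinder_pos[of w] by (simp add: powr_def)
    also have "\<dots> = exp (ln ?p) * exp ((1 - q) * logratio s w)"
      unfolding exp_add[symmetric] by (rule arg_cong[of _ _ exp]) (simp add: logratio_def algebra_simps)
    finally show ?thesis using cylinder_pos[of w] by simp
  qed
  moreover have "x / (q - 1) = - (x / (1 - q))" for x by (metis minus_diff_eq minus_divide_right)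
  ultimately show ?thesis using False
    by (simp add: pressure_def level_mean_def exp_mean_def mult.commute)
qed

lemma level_weights: "finite {w :: 'm list. length w = k}" "\<And>w. w \<in> {w. length w = k} \<Longrightarrow> 0 < measure \<mu> (cylinder w)"
  "(\<Sum>w\<in>{w. length w = k}. measure \<mu> (cylinder w)) = 1"
  using cylinder_pos sum_cylinders by auto

text \<open>For \<open>t = 0\<close> this is the first part of \<open>kingman\<close>; for positive
  \<open>t\<close> the exponential sums over words are submultiplicative up to a constant.
  Subadditivity of \<open>logratio\<close> gives upper bounds on exponentials only when
  \<open>t\<close> is nonnegative, whence the restriction to q <= 1.\<close>

lemma level_mean_convergent:
  assumes s: "0 \<le> s" and t: "0 \<le> t"
  shows "convergent (\<lambda>k. level_mean k t s / real k)"
proof -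
  let ?C = "sv_const DIM('a) s + ln c"
  obtain K where K: "K \<ge> 0" "\<And>w. \<bar>logratio s w\<bar> \<le> K * real (length w)" using logratio_bound[OF s] by blast
  show ?thesis
  proof (cases "t = 0")
    case True
    have "\<bar>logratio s w\<bar> \<le> K * real (length w) + K" for w using K(2)[of w] K(1) by simp
    from kingman[of "logratio s", OF logratio_append[OF s] this] show ?thesis
      using True by (auto simp: level_mean_def exp_mean_def convergent_def)
  next
    case False
    then have t: "0 < t" using t by simp
    let ?p = "\<lambda>w. measure \<mu> (cylinder w)"
    define E where "E k = (\<Sum>w | length w = k. ?p w * exp (t * logratio s w))" for k
    have E: "0 < E k" for k unfolding E_def by (rule exp_mean_sum_pos[OF level_weights])
    define a where "a k = ln (E k)" for k
    have "convergent (\<lambda>k. a k / real k)"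
    proof (rule fekete_const)
      fix m n
      have "E (m + n) = (\<Sum>u | length u = m. \<Sum>v | length v = n. ?p (u @ v) * exp (t * logratio s (u @ v)))"
        unfolding E_def by (rule sum_words_append)
      also have "\<dots> \<le> (\<Sum>u | length u = m. \<Sum>v | length v = n.
          (c * ?p u * ?p v) * exp (t * (logratio s u + logratio s v + ?C)))"
        using append_le logratio_append[OF s] t c_ge_1 by (intro sum_mono mult_mono) auto
      also have "\<dots> = (c * exp (t * ?C)) * (E m * E n)"
      proof -
        have "E m * E n = (\<Sum>u | length u = m. \<Sum>v | length v = n.
            (?p u * exp (t * logratio s u)) * (?p v * exp (t * logratio s v)))"
          unfolding E_def by (rule sum_product)
        then show ?thesis
          by (simp only: sum_distrib_left) (intro sum.cong refl, simp add: distrib_left exp_add mult_ac)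
      qed
      finally have "ln (E (m + n)) \<le> ln ((c * exp (t * ?C)) * (E m * E n))"
        using E by (intro ln_mono) auto
      also have "\<dots> = a m + a n + (ln c + t * ?C)"
        using E[of m] E[of n] c_ge_1 by (simp add: a_def ln_mult)
      finally show "a (m + n) \<le> a m + a n + (ln c + t * ?C)" by (simp add: a_def)
    next
      fix n
      have "- K * real n = exp_mean {w. length w = n} ?p t (\<lambda>w. - K * real n)"
        by (simp only: exp_mean_const[OF level_weights(3)])
      also have "\<dots> \<le> exp_mean {w. length w = n} ?p t (logratio s)"
      proof (intro exp_mean_mono level_weights less_imp_le[OF t])
        fix w :: "'m list" assume "w \<in> {w. length w = n}"
        then show "- K * real n \<le> logratio s w" using K(2)[of w] by auto
      qed
      also have "\<dots> = a n / t" using t by (simp add: exp_mean_def a_def E_def)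
      finally show "- (t * K) * real n \<le> a n" using t by (simp add: field_simps)
    qed
    then have "convergent (\<lambda>k. (1 / t) * (a k / real k))" by (intro convergent_mult convergent_const)
    then show ?thesis using t by (simp add: level_mean_def exp_mean_def a_def E_def)
  qed
qed

lemma pressure_tendsto:
  assumes "0 \<le> s" "q \<le> 1"
  shows "(\<lambda>k. - (level_mean k (1 - q) s / real k)) \<longlonglongrightarrow> pressure T \<mu> s q"
  unfolding pressure_eq[OF assms(1)]
  using level_mean_convergent[OF assms(1), of "1 - q"] assms(2)
  by (simp add: convergent_LIMSEQ_iff[symmetric] convergent_minus_iff[symmetric])

lemma level_mean_diff:
  assumes "0 \<le> s" "s \<le> s'" "0 \<le> t"
  shows "level_mean k t s + (s' - s) * (real k * ln \<iota>) \<le> level_mean k t s'"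
    and "level_mean k t s' \<le> level_mean k t s + (s' - s) * (real k * ln \<kappa>)"
proof -
  let ?m = "exp_mean {w. length w = k} (\<lambda>w. measure \<mu> (cylinder w)) t"
  have "?m (\<lambda>w. logratio s w + (s' - s) * (real k * ln \<iota>)) \<le> ?m (logratio s')"
    using logratio_diff(1)[OF assms(1,2)] by (intro exp_mean_mono level_weights assms(3)) auto
  then show "level_mean k t s + (s' - s) * (real k * ln \<iota>) \<le> level_mean k t s'"
    by (simp only: level_mean_def exp_mean_add_const[OF level_weights])
  have "?m (logratio s') \<le> ?m (\<lambda>w. logratio s w + (s' - s) * (real k * ln \<kappa>))"
    using logratio_diff(2)[OF assms(1,2)] by (intro exp_mean_mono level_weights assms(3)) auto
  then show "level_mean k t s' \<le> level_mean k t s + (s' - s) * (real k * ln \<kappa>)"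
    by (simp only: level_mean_def exp_mean_add_const[OF level_weights])
qed

lemma pressure_diff:
  assumes "0 \<le> s" "s \<le> s'" "q \<le> 1"
  shows "pressure T \<mu> s q + (s' - s) * (- ln \<kappa>) \<le> pressure T \<mu> s' q"
    and "pressure T \<mu> s' q \<le> pressure T \<mu> s q + (s' - s) * (- ln \<iota>)"
proof -
  let ?a = "\<lambda>s k. - (level_mean k (1 - q) s / real k)"
  have lim: "?a s \<longlonglongrightarrow> pressure T \<mu> s q" "?a s' \<longlonglongrightarrow> pressure T \<mu> s' q"
    using assms by (auto intro!: pressure_tendsto)
  have "?a s k + (s' - s) * (- ln \<kappa>) \<le> ?a s' k \<and> ?a s' k \<le> ?a s k + (s' - s) * (- ln \<iota>)" if k: "1 \<le> k" for k
  proof -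
    have div: "x / n + d * l \<le> y / n" if "x + d * (n * l) \<le> y" "0 < n" for x d n l y :: real
    proof -
      have "x / n + d * l = (x + d * (n * l)) / n" using that(2) by (simp add: add_divide_distrib)
      then show ?thesis using divide_right_mono[OF that(1), of n] that(2) by simp
    qed
    have "0 < real k" "0 \<le> 1 - q" using k assms(3) by auto
    then show ?thesis
      using div[OF level_mean_diff(1)[OF assms(1,2), of "1 - q" k]]
        div[of "level_mean k (1 - q) s'" "s' - s" "real k" "- ln \<kappa>" "level_mean k (1 - q) s"]
        level_mean_diff(2)[OF assms(1,2), of "1 - q" k] by simp
  qed
  then have "\<forall>k\<ge>1. ?a s k + (s' - s) * (- ln \<kappa>) \<le> ?a s' k" "\<forall>k\<ge>1. ?a s' k \<le> ?a s k + (s' - s) * (- ln \<iota>)"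
    by blast+
  then show "pressure T \<mu> s q + (s' - s) * (- ln \<kappa>) \<le> pressure T \<mu> s' q"
    "pressure T \<mu> s' q \<le> pressure T \<mu> s q + (s' - s) * (- ln \<iota>)"
    by (blast intro: LIMSEQ_le[OF tendsto_add[OF lim(1) tendsto_const] lim(2)]
        LIMSEQ_le[OF lim(2) tendsto_add[OF lim(1) tendsto_const]])+
qed

lemma pressure_0_le:
  assumes "q \<le> 1"
  shows "pressure T \<mu> 0 q \<le> ln \<theta>"
proof (rule LIMSEQ_le_const2[OF pressure_tendsto[OF order_refl assms]], intro exI[of _ 1] allI impI)
  fix k :: nat assume k: "1 \<le> k"
  have "real k * (- ln \<theta>) = exp_mean {w. length w = k} (\<lambda>w. measure \<mu> (cylinder w)) (1 - q) (\<lambda>w. real k * (- ln \<theta>))"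
    by (simp only: exp_mean_const[OF level_weights(3)])
  also have "\<dots> \<le> level_mean k (1 - q) 0"
    unfolding level_mean_def using logratio_0_ge assms by (intro exp_mean_mono level_weights) auto
  finally show "- (level_mean k (1 - q) 0 / real k) \<le> ln \<theta>" using k by (simp add: field_simps)
qed

lemma pressure_mono_q:
  assumes "0 \<le> s" "q \<le> q'" "q' \<le> 1"
  shows "pressure T \<mu> s q \<le> pressure T \<mu> s q'"
proof (rule LIMSEQ_le[OF pressure_tendsto pressure_tendsto], rule assms(1), use assms in simp, rule assms(1), rule assms(3),
    intro exI[of _ 1] allI impI)
  fix k :: nat assume "1 \<le> k"
  have "level_mean k (1 - q') s \<le> level_mean k (1 - q) s"
    unfolding level_mean_def using assms by (intro exp_mean_mono_exponent level_weights) auto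
  then show "- (level_mean k (1 - q) s / real k) \<le> - (level_mean k (1 - q') s / real k)"
    by (simp add: divide_right_mono)
qed

lemma pressure_strict_mono:
  assumes "0 \<le> s" "s < s'" "q \<le> 1"
  shows "pressure T \<mu> s q < pressure T \<mu> s' q"
proof -
  have "0 < (s' - s) * (- ln \<kappa>)" using assms \<kappa> by (intro mult_pos_pos) auto
  then show ?thesis using pressure_diff(1)[of s s' q] assms by simp
qed

text \<open>\<open>dim_q\<close> is a definite description, so existence and uniqueness of the root
  must come first. The pressure is negative at s = 0, Lipschitz, and increases at a rate of at least
  \<open>- ln \<kappa>\<close>.\<close>

lemma dim_q_root:
  assumes q: "q \<le> 1"
  shows "0 < dim_q T \<mu> q" "pressure T \<mu> (dim_q T \<mu> q) q = 0"
proof -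
  let ?P = "\<lambda>s. pressure T \<mu> s q"
  have neg: "?P 0 < 0" using pressure_0_le[OF q] theta_bounds ln_less_zero[of \<theta>] by linarith
  have lk: "0 < - ln \<kappa>" using \<kappa> by simp
  \<comment> \<open>At this point the guaranteed slope has made up for the negative value at
    0.\<close>
  define S where "S = - ?P 0 / (- ln \<kappa>)"
  have S0: "0 \<le> S" unfolding S_def using neg lk by (intro divide_nonneg_pos) auto
  have "0 \<le> ?P S" using pressure_diff(1)[of 0 S q] S0 q lk by (simp add: S_def)
  have "continuous_on {0..S} ?P"
  proof (rule lipschitz_on_continuous_on)
    show "(- ln \<iota>)-lipschitz_on {0..S} ?P"
    proof (rule lipschitz_onI)
      show "0 \<le> - ln \<iota>" using \<iota> by simp
      have one: "dist (?P x) (?P y) \<le> - ln \<iota> * dist x y" if "0 \<le> x" "x \<le> y" for x y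
      proof -
        have "?P x \<le> ?P y" using pressure_strict_mono[OF that(1), of y q] that q by (cases "x = y") auto
        then show ?thesis using pressure_diff(2)[OF that q] that by (simp add: dist_real_def algebra_simps)
      qed
      fix x y assume xy: "x \<in> {0..S}" "y \<in> {0..S}"
      then show "dist (?P x) (?P y) \<le> - ln \<iota> * dist x y"
        using one[of x y] one[of y x] by (cases "x \<le> y") (auto simp: dist_commute)
    qed
  qed
  then obtain s where s: "0 \<le> s" "s \<le> S" "?P s = 0"
    using IVT'[of ?P 0 0 S] neg \<open>0 \<le> ?P S\<close> S0 by auto
  have "s \<noteq> 0" using s neg by auto
  then have ex: "0 < s \<and> ?P s = 0" using s by simp
  have uniq: "s' = s" if "0 < s' \<and> ?P s' = 0" for s'
  proof -
    have "\<not> s < s'" using pressure_strict_mono[of s s' q] that ex q by linarith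
    moreover have "\<not> s' < s" using pressure_strict_mono[of s' s q] that ex q by linarith
    ultimately show ?thesis by linarith
  qed
  have "dim_q T \<mu> q = s"
    unfolding dim_q_def
  proof (rule the_equality)
    show "0 < s \<and> ?P s = 0" by (rule ex)
    show "s' = s" if "0 < s' \<and> ?P s' = 0" for s' using that by (rule uniq)
  qed
  then show "0 < dim_q T \<mu> q" "pressure T \<mu> (dim_q T \<mu> q) q = 0" using ex by auto
qed

text \<open>The pressure increases in both arguments, so a larger q moves its zero to the
  left.\<close>

lemma dim_q_antimono:
  assumes "q \<le> q'" "q' \<le> 1"
  shows "dim_q T \<mu> q' \<le> dim_q T \<mu> q"
proof (rule ccontr)
  assume "\<not> ?thesis"
  then have less: "dim_q T \<mu> q < dim_q T \<mu> q'" by simp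
  have q: "q \<le> 1" using assms by simp
  have "pressure T \<mu> (dim_q T \<mu> q) q < pressure T \<mu> (dim_q T \<mu> q') q"
    using dim_q_root(1)[OF q] less q by (intro pressure_strict_mono) auto
  also have "\<dots> \<le> pressure T \<mu> (dim_q T \<mu> q') q'"
    using dim_q_root(1)[OF assms(2)] assms by (intro pressure_mono_q) auto
  finally show False using dim_q_root(2)[OF q] dim_q_root(2)[OF assms(2)] by simp
qed

text \<open>\<open>Lim\<close> is meaningful only once convergence is known; by monotonicity the
  left limit exists and is the infimum over q < 1, and d_1 is below every term.\<close>

lemma dim_1_le_Lim: "dim_q T \<mu> 1 \<le> Lim (at_left 1) (dim_q T \<mu>)"
proof -
  define l where "l = (INF q\<in>{..<1}. dim_q T \<mu> q)"
  have bdd: "bdd_below (dim_q T \<mu> ` {..<1})"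
    by (rule bdd_belowI2[of _ 0]) (use dim_q_root(1) in \<open>auto simp: less_imp_le\<close>)
  have "(dim_q T \<mu> \<longlongrightarrow> l) (at_left 1)"
  proof (rule order_tendstoI)
    fix a assume a: "a < l"
    show "\<forall>\<^sub>F q in at_left 1. a < dim_q T \<mu> q"
      unfolding eventually_at_left[of 0 "1::real", simplified]
    proof (intro exI[of _ 0] conjI allI impI)
      fix q :: real assume "q < 1"
      then have "l \<le> dim_q T \<mu> q" unfolding l_def using bdd by (intro cINF_lower) auto
      then show "a < dim_q T \<mu> q" using a by simp
    qed simp
  next
    fix a assume a: "l < a"
    have "\<exists>q\<in>{..<1}. dim_q T \<mu> q < a"
    proof (rule ccontr)
      assume "\<not> ?thesis"
      then have "a \<le> l" unfolding l_def by (intro cINF_greatest) (auto simp: not_less intro: exI[of _ 0])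
      then show False using a by simp
    qed
    then obtain q0 where q0: "q0 < 1" "dim_q T \<mu> q0 < a" by auto
    show "\<forall>\<^sub>F q in at_left 1. dim_q T \<mu> q < a"
      unfolding eventually_at_left[OF q0(1)]
    proof (intro exI[of _ q0] conjI allI impI)
      fix q assume "q0 < q" "q < 1"
      then have "dim_q T \<mu> q \<le> dim_q T \<mu> q0" by (intro dim_q_antimono) auto
      then show "dim_q T \<mu> q < a" using q0(2) by simp
    qed (rule q0(1))
  qed
  then have "Lim (at_left 1) (dim_q T \<mu>) = l" by (intro tendsto_Lim) auto
  moreover have "dim_q T \<mu> 1 \<le> l" unfolding l_def
    using dim_q_antimono by (intro cINF_greatest) (auto intro: exI[of _ 0])
  ultimately show ?thesis by simp
qed

section \<open>Growth along typical sequences\<close>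

lemma logratio_typical:
  assumes s: "0 \<le> s"
  shows "\<gamma> > - pressure T \<mu> s 1 \<Longrightarrow> AE x in \<mu>. \<forall>\<^sub>F n in sequentially. logratio s (initial x n) \<le> \<gamma> * real n"
    and "\<beta> < - pressure T \<mu> s 1 \<Longrightarrow> AE x in \<mu>. \<forall>\<^sub>F n in sequentially. \<beta> * real n \<le> logratio s (initial x n)"
proof -
  obtain K where K: "K \<ge> 0" "\<And>w. \<bar>logratio s w\<bar> \<le> K * real (length w)" using logratio_bound[OF s] by blast
  have "\<bar>logratio s w\<bar> \<le> K * real (length w) + K" for w using K(2)[of w] K(1) by simp
  from kingman[of "logratio s", OF logratio_append[OF s] this] obtain l where
    l: "(\<lambda>n. 1 / real n * (\<Sum>w | length w = n. measure \<mu> (cylinder w) * logratio s w)) \<longlonglongrightarrow> l"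
    "\<And>\<gamma>. \<gamma>>l \<Longrightarrow> AE x in \<mu>. \<forall>\<^sub>F n in sequentially. logratio s (initial x n) \<le> \<gamma> * real n"
    "\<And>\<beta>. \<beta><l \<Longrightarrow> AE x in \<mu>. \<forall>\<^sub>F n in sequentially. \<beta> * real n \<le> logratio s (initial x n)" by blast
  have "(\<lambda>n. - (1 / real n * (\<Sum>w | length w = n. measure \<mu> (cylinder w) * logratio s w))) \<longlonglongrightarrow> pressure T \<mu> s 1"
    using pressure_tendsto[OF s, of 1] by (simp add: level_mean_def exp_mean_def)
  then have "pressure T \<mu> s 1 = - l" using tendsto_minus[OF l(1)] LIMSEQ_unique by blast
  then show "\<gamma> > - pressure T \<mu> s 1 \<Longrightarrow> AE x in \<mu>. \<forall>\<^sub>F n in sequentially. logratio s (initial x n) \<le> \<gamma> * real n"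
    and "\<beta> < - pressure T \<mu> s 1 \<Longrightarrow> AE x in \<mu>. \<forall>\<^sub>F n in sequentially. \<beta> * real n \<le> logratio s (initial x n)"
    using l(2,3) by auto
qed

lemma typical_below:
  assumes "0 \<le> s" "s < dim_q T \<mu> 1"
  shows "\<exists>\<delta>>0. AE x in \<mu>. \<forall>\<^sub>F n in sequentially. \<delta> * real n \<le> logratio s (initial x n)"
proof -
  have "pressure T \<mu> s 1 < 0" using pressure_strict_mono[OF assms, of 1] dim_q_root[of 1] by simp
  then show ?thesis using logratio_typical(2)[OF assms(1), of "- pressure T \<mu> s 1 / 2"]
    by (intro exI[of _ "- pressure T \<mu> s 1 / 2"]) auto
qed

lemma typical_above:
  assumes "dim_q T \<mu> 1 < s"
  shows "\<exists>\<delta>>0. AE x in \<mu>. \<forall>\<^sub>F n in sequentially. logratio s (initial x n) \<le> - \<delta> * real n"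
proof -
  have d: "0 \<le> dim_q T \<mu> 1" using dim_q_root[of 1] by simp
  then have "0 < pressure T \<mu> s 1" using pressure_strict_mono[OF d assms, of 1] dim_q_root[of 1] by simp
  then show ?thesis using logratio_typical(1)[of s "- pressure T \<mu> s 1 / 2"] assms d
    by (intro exI[of _ "pressure T \<mu> s 1 / 2"]) auto
qed

end

section \<open>Local dimensions from ball masses\<close>

text \<open>A bound along scales that shrink by at most a factor \<open>b\<close> per step gives a
  bound for every small radius, with the constant \<open>(b / C) powr s\<close>. Monotonicity of the
  scales is not assumed, so the first admissible index is used.\<close>

lemma interpolate_radii:
  fixes g :: "real \<Rightarrow> real" and a :: "nat \<Rightarrow> real"
  assumes mono: "\<And>r r'. r \<le> r' \<Longrightarrow> g r \<le> g r'"
    and a: "\<And>k. 0 < a k" "a \<longlonglongrightarrow> 0" "\<And>k. b * a k \<le> a (Suc k)" and b: "0 < b" and C: "0 < C" and s: "0 \<le> s"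
    and ev: "\<forall>\<^sub>F k in sequentially. a k powr s \<le> g (C * a k)"
  shows "\<exists>A>0. \<forall>\<^sub>F r in at_right 0. A * r powr s \<le> g r"
proof (intro exI[of _ "(b / C) powr s"] conjI)
  obtain k0 where k0: "\<And>k. k0 \<le> k \<Longrightarrow> a k powr s \<le> g (C * a k)" using ev by (auto simp: eventually_sequentially)
  have pos: "0 < C * a k0" using C a(1) by simp
  show "\<forall>\<^sub>F r in at_right 0. (b / C) powr s * r powr s \<le> g r"
    unfolding eventually_at_right[OF pos]
  proof (intro exI[of _ "C * a k0"] conjI allI impI pos)
    fix r :: real assume r: "0 < r" "r < C * a k0"
    have "\<forall>\<^sub>F k in sequentially. a k < r / C" using a(2) r C by (intro order_tendstoD) auto
    then have "\<forall>\<^sub>F k in sequentially. C * a k \<le> r \<and> k0 \<le> k"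
      using eventually_ge_at_top[of k0] by eventually_elim (use C in \<open>simp add: field_simps\<close>)
    then have ex: "\<exists>k. C * a k \<le> r \<and> k0 \<le> k" by (auto simp: eventually_sequentially)
    \<comment> \<open>At this first index the scale fits under \<open>r\<close>, while its
      predecessor does not; hence \<open>a k\<close> is at least \<open>(b / C) * r\<close>.\<close>
    define k where "k = (LEAST k. C * a k \<le> r \<and> k0 \<le> k)"
    have k: "C * a k \<le> r" "k0 \<le> k" using LeastI_ex[OF ex] by (auto simp: k_def)
    have "k \<noteq> k0" using k r by auto
    then obtain k' where k': "k = Suc k'" "k0 \<le> k'" using k(2) by (cases k) auto
    have "\<not> (C * a k' \<le> r \<and> k0 \<le> k')" using not_less_Least[of k' "\<lambda>k. C * a k \<le> r \<and> k0 \<le> k"] k' by (simp add: k_def)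
    then have "r / C < a k'" using k' C by (simp add: field_simps)
    then have "b * (r / C) \<le> b * a k'" using b by (intro mult_left_mono) auto
    also have "\<dots> \<le> a k" using a(3)[of k'] k' by simp
    finally have "(b / C) * r \<le> a k" by simp
    then have "((b / C) * r) powr s \<le> a k powr s" using b C r s by (intro powr_mono2) auto
    also have "\<dots> \<le> g (C * a k)" using k0 k by simp
    also have "\<dots> \<le> g r" using k by (intro mono)
    also have "((b / C) * r) powr s = (b / C) powr s * r powr s" using b C r by (intro powr_mult; simp)
    finally show "(b / C) powr s * r powr s \<le> g r" .
  qed
qed (use b C in simp)

text \<open>The hypothesis involves only dyadic radii, exponents off by
  \<open>1 / (real j + 1)\<close> and a single natural number \<open>i\<close> that is both
  threshold and constant. Such a countable condition defines a measurable set of centres.\<close>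

lemma local_dimension_tendsto:
  fixes g :: "real \<Rightarrow> real"
  assumes mono: "\<And>r r'. r \<le> r' \<Longrightarrow> g r \<le> g r'" and m: "0 < m"
    and bounds: "\<And>j::nat. \<exists>i::nat. \<forall>n\<ge>i. ((1/2) ^ n) powr (m + 1 / (real j + 1)) \<le> (real i + 1) * g ((1/2) ^ n)
       \<and> g ((1/2) ^ n) \<le> (real i + 1) * ((1/2) ^ n) powr (m - 1 / (real j + 1))"
  shows "((\<lambda>r. ln (g r) / ln r) \<longlongrightarrow> m) (at_right 0)"
proof (rule tendstoI)
  fix e :: real assume e: "0 < e"
  obtain j :: nat where j0: "1 / min (e / 2) m < real j" using reals_Archimedean2 by blast
  \<comment> \<open>Besides \<open>d < e / 2\<close>, the choice ensures \<open>d < m\<close>, so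
    that \<open>m - d\<close> is positive and the power is increasing in the radius.\<close>
  define d where "d = 1 / (real j + 1)"
  have d: "0 < d" "d < e / 2" "d < m"
  proof -
    show "0 < d" by (simp add: d_def)
    have mp: "0 < min (e / 2) m" using e m by simp
    have "1 < real j * min (e / 2) m" using j0 mp by (simp add: field_simps)
    moreover have "(real j + 1) * min (e / 2) m = real j * min (e / 2) m + min (e / 2) m"
      by (simp only: distrib_right mult_1)
    ultimately have "1 < (real j + 1) * min (e / 2) m" using mp by linarith
    moreover have "d < x" if "1 < (real j + 1) * x" for x using that by (simp add: d_def field_simps)
    ultimately have "d < min (e / 2) m" by blast
    then show "d < e / 2" "d < m" by auto
  qed
  obtain i :: nat where i: "\<And>n. i \<le> n \<Longrightarrow> ((1/2) ^ n) powr (m + d) \<le> (real i + 1) * g ((1/2) ^ n)"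
     "\<And>n. i \<le> n \<Longrightarrow> g ((1/2) ^ n) \<le> (real i + 1) * ((1/2) ^ n) powr (m - d)"
    using bounds[of j] unfolding d_def[symmetric] by blast
  \<comment> \<open>Passing from a radius to a neighbouring dyadic one costs a factor 2, raised to
    the exponent in question.\<close>
  define A where "A = (1/2) powr (m + d) / (real i + 1)"
  define B where "B = (real i + 1) * 2 powr (m - d)"
  have AB: "0 < A" "0 < B" by (auto simp: A_def B_def add_pos_nonneg)
  have sandwich: "A * r powr (m + d) \<le> g r \<and> g r \<le> B * r powr (m - d)" if r: "0 < r" "r < (1/2) ^ Suc i" for r
  proof -
    have "\<exists>n. (1/2 :: real) ^ n \<le> r" using real_arch_pow_inv[OF r(1), of "1/2"] by (auto intro: less_imp_le)
    define n where "n = (LEAST n. (1/2 :: real) ^ n \<le> r)"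
    have n: "(1/2 :: real) ^ n \<le> r" using LeastI_ex[OF \<open>\<exists>n. (1/2 :: real) ^ n \<le> r\<close>] by (simp add: n_def)
    have "\<not> n \<le> Suc i"
    proof
      assume "n \<le> Suc i"
      then have "(1/2 :: real) ^ Suc i \<le> (1/2) ^ n" by (intro power_decreasing) auto
      then show False using n r by simp
    qed
    then obtain n' where n': "n = Suc n'" "i \<le> n'" by (cases n) auto
    have "\<not> (1/2 :: real) ^ n' \<le> r" using not_less_Least[of n' "\<lambda>n. (1/2 :: real) ^ n \<le> r"] n' by (simp add: n_def)
    then have r1: "r \<le> (1/2) ^ n'" by simp
    have r2: "(1/2) * r \<le> (1/2) ^ n" using r1 n' by simp
    have r3: "(1/2) ^ n' \<le> 2 * r" using n n' by simp
    have "((1/2) * r) powr (m + d) \<le> ((1/2) ^ n) powr (m + d)" using r r2 m d by (intro powr_mono2) auto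
    also have "\<dots> \<le> (real i + 1) * g ((1/2) ^ n)" by (rule i(1)) (use n' in simp)
    also have "\<dots> \<le> (real i + 1) * g r" using mono[OF n] by (intro mult_left_mono) auto
    finally have "A * r powr (m + d) \<le> g r" unfolding A_def powr_mult
      by (simp add: field_simps add_pos_nonneg)
    moreover have "g r \<le> B * r powr (m - d)"
    proof -
      have "g r \<le> g ((1/2) ^ n')" by (rule mono[OF r1])
      also have "\<dots> \<le> (real i + 1) * ((1/2) ^ n') powr (m - d)" by (rule i(2)[OF n'(2)])
      also have "\<dots> \<le> (real i + 1) * (2 * r) powr (m - d)"
        using r3 d by (intro mult_left_mono powr_mono2) auto
      finally show ?thesis using r by (simp add: B_def powr_mult mult.assoc)
    qed
    ultimately show ?thesis by simp
  qed
  have lim: "((\<lambda>r. ln A / ln r) \<longlongrightarrow> 0) (at_right (0::real))" "((\<lambda>r. ln B / ln r) \<longlongrightarrow> 0) (at_right (0::real))"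
    by (intro tendsto_divide_0[OF tendsto_const] filterlim_at_bot_imp_at_infinity ln_at_0)+
  have "0 < e / 2" using e by simp
  note tendstoD[OF lim(1) this] tendstoD[OF lim(2) this]
  moreover have "\<forall>\<^sub>F r in at_right (0::real). r \<in> {0<..<(1/2) ^ Suc i}"
    by (rule eventually_at_right_real) simp
  ultimately show "\<forall>\<^sub>F r in at_right 0. dist (ln (g r) / ln r) m < e"
  proof eventually_elim
    case (elim r)
    have "(1/2 :: real) ^ Suc i < 1" by (rule power_Suc_less_one) auto
    then have r: "0 < r" "r < 1" "ln r < 0" using elim(3) by auto
    have sw: "A * r powr (m + d) \<le> g r" "g r \<le> B * r powr (m - d)" using sandwich elim(3) by auto
    have gp: "0 < g r" using sw(1) AB(1) r by (intro less_le_trans[OF _ sw(1)]) simp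
    have "ln (A * r powr (m + d)) \<le> ln (g r)" using sw(1) AB r by (intro ln_mono) auto
    then have 1: "ln A + (m + d) * ln r \<le> ln (g r)" using AB r by (simp add: ln_mult ln_powr)
    have "ln (g r) \<le> ln (B * r powr (m - d))" using sw(2) gp by (intro ln_mono) auto
    then have 2: "ln (g r) \<le> ln B + (m - d) * ln r" using AB r by (simp add: ln_mult ln_powr)
    \<comment> \<open>Division by \<open>ln r\<close>, which is negative, reverses the inequality:
      the lower bound on mass gives the upper bound on dimension.\<close>
    have "ln (g r) / ln r \<le> (ln A + (m + d) * ln r) / ln r" using 1 r by (intro divide_right_mono_neg) auto
    also have "\<dots> = ln A / ln r + (m + d)" using r by (simp add: add_divide_distrib)
    finally have u: "ln (g r) / ln r \<le> ln A / ln r + (m + d)" .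
    have "(ln B + (m - d) * ln r) / ln r \<le> ln (g r) / ln r" using 2 r by (intro divide_right_mono_neg) auto
    moreover have "(ln B + (m - d) * ln r) / ln r = ln B / ln r + (m - d)" using r by (simp add: add_divide_distrib)
    ultimately have l: "ln B / ln r + (m - d) \<le> ln (g r) / ln r" by simp
    have "\<bar>ln A / ln r\<bar> < e / 2" "\<bar>ln B / ln r\<bar> < e / 2" using elim(1,2) unfolding dist_real_def diff_0_right .
    then show ?case using u l d unfolding dist_real_def by linarith
  qed
qed

text \<open>The pieces whose mass falls short of the share \<open>v k j\<close> by more than the
  factor \<open>e k\<close> have total mass at most \<open>e k\<close>, because the shares add up to
  at most 1. Summability then excludes them for large \<open>k\<close> at almost every
  point.\<close>

lemma (in prob_space) pieces_not_too_small:
  fixes v :: "nat \<Rightarrow> 'j \<Rightarrow> real" and P :: "nat \<Rightarrow> 'j \<Rightarrow> 'a set"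
  assumes fin: "\<And>k. finite (J k)" and P: "\<And>k j. j \<in> J k \<Longrightarrow> P k j \<in> sets M"
    and v: "\<And>k j. j \<in> J k \<Longrightarrow> 0 \<le> v k j" "\<And>k. (\<Sum>j\<in>J k. v k j) \<le> 1"
    and e: "summable e" "\<And>k. 0 \<le> (e k :: real)"
  shows "AE x in M. \<forall>\<^sub>F k in sequentially. \<forall>j\<in>J k. x \<in> P k j \<longrightarrow> v k j * e k \<le> measure M (P k j)"
proof -
  define S where "S k = {j \<in> J k. measure M (P k j) < v k j * e k}" for k
  define B where "B k = (\<Union>j\<in>S k. P k j)" for k
  have finS: "finite (S k)" for k using fin by (simp add: S_def)
  have B: "B k \<in> sets M" for k unfolding B_def using finS P by (intro sets.finite_UN) (auto simp: S_def)
  have mB: "measure M (B k) \<le> e k" for k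
  proof -
    have "measure M (B k) \<le> (\<Sum>j\<in>S k. measure M (P k j))"
      unfolding B_def using finS P by (intro measure_UNION_le) (auto simp: S_def)
    also have "\<dots> \<le> (\<Sum>j\<in>S k. v k j * e k)" by (intro sum_mono) (auto simp: S_def)
    also have "\<dots> \<le> (\<Sum>j\<in>J k. v k j * e k)"
      using fin v(1) e(2) by (intro sum_mono2) (auto simp: S_def)
    also have "\<dots> = (\<Sum>j\<in>J k. v k j) * e k" by (simp add: sum_distrib_right)
    also have "\<dots> \<le> 1 * e k" using v(2) e(2) by (intro mult_right_mono) auto
    finally show ?thesis by simp
  qed
  have "summable (\<lambda>k. measure M (B k))"
    by (rule summable_comparison_test'[OF e(1), of 0]) (use mB in auto)
  then have "AE x in M. \<forall>\<^sub>F k in sequentially. x \<in> space M - B k"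
    using B by (intro borel_cantelli_AE1) (auto simp: emeasure_eq_measure)
  then show ?thesis
  proof (rule AE_mp, intro AE_I2 impI)
    fix x assume "\<forall>\<^sub>F k in sequentially. x \<in> space M - B k"
    then show "\<forall>\<^sub>F k in sequentially. \<forall>j\<in>J k. x \<in> P k j \<longrightarrow> v k j * e k \<le> measure M (P k j)"
      by eventually_elim (auto simp: B_def S_def not_less)
  qed
qed

lemma cube_partition:
  assumes R: "0 < R" and e: "0 < \<epsilon>" "\<epsilon> \<le> 1"
  shows "\<exists>(h :: 'a::euclidean_space \<Rightarrow> 'a \<Rightarrow> int) J. finite J \<and> (\<forall>x. norm x \<le> R \<longrightarrow> h x \<in> J)
     \<and> real (card J) \<le> (2 * R + 2) ^ DIM('a) * (1 / \<epsilon>) ^ DIM('a)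
     \<and> (\<forall>j. {y. h y = j} \<in> sets borel)
     \<and> (\<forall>x y. h x = h y \<longrightarrow> dist x y \<le> real DIM('a) * \<epsilon>)"
proof -
  define q where "q b y = (y \<bullet> b) / \<epsilon>" for b y :: 'a
  define h :: "'a \<Rightarrow> 'a \<Rightarrow> int" where "h y = (\<lambda>b\<in>Basis. \<lfloor>q b y\<rfloor>)" for y
  define J where "J = (\<Pi>\<^sub>E b\<in>(Basis :: 'a set). {\<lfloor>- (R / \<epsilon>)\<rfloor>..\<lfloor>R / \<epsilon>\<rfloor>})"
  have "finite J" unfolding J_def by (intro finite_PiE) auto
  moreover have "h x \<in> J" if x: "norm x \<le> R" for x
    unfolding h_def J_def
  proof (rule restrict_PiE_iff[THEN iffD2], rule ballI)
    fix b :: 'a assume b: "b \<in> Basis"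
    have "\<bar>q b x\<bar> = \<bar>x \<bullet> b\<bar> / \<epsilon>" using e by (simp add: q_def)
    also have "\<dots> \<le> R / \<epsilon>" using Basis_le_norm[OF b, of x] x e by (intro divide_right_mono) auto
    finally show "\<lfloor>q b x\<rfloor> \<in> {\<lfloor>- (R / \<epsilon>)\<rfloor>..\<lfloor>R / \<epsilon>\<rfloor>}" by (auto intro!: floor_mono)
  qed
  moreover have "real (card J) \<le> (2 * R + 2) ^ DIM('a) * (1 / \<epsilon>) ^ DIM('a)"
  proof -
    have "real (card J) = real (card {\<lfloor>- (R / \<epsilon>)\<rfloor>..\<lfloor>R / \<epsilon>\<rfloor>}) ^ DIM('a)"
      by (simp add: J_def card_PiE)
    also have "\<dots> \<le> ((2 * R + 2) * (1 / \<epsilon>)) ^ DIM('a)"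
    proof (rule power_mono)
      have "real (card {\<lfloor>- (R / \<epsilon>)\<rfloor>..\<lfloor>R / \<epsilon>\<rfloor>}) \<le> 2 * (R / \<epsilon>) + 2" using R e by (intro card_floor_interval) auto
      also have "\<dots> \<le> (2 * R + 2) * (1 / \<epsilon>)" using e by (simp add: field_simps)
      finally show "real (card {\<lfloor>- (R / \<epsilon>)\<rfloor>..\<lfloor>R / \<epsilon>\<rfloor>}) \<le> (2 * R + 2) * (1 / \<epsilon>)" .
    qed simp
    finally show ?thesis by (simp only: power_mult_distrib)
  qed
  moreover have "{y. h y = j} \<in> sets borel" for j
  proof (cases "j \<in> extensional Basis")
    case True
    have "{y. h y = j} = {y \<in> space borel. \<forall>b\<in>Basis. \<lfloor>q b y\<rfloor> = j b}"
      using True by (auto simp: h_def fun_eq_iff extensional_def restrict_def)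
    also have "\<dots> \<in> sets borel"
    proof (rule sets.sets_Collect_finite_All)
      fix b :: 'a
      have "q b \<in> borel_measurable borel" unfolding q_def by measurable
      then have "(\<lambda>y. \<lfloor>q b y\<rfloor>) \<in> measurable borel (count_space UNIV)" by measurable
      then have "(\<lambda>y. \<lfloor>q b y\<rfloor>) -` {j b} \<inter> space borel \<in> sets borel" by (rule measurable_sets) simp
      then show "{y \<in> space borel. \<lfloor>q b y\<rfloor> = j b} \<in> sets borel" by (simp add: vimage_def Int_def)
    qed auto
    finally show ?thesis .
  next
    case False
    then have "{y. h y = j} = {}" by (auto simp: h_def)
    then show ?thesis by simp
  qed
  moreover have "dist x y \<le> real DIM('a) * \<epsilon>" if xy: "h x = h y" for x y
  proof -
    have "norm (x - y) \<le> (\<Sum>b\<in>Basis. \<bar>(x - y) \<bullet> b\<bar>)" by (rule norm_le_l1)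
    also have "\<dots> \<le> (\<Sum>b\<in>(Basis :: 'a set). \<epsilon>)"
    proof (rule sum_mono)
      fix b :: 'a assume b: "b \<in> Basis"
      have "h x b = h y b" using xy by simp
      then have "\<lfloor>q b x\<rfloor> = \<lfloor>q b y\<rfloor>" using b by (simp add: h_def)
      then have "\<bar>q b x - q b y\<bar> \<le> 1" by linarith
      also have "q b x - q b y = ((x - y) \<bullet> b) / \<epsilon>" by (simp add: q_def inner_diff_left diff_divide_distrib)
      finally show "\<bar>(x - y) \<bullet> b\<bar> \<le> \<epsilon>" using e by simp
    qed
    finally show ?thesis by (simp add: dist_norm)
  qed
  ultimately show ?thesis by blast
qed

lemma sv_fun_split:
  fixes T :: "'a::euclidean_space \<Rightarrow> 'a"
  assumes T: "linear T" and s: "0 < s" "s \<le> real DIM('a)"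
  defines "p \<equiv> nat \<lceil>s\<rceil> - 1"
  shows "p < DIM('a)" "sv_fun s T = (\<Prod>i<p. singular_values T ! i) * (singular_values T ! p) powr (s - real p)"
proof -
  have p: "nat \<lceil>s\<rceil> = Suc p" using s by (simp add: p_def)
  show pd: "p < DIM('a)" using p s(2) by linarith
  have "prod_list (take p (singular_values T)) = (\<Prod>i<p. singular_values T ! i)"
    using pd length_singular_values[OF T] by (simp add: prod.list_conv_set_nth atLeast0LessThan)
  then show "sv_fun s T = (\<Prod>i<p. singular_values T ! i) * (singular_values T ! p) powr (s - real p)"
    using s p by (simp add: sv_fun_def Let_def)
qed

lemma riesz_kernel_ge:
  assumes "0 \<le> s" "norm z \<le> r" "0 < r"
  shows "inverse (ennreal (r powr s)) \<le> riesz_kernel s z"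
proof (cases "s = 0 \<or> norm z powr s = 0")
  \<comment> \<open>For \<open>s = 0\<close> both sides are 1; otherwise \<open>z = 0\<close>, where
    the kernel is infinite.\<close>
  case True
  then show ?thesis using assms by (auto simp: riesz_kernel_def)
next
  case False
  then have pos: "0 < norm z powr s" by simp
  have "norm z powr s \<le> r powr s" using assms by (intro powr_mono2) auto
  then have "inverse (r powr s) \<le> inverse (norm z powr s)" using pos by (intro le_imp_inverse_le) auto
  then show ?thesis using False pos assms by (simp add: riesz_kernel_def inverse_ennreal ennreal_leI)
qed

lemma riesz_kernel_measurable [measurable]:
  "riesz_kernel s \<in> borel_measurable (borel :: 'a::{real_normed_vector, second_countable_topology} measure)"
  unfolding riesz_kernel_def by measurable

lemma uniform_contraction_bounds:
  fixes T :: "'m::finite \<Rightarrow> 'a::euclidean_space \<Rightarrow> 'a"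
  assumes T: "\<And>i. nonsingular_contraction (T i)"
  shows "\<exists>\<kappa> \<iota>. 0 < \<kappa> \<and> \<kappa> < 1 \<and> 0 < \<iota> \<and> \<iota> < 1 \<and> (\<forall>i v. norm (T i v) \<le> \<kappa> * norm v \<and> \<iota> * norm v \<le> norm (T i v))"
proof -
  have lin: "linear (T i)" "onorm (T i) < 1" "bij (T i)" for i using T[of i] by (auto simp: nonsingular_contraction_def)
  define \<kappa> where "\<kappa> = max (1/2) (Max (range (\<lambda>i. onorm (T i))))"
  have k: "onorm (T i) \<le> \<kappa>" for i unfolding \<kappa>_def by (intro max.coboundedI2 Max_ge) auto
  have "norm (T i v) \<le> \<kappa> * norm v" for i v
  proof -
    have "norm (T i v) \<le> onorm (T i) * norm v" using lin(1)[of i] by (intro onorm) (simp add: linear_conv_bounded_linear)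
    also have "\<dots> \<le> \<kappa> * norm v" using k by (intro mult_right_mono) auto
    finally show ?thesis .
  qed
  moreover have "0 < \<kappa>" "\<kappa> < 1" using lin(2) by (auto simp: \<kappa>_def)
  moreover have "\<forall>i. \<exists>B>0. \<forall>v. B * norm v \<le> norm (T i v)"
    using linear_inj_bounded_below_pos[OF lin(1) bij_is_inj[OF lin(3)]] by metis
  then obtain B where B: "\<And>i. B i > 0" "\<And>i v. B i * norm v \<le> norm (T i v)" by metis
  define \<iota> where "\<iota> = min (1/2) (Min (range B))"
  have "\<iota> * norm v \<le> norm (T i v)" for i v
  proof -
    have "\<iota> \<le> B i" unfolding \<iota>_def by (intro min.coboundedI2 Min_le) auto
    then have "\<iota> * norm v \<le> B i * norm v" by (intro mult_right_mono) auto
    then show ?thesis using B(2)[of i v] by simp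
  qed
  moreover have "0 < \<iota>" "\<iota> < 1" using B(1) by (auto simp: \<iota>_def)
  ultimately show ?thesis by blast
qed

section \<open>The projected measure\<close>

context self_affine
begin

section \<open>Geometry and measurability of the projection\<close>

text \<open>A term of the series depends on the sequence only through one finite word, so it is a
  function on a countable set. Measurability, jointly with \<omega> as well, then reduces to single
  words.\<close>

definition cp_term :: "('m list \<Rightarrow> 'a) \<Rightarrow> 'm list \<Rightarrow> 'a" where
  "cp_term \<omega> v = word_map T (butlast v) (\<omega> v)"

lemma code_point_eq: "code_point T \<omega> x = (\<Sum>k. cp_term \<omega> (initial x (Suc k)))"
  by (simp add: code_point_def cp_term_def initial_Suc)

text \<open>The tail of the series after \<open>n\<close> terms is \<open>word_map T w\<close>
  applied to a series dominated by a geometric one. Hence the image of a cylinder lies in a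
  translate of the image of a fixed ball under \<open>word_map T w\<close>, with a translation that
  depends on \<open>w\<close> alone.\<close>

lemma code_point_split:
  assumes M: "\<And>w. w \<noteq> [] \<Longrightarrow> norm (\<omega> w) \<le> M" and n: "length w = n" and x: "x \<in> cylinder w"
  shows "\<exists>y. norm y \<le> M / (1 - \<kappa>) \<and> code_point T \<omega> x = (\<Sum>k<n. cp_term \<omega> (take (Suc k) w)) + word_map T w y"
proof -
  have M0: "0 \<le> M" using M[of "[undefined]"] norm_ge_zero by (metis list.distinct(1) order_trans)
  have geo: "summable (\<lambda>k. M * \<kappa> ^ k)" using \<kappa> by (intro summable_mult summable_geometric) simp
  have bd: "norm (word_map T (initial y k) (\<omega> (v @ initial z (Suc k)))) \<le> M * \<kappa> ^ k" for y z v k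
  proof -
    have "norm (word_map T (initial y k) (\<omega> (v @ initial z (Suc k)))) \<le> \<kappa> ^ k * norm (\<omega> (v @ initial z (Suc k)))"
      using word_map_le[of "initial y k"] by simp
    also have "\<dots> \<le> \<kappa> ^ k * M" using \<kappa> by (intro mult_left_mono M) (auto simp: initial_Suc)
    finally show ?thesis by (simp add: mult.commute)
  qed
  have xw: "initial x n = w" using x n by (simp add: mem_cylinder)
  define z where "z = (shift ^^ n) x"
  define f where "f k = word_map T (initial z k) (\<omega> (w @ initial z (Suc k)))" for k
  have sumf: "summable f" by (rule summable_comparison_test'[OF geo, of 0]) (use bd[of z _ w z] in \<open>simp add: f_def\<close>)
  have sum: "summable (\<lambda>k. cp_term \<omega> (initial x (Suc k)))"
    by (rule summable_comparison_test'[OF geo, of 0])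
      (use bd[of x _ "[]" x] in \<open>simp add: cp_term_def initial_Suc\<close>)
  have tail: "cp_term \<omega> (initial x (Suc (k + n))) = word_map T w (f k)" for k
  proof -
    have "initial x (n + k) = w @ initial z k" "initial x (n + Suc k) = w @ initial z (Suc k)"
      by (simp_all only: initial_add xw z_def)
    then show ?thesis by (simp add: cp_term_def f_def word_map_append add.commute initial_Suc butlast_append)
  qed
  have "code_point T \<omega> x = (\<Sum>k. cp_term \<omega> (initial x (Suc (k + n)))) + (\<Sum>k<n. cp_term \<omega> (initial x (Suc k)))"
    unfolding code_point_eq by (rule suminf_split_initial_segment[OF sum])
  also have "(\<Sum>k. cp_term \<omega> (initial x (Suc (k + n)))) = (\<Sum>k. word_map T w (f k))" by (simp only: tail)
  also have "\<dots> = word_map T w (\<Sum>k. f k)"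
    using word_map_linear[of w] sumf by (intro bounded_linear.suminf[symmetric]) (simp_all add: linear_conv_bounded_linear)
  also have "(\<Sum>k<n. cp_term \<omega> (initial x (Suc k))) = (\<Sum>k<n. cp_term \<omega> (take (Suc k) w))"
    by (intro sum.cong refl) (simp add: xw[symmetric] take_initial)
  finally have "code_point T \<omega> x = (\<Sum>k<n. cp_term \<omega> (take (Suc k) w)) + word_map T w (\<Sum>k. f k)" by simp
  moreover have "norm (\<Sum>k. f k) \<le> M / (1 - \<kappa>)"
  proof -
    have "norm (\<Sum>k. f k) \<le> (\<Sum>k. M * \<kappa> ^ k)"
      using bd[of z _ w z] by (intro norm_suminf_le[OF _ geo]) (simp add: f_def)
    also have "\<dots> = M / (1 - \<kappa>)" using \<kappa> by (simp add: suminf_mult suminf_geometric)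
    finally show ?thesis .
  qed
  ultimately show ?thesis by blast
qed

lemma code_point_measurable [measurable]: "code_point T \<omega> \<in> borel_measurable code_borel"
  unfolding code_point_eq[abs_def]
proof (rule borel_measurable_suminf)
  show "(\<lambda>x. cp_term \<omega> (initial x (Suc k))) \<in> borel_measurable code_borel" for k
    by (rule measurable_compose[OF measurable_initial]) simp
qed

lemma code_point_measurable_pair:
  assumes "(\<lambda>\<omega>. \<omega>) \<in> P \<rightarrow>\<^sub>M Pi\<^sub>M UNIV (\<lambda>_. borel)"
  shows "(\<lambda>z. code_point T (fst z) (snd z)) \<in> borel_measurable (P \<Otimes>\<^sub>M \<mu>)"
  unfolding code_point_eq
proof (rule borel_measurable_suminf)
  fix k
  show "(\<lambda>z. cp_term (fst z) (initial (snd z) (Suc k))) \<in> borel_measurable (P \<Otimes>\<^sub>M \<mu>)"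
  proof (rule measurable_compose_countable)
    fix v :: "'m list"
    have "(\<lambda>\<omega>. \<omega> v) \<in> borel_measurable P"
      using measurable_compose[OF assms measurable_component_singleton[of v UNIV "\<lambda>_. borel"]] by simp
    moreover have "word_map T (butlast v) \<in> borel_measurable borel"
      using word_map_linear[of "butlast v"] by (intro borel_measurable_continuous_onI linear_continuous_on) (simp add: linear_conv_bounded_linear)
    ultimately have "(\<lambda>\<omega>. cp_term \<omega> v) \<in> borel_measurable P"
      unfolding cp_term_def by (rule measurable_compose)
    then show "(\<lambda>z. cp_term (fst z) v) \<in> borel_measurable (P \<Otimes>\<^sub>M \<mu>)" by (rule measurable_compose[OF measurable_fst])
  next
    have "(\<lambda>x. initial x (Suc k)) \<in> measurable \<mu> (count_space UNIV)"
      using measurable_initial by (simp only: measurable_cong_sets[OF sets_mu refl])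
    then show "(\<lambda>z. initial (snd z) (Suc k)) \<in> measurable (P \<Otimes>\<^sub>M \<mu>) (count_space UNIV)"
      by (rule measurable_compose[OF measurable_snd])
  qed
qed

lemma measure_projected:
  assumes "A \<in> sets borel"
  shows "measure (projected_measure T \<mu> \<omega>) A = measure \<mu> {x. code_point T \<omega> x \<in> A}"
proof -
  have "code_point T \<omega> \<in> borel_measurable \<mu>"
    using code_point_measurable by (simp only: measurable_cong_sets[OF sets_mu refl])
  then show ?thesis unfolding projected_measure_def
    using assms by (subst measure_distr) (auto simp: vimage_def)
qed

lemma projected_ball_ge:
  assumes "A \<in> sets \<mu>" "\<And>y. y \<in> A \<Longrightarrow> dist z (code_point T \<omega> y) \<le> r"
  shows "measure \<mu> A \<le> measure (projected_measure T \<mu> \<omega>) (cball z r)"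
proof -
  have "code_point T \<omega> -` cball z r \<inter> space code_borel \<in> sets code_borel"
    by (rule measurable_sets[OF code_point_measurable]) simp
  then have "{x. code_point T \<omega> x \<in> cball z r} \<in> sets \<mu>" by (simp add: vimage_def)
  then show ?thesis
    using assms by (subst measure_projected) (auto intro!: finite_measure_mono)
qed

lemma projected_mono: "r \<le> r' \<Longrightarrow> measure (projected_measure T \<mu> \<omega>) (cball z r) \<le> measure (projected_measure T \<mu> \<omega>) (cball z r')"
proof -
  assume "r \<le> r'"
  have "code_point T \<omega> \<in> borel_measurable \<mu>"
    using code_point_measurable by (simp only: measurable_cong_sets[OF sets_mu refl])
  then interpret D: prob_space "projected_measure T \<mu> \<omega>"
    unfolding projected_measure_def by (rule prob_space_distr)
  show ?thesis using \<open>r \<le> r'\<close> by (intro D.finite_measure_mono) (auto simp: projected_measure_def)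
qed

text \<open>Each cylinder is cut into pieces of diameter comparable to \<open>\<alpha>\<^sub>p\<close>, where \<open>p < s \<le> p + 1\<close>.
  By the Borel--Cantelli lemma a typical point lies in pieces that carry almost their fair share of the
  mass of the cylinder.\<close>

lemma ball_mass_ge_entropy:
  assumes M: "\<And>w. w \<noteq> [] \<Longrightarrow> norm (\<omega> w) \<le> M" "0 < M"
    and s: "dim_q T \<mu> 1 < s" "s \<le> real DIM('a)"
  shows "AE x in \<mu>. \<exists>A>0. \<forall>\<^sub>F r in at_right 0.
      A * r powr s \<le> measure (projected_measure T \<mu> \<omega>) (cball (code_point T \<omega> x) r)"
proof -
  let ?\<pi> = "code_point T \<omega>" and ?p = "\<lambda>w. measure \<mu> (cylinder w)"
  let ?sv = "\<lambda>w i. singular_values (word_map T w) ! i"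
  let ?g = "\<lambda>x r. measure (projected_measure T \<mu> \<omega>) (cball (?\<pi> x) r)"
  have s0: "0 < s" using dim_q_root(1)[of 1] s by simp
  define p where "p = nat \<lceil>s\<rceil> - 1"
  note sp = sv_fun_split[OF word_map_linear s0 s(2), folded p_def]
  define R where "R = M / (1 - \<kappa>)"
  have R: "0 < R" using M \<kappa> by (simp add: R_def)
  define C1 where "C1 = (2 * R + 2) ^ p"
  define C2 where "C2 = real DIM('a) * (1 + 2 * R)"
  have C: "0 < C1" "0 < C2" using R by (auto simp: C1_def C2_def)
  define ctr where "ctr w = (\<Sum>k<length w. cp_term \<omega> (take (Suc k) w))" for w
  have split: "\<exists>y. norm y \<le> R \<and> ?\<pi> x = ctr w + word_map T w y" if "x \<in> cylinder w" for x w
    using code_point_split[OF M(1) refl that] by (simp add: R_def ctr_def)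
  have "\<forall>w. \<exists>(h :: 'a \<Rightarrow> nat \<Rightarrow> int) J. finite J \<and> (\<forall>x. norm x \<le> R \<longrightarrow> h (word_map T w x) \<in> J)
     \<and> real (card J) \<le> C1 * (\<Prod>i<p. ?sv w i / ?sv w p)
     \<and> (\<forall>j. {y. h y = j} \<in> sets borel)
     \<and> (\<forall>x y. norm x \<le> R \<longrightarrow> norm y \<le> R \<longrightarrow> h (word_map T w x) = h (word_map T w y) \<longrightarrow>
          dist (word_map T w x) (word_map T w y) \<le> C2 * ?sv w p)"
    unfolding C1_def C2_def using ellipsoid_partition[OF word_map_linear sv_word_pos R sp(1)] by blast
  then obtain h J where hJ: "\<And>w. finite (J w :: (nat \<Rightarrow> int) set)"
    "\<And>w x. norm x \<le> R \<Longrightarrow> h w (word_map T w x) \<in> J w"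
    "\<And>w. real (card (J w)) \<le> C1 * (\<Prod>i<p. ?sv w i / ?sv w p)"
    "\<And>w j. {y. h w y = j} \<in> sets borel"
    "\<And>w x y. norm x \<le> R \<Longrightarrow> norm y \<le> R \<Longrightarrow> h w (word_map T w x) = h w (word_map T w y) \<Longrightarrow>
          dist (word_map T w x) (word_map T w y) \<le> C2 * ?sv w p"
    by metis
  define P where "P w j = cylinder w \<inter> {x. h w (?\<pi> x - ctr w) = j}" for w j
  have Pm: "P w j \<in> sets \<mu>" for w j
  proof -
    have "(\<lambda>x. ?\<pi> x - ctr w) -` {y. h w y = j} \<inter> space code_borel \<in> sets code_borel"
      by (rule measurable_sets[OF _ hJ(4)]) measurable
    then show ?thesis by (simp add: P_def vimage_def sets.Int)
  qed
  have cardJ: "0 < card (J w)" for w using hJ(1) hJ(2)[of 0 w] R by (auto simp: card_gt_0_iff)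
  obtain \<delta> where \<delta>: "0 < \<delta>" "AE x in \<mu>. \<forall>\<^sub>F n in sequentially. logratio s (initial x n) \<le> - \<delta> * real n"
    using typical_above[OF s(1)] by blast
  \<comment> \<open>Half of the exponential gain \<delta> is spent on the summable loss in the
    Borel-Cantelli argument; the other half will beat the constant \<open>C1\<close>.\<close>
  define e where "e k = exp (- \<delta> / 2) ^ k" for k :: nat
  have e: "summable e" unfolding e_def using \<delta> by (intro summable_geometric) simp
  have e_eq: "e k = exp (- (\<delta> / 2) * real k)" for k by (simp add: e_def exp_of_nat_mult[symmetric] mult.commute)
  have "AE x in \<mu>. \<forall>\<^sub>F k in sequentially. \<forall>z\<in>(SIGMA w:{w. length w = k}. J w). x \<in> (\<lambda>(w, j). P w j) z \<longrightarrow>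
      (\<lambda>(w, j). ?p w / real (card (J w))) z * e k \<le> measure \<mu> ((\<lambda>(w, j). P w j) z)"
  proof (rule pieces_not_too_small)
    show "finite (SIGMA w:{w. length w = k}. J w)" for k using hJ(1) by (intro finite_SigmaI) auto
    show "(\<Sum>z\<in>(SIGMA w:{w. length w = k}. J w). (\<lambda>(w, j). ?p w / real (card (J w))) z) \<le> 1" for k
    proof -
      have "(\<Sum>z\<in>(SIGMA w:{w. length w = k}. J w). (\<lambda>(w, j). ?p w / real (card (J w))) z)
        = (\<Sum>w | length w = k. \<Sum>j\<in>J w. ?p w / real (card (J w)))"
        using hJ(1) by (subst sum.Sigma) auto
      also have "\<dots> = (\<Sum>w | length w = k. ?p w)" using cardJ by (intro sum.cong) (auto simp: less_imp_neq[symmetric])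
      finally show ?thesis using sum_cylinders[of k] by simp
    qed
  qed (use Pm e \<delta>(1) in \<open>auto simp: e_def\<close>)
  with \<delta>(2) show ?thesis
  proof eventually_elim
    case (elim x)
    define a where "a k = ?sv (initial x k) p" for k
    have a0: "0 < a k" for k unfolding a_def by (rule sv_word_pos[OF sp(1)])
    show ?case
    proof (rule interpolate_radii[where a = a and b = \<iota> and C = C2])
      have "a k \<le> \<kappa> ^ k" for k unfolding a_def using sv_word_le[OF sp(1), of "initial x k"] by simp
      moreover have "(\<lambda>k. \<kappa> ^ k) \<longlonglongrightarrow> 0" using \<kappa> by (intro LIMSEQ_realpow_zero) auto
      ultimately show "a \<longlonglongrightarrow> 0" using a0
        by (intro tendsto_sandwich[of "\<lambda>_. 0" a sequentially "\<lambda>k. \<kappa> ^ k"]) (auto intro!: always_eventually simp: less_imp_le)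
      show "\<iota> * a k \<le> a (Suc k)" for k
      proof -
        have "\<iota> * ?sv (initial x k) p \<le> singular_values (word_map T (initial x k) \<circ> T (x k)) ! p"
          by (rule singular_value_comp_right[OF word_map_linear linT bijT T_ge \<iota>(1) sp(1)])
        then show ?thesis by (simp add: a_def initial_Suc word_map_append)
      qed
      have "\<forall>\<^sub>F k in sequentially. C1 \<le> exp (\<delta> / 2 * real k)"
      proof -
        obtain k0 :: nat where "C1 / (\<delta> / 2) < real k0" using reals_Archimedean2 by blast
        then have k0: "C1 < \<delta> / 2 * real k0" using \<delta> by (simp add: field_simps)
        have "C1 \<le> exp (\<delta> / 2 * real k)" if "k0 \<le> k" for k
        proof -
          have "\<delta> / 2 * real k0 \<le> \<delta> / 2 * real k" using that \<delta> by (intro mult_left_mono) auto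
          then show ?thesis using k0 exp_ge_add_one_self[of "\<delta> / 2 * real k"] by linarith
        qed
        then show ?thesis by (auto simp: eventually_sequentially)
      qed
      with elim show "\<forall>\<^sub>F k in sequentially. a k powr s \<le> ?g x (C2 * a k)"
      proof eventually_elim
        case (elim k)
        define w where "w = initial x k"
        have xw: "x \<in> cylinder w" by (simp add: w_def mem_cylinder)
        obtain y where y: "norm y \<le> R" "?\<pi> x = ctr w + word_map T w y" using split[OF xw] by blast
        define j where "j = h w (word_map T w y)"
        have jJ: "j \<in> J w" using hJ(2)[OF y(1)] by (simp add: j_def)
        have xP: "x \<in> P w j" using xw y by (simp add: P_def j_def)
        have "(w, j) \<in> (SIGMA w:{w. length w = k}. J w)" using jJ by (simp add: w_def)
        then have mass: "?p w / real (card (J w)) * e k \<le> measure \<mu> (P w j)" using elim(2) xP by fastforce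
        have "measure \<mu> (P w j) \<le> ?g x (C2 * a k)"
        proof (rule projected_ball_ge[OF Pm])
          fix x' assume x': "x' \<in> P w j"
          then obtain y' where y': "norm y' \<le> R" "?\<pi> x' = ctr w + word_map T w y'" using split[of x' w] by (auto simp: P_def)
          have "h w (word_map T w y) = h w (word_map T w y')" using x' y' by (simp add: P_def j_def)
          from hJ(5)[OF y(1) y'(1) this] show "dist (?\<pi> x) (?\<pi> x') \<le> C2 * a k"
            using y y' by (simp add: a_def w_def[symmetric])
        qed
        moreover have "a k powr s \<le> ?p w / real (card (J w)) * e k"
        proof -
          have f0: "0 < sv_fun s (word_map T w)" using s0 by (intro sv_word_fun_pos) simp
          have ak: "a k = ?sv w p" by (simp add: a_def w_def)
          \<comment> \<open>The number of cells is comparable to \<phi>^s divided by the s-th power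
            of the cell size, because \<phi>^s contains \<alpha>_{p+1} to the power s - p. This is
            where the choice of \<open>p\<close> matters.\<close>
          have "(\<Prod>i<p. ?sv w i / ?sv w p) = (\<Prod>i<p. ?sv w i) / a k powr real p"
            using a0[of k] by (simp add: prod_dividef ak powr_realpow)
          also have "\<dots> = sv_fun s (word_map T w) / a k powr s"
          proof -
            have "a k powr (s - real p) * a k powr real p = a k powr s" using a0[of k] by (simp add: powr_add[symmetric])
            moreover have "0 < a k powr s" "0 < a k powr real p" using a0[of k] by auto
            ultimately show ?thesis unfolding sp(2)[of w] ak[symmetric] by (simp add: field_simps)
          qed
          finally have "real (card (J w)) \<le> C1 * (sv_fun s (word_map T w) / a k powr s)" using hJ(3)[of w] by simp
          then have "a k powr s * real (card (J w)) \<le> C1 * sv_fun s (word_map T w)" using a0[of k] by (simp add: field_simps)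
          also have "\<dots> \<le> exp (\<delta> / 2 * real k) * sv_fun s (word_map T w)" using elim(3) f0 by (intro mult_right_mono) auto
          also have "sv_fun s (word_map T w) = exp (logratio s w) * ?p w"
            using exp_logratio[of s w] s0 cylinder_pos[of w] by simp
          also have "exp (\<delta> / 2 * real k) * (exp (logratio s w) * ?p w) \<le> exp (\<delta> / 2 * real k) * (exp (- \<delta> * real k) * ?p w)"
            using elim(1) by (intro mult_left_mono mult_right_mono) (auto simp: w_def)
          also have "\<dots> = ?p w * e k" by (simp add: e_eq exp_add[symmetric] algebra_simps)
          finally show ?thesis using cardJ[of w] by (simp add: field_simps)
        qed
        ultimately show ?case using mass by simp
      qed
    qed (use a0 projected_mono \<iota> C s0 in auto)
  qed
qed

text \<open>Of order 2^(kN) cubes of side 2^(-k) cover a bounded set, so a fair share is of order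
  2^(-kN). Since s > N, this exceeds 2^(-ks) by an exponential factor, which pays for the
  Borel-Cantelli loss and for the constants.\<close>

lemma ball_mass_ge_dimension:
  assumes M: "\<And>w. w \<noteq> [] \<Longrightarrow> norm (\<omega> w) \<le> M" "0 < M" and s: "real DIM('a) < s"
  shows "AE x in \<mu>. \<exists>A>0. \<forall>\<^sub>F r in at_right 0.
      A * r powr s \<le> measure (projected_measure T \<mu> \<omega>) (cball (code_point T \<omega> x) r)"
proof -
  let ?\<pi> = "code_point T \<omega>" and ?d = "DIM('a)"
  let ?g = "\<lambda>x r. measure (projected_measure T \<mu> \<omega>) (cball (?\<pi> x) r)"
  define R where "R = M / (1 - \<kappa>)"
  have R: "0 < R" using M \<kappa> by (simp add: R_def)
  have bound: "norm (?\<pi> x) \<le> R" for x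
    using code_point_split[OF M(1), where w = "[]" and n = 0 and x = x] by (auto simp: R_def)
  define a :: "nat \<Rightarrow> real" where "a k = (1/2) ^ k" for k
  have a: "0 < a k" "a k \<le> 1" for k by (auto simp: a_def power_le_one)
  define C1 where "C1 = (2 * R + 2) ^ ?d"
  have C1: "0 < C1" using R by (simp add: C1_def)
  define good where "good k h J \<longleftrightarrow> finite J \<and> (\<forall>x. norm x \<le> R \<longrightarrow> h x \<in> J)
     \<and> real (card J) \<le> C1 * (1 / a k) ^ ?d \<and> (\<forall>j. {y. h y = j} \<in> sets borel)
     \<and> (\<forall>x y. h x = h y \<longrightarrow> dist x y \<le> real ?d * a k)" for k and h :: "'a \<Rightarrow> 'a \<Rightarrow> int" and J
  have "\<exists>h J. good k h J" for k unfolding good_def C1_def by (rule cube_partition[OF R a])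
  then obtain h J where good: "\<And>k. good k (h k) (J k)" by metis
  have hJ: "finite (J k)" "norm x \<le> R \<Longrightarrow> h k x \<in> J k" "real (card (J k)) \<le> C1 * (1 / a k) ^ ?d"
    "{y. h k y = j} \<in> sets borel" "h k x = h k y \<Longrightarrow> dist x y \<le> real ?d * a k" for k x y j
    using good[of k] unfolding good_def by blast+
  define P where "P k j = {x. h k (?\<pi> x) = j}" for k j
  have Pm: "P k j \<in> sets \<mu>" for k j
  proof -
    have "?\<pi> -` {y. h k y = j} \<inter> space code_borel \<in> sets code_borel"
      by (rule measurable_sets[OF code_point_measurable hJ(4)])
    then show ?thesis by (simp add: P_def vimage_def)
  qed
  have cardJ: "0 < card (J k)" for k using hJ(1) hJ(2)[of 0 k] R by (auto simp: card_gt_0_iff)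
  define t where "t = s - real ?d"
  have t: "0 < t" using s by (simp add: t_def)
  \<comment> \<open>The surplus \<open>a k powr t\<close> is split into two equal factors
    \<open>b ^ k\<close>: one is the summable loss, the other eventually falls below
    \<open>1 / C1\<close>.\<close>
  define b where "b = (1/2 :: real) powr (t / 2)"
  have b: "0 < b" "b < 1"
    using t powr_less_mono2[of "t / 2" "1/2" "1::real"] by (auto simp: b_def)
  have ab: "a k powr (t / 2) = b ^ k" for k
  proof -
    have "a k powr (t / 2) = ((1/2) powr real k) powr (t / 2)" by (simp add: a_def powr_realpow)
    also have "\<dots> = b powr real k" by (simp only: b_def powr_powr mult.commute)
    also have "\<dots> = b ^ k" using b by (simp add: powr_realpow)
    finally show ?thesis .
  qed
  have "AE x in \<mu>. \<forall>\<^sub>F k in sequentially. \<forall>j\<in>J k. x \<in> P k j \<longrightarrow> 1 / real (card (J k)) * b ^ k \<le> measure \<mu> (P k j)"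
  proof (rule pieces_not_too_small)
    show "summable (\<lambda>k. b ^ k)" using b by (intro summable_geometric) simp
    show "(\<Sum>j\<in>J k. 1 / real (card (J k))) \<le> 1" for k using cardJ[of k] by simp
  qed (use hJ(1) Pm b in auto)
  then show ?thesis
  proof eventually_elim
    case (elim x)
    show ?case
    proof (rule interpolate_radii[where a = a and b = "1/2" and C = "real ?d"])
      show "a \<longlonglongrightarrow> 0" unfolding a_def[abs_def] by (intro LIMSEQ_realpow_zero) auto
      have "(\<lambda>k. b ^ k) \<longlonglongrightarrow> 0" using b by (intro LIMSEQ_realpow_zero) auto
      then have "\<forall>\<^sub>F k in sequentially. b ^ k < 1 / C1" using C1 by (intro order_tendstoD) auto
      with elim show "\<forall>\<^sub>F k in sequentially. a k powr s \<le> ?g x (real ?d * a k)"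
      proof eventually_elim
        case (elim k)
        define j where "j = h k (?\<pi> x)"
        have jJ: "j \<in> J k" unfolding j_def by (rule hJ(2)[OF bound])
        have mass: "1 / real (card (J k)) * b ^ k \<le> measure \<mu> (P k j)" using elim(1) jJ by (auto simp: P_def j_def)
        have "measure \<mu> (P k j) \<le> ?g x (real ?d * a k)"
          by (rule projected_ball_ge[OF Pm]) (auto simp: P_def j_def intro: hJ(5))
        moreover have "a k powr s \<le> 1 / real (card (J k)) * b ^ k"
        proof -
          have "a k powr s = a k powr real ?d * (a k powr (t / 2) * a k powr (t / 2))"
            by (simp add: t_def field_simps flip: powr_add)
          also have "\<dots> = a k ^ ?d * (b ^ k * b ^ k)" using a(1)[of k] by (simp add: ab powr_realpow)
          also have "\<dots> \<le> a k ^ ?d * (1 / C1 * b ^ k)"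
            using elim(2) b a(1)[of k] by (intro mult_left_mono mult_right_mono) auto
          also have "a k ^ ?d * (1 / C1 * b ^ k) = 1 / (C1 * (1 / a k) ^ ?d) * b ^ k" by (simp add: power_one_over field_simps)
          also have "\<dots> \<le> 1 / real (card (J k)) * b ^ k"
            using hJ(3)[of k] cardJ[of k] b by (intro mult_right_mono divide_left_mono) (auto intro!: mult_pos_pos C1 simp: a(1))
          finally show ?thesis .
        qed
        ultimately show ?case using mass by simp
      qed
    qed (use a projected_mono s in \<open>auto simp: a_def\<close>)
  qed
qed

section \<open>Potentials and upper bounds on ball masses\<close>

lemma AE_neq: "AE y in \<mu>. y \<noteq> x"
proof -
  have eq: "{x} = (\<Inter>n. cylinder (initial x n))"
  proof (intro equalityI subsetI)
    fix y assume y: "y \<in> (\<Inter>n. cylinder (initial x n))"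
    have "y i = x i" for i
    proof -
      have "initial y (Suc i) = initial x (Suc i)" using y by (auto simp: mem_cylinder)
      then show ?thesis by (simp add: initial_eq_iff)
    qed
    then show "y \<in> {x}" by auto
  qed (auto simp: mem_cylinder)
  have sets: "{x} \<in> sets \<mu>" unfolding eq by auto
  have "measure \<mu> {x} \<le> \<theta> ^ n" for n
  proof -
    have "measure \<mu> {x} \<le> measure \<mu> (cylinder (initial x n))"
      by (intro finite_measure_mono) (auto simp: mem_cylinder)
    then show ?thesis using cylinder_decay[of "initial x n"] by simp
  qed
  moreover have "(\<lambda>n. \<theta> ^ n) \<longlonglongrightarrow> 0" using theta_bounds by (intro LIMSEQ_realpow_zero) auto
  ultimately have "measure \<mu> {x} \<le> 0" by (intro LIMSEQ_le_const) auto
  then have "{x} \<in> null_sets \<mu>" using sets by (simp add: null_sets_def emeasure_eq_measure measure_le_0_iff)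
  from AE_not_in[OF this] show ?thesis by simp
qed

text \<open>For a fixed typical \<open>x\<close>, Tonelli bounds the expected potential by a
  constant times the sum over n of \<mu>(C_{x|n}) / \<phi>^s(T_{x|n}), that is, of exp(-logratio),
  which decays geometrically when s < d_1. Finite expectation gives finiteness for almost every
  \<omega>, and then the two almost-everywhere quantifiers are exchanged.\<close>

lemma potential_finite:
  assumes P: "prob_space P" and meas: "(\<lambda>\<omega>. \<omega>) \<in> P \<rightarrow>\<^sub>M Pi\<^sub>M UNIV (\<lambda>_. borel)"
    and s: "0 \<le> s" "s < dim_q T \<mu> 1"
    and energy: "\<And>x y. x \<noteq> y \<Longrightarrow> (\<integral>\<^sup>+\<omega>. riesz_kernel s (code_point T \<omega> x - code_point T \<omega> y) \<partial>P)
              \<le> ennreal (C / sv_fun s (word_map T (meet x y)))"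
  shows "AE \<omega> in P. AE x in \<mu>. (\<integral>\<^sup>+y. riesz_kernel s (code_point T \<omega> x - code_point T \<omega> y) \<partial>\<mu>) < \<infinity>"
proof -
  interpret P: prob_space P by fact
  interpret PM: pair_sigma_finite P \<mu> ..
  define K where "K \<omega> x = (\<integral>\<^sup>+y. riesz_kernel s (code_point T \<omega> x - code_point T \<omega> y) \<partial>\<mu>)" for \<omega> x
  note cpm = code_point_measurable_pair[OF meas]
  have "(\<lambda>z. riesz_kernel s (code_point T (fst (fst z)) (snd (fst z)) - code_point T (fst (fst z)) (snd z)))
      \<in> borel_measurable ((P \<Otimes>\<^sub>M \<mu>) \<Otimes>\<^sub>M \<mu>)"
  proof (rule measurable_compose[OF _ riesz_kernel_measurable], rule borel_measurable_diff)
    show "(\<lambda>z. code_point T (fst (fst z)) (snd (fst z))) \<in> borel_measurable ((P \<Otimes>\<^sub>M \<mu>) \<Otimes>\<^sub>M \<mu>)"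
      by (rule measurable_compose[OF measurable_fst cpm])
    have "(\<lambda>z. (fst (fst z), snd z)) \<in> measurable ((P \<Otimes>\<^sub>M \<mu>) \<Otimes>\<^sub>M \<mu>) (P \<Otimes>\<^sub>M \<mu>)" by measurable
    from measurable_compose[OF this cpm]
    show "(\<lambda>z. code_point T (fst (fst z)) (snd z)) \<in> borel_measurable ((P \<Otimes>\<^sub>M \<mu>) \<Otimes>\<^sub>M \<mu>)" by simp
  qed
  then have "(\<lambda>z. \<integral>\<^sup>+y. riesz_kernel s (code_point T (fst z) (snd z) - code_point T (fst z) y) \<partial>\<mu>) \<in> borel_measurable (P \<Otimes>\<^sub>M \<mu>)"
    by (intro borel_measurable_nn_integral) (simp add: split_beta')
  then have Km: "(\<lambda>z. K (fst z) (snd z)) \<in> borel_measurable (P \<Otimes>\<^sub>M \<mu>)" by (simp add: K_def)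
  obtain \<delta> where \<delta>: "0 < \<delta>" "AE x in \<mu>. \<forall>\<^sub>F n in sequentially. \<delta> * real n \<le> logratio s (initial x n)"
    using typical_below[OF s] by blast
  have "AE x in \<mu>. AE \<omega> in P. K \<omega> x < \<infinity>"
    using \<delta>(2)
  proof eventually_elim
    case (elim x)
    \<comment> \<open>The constant in the energy bound may be negative; a nonnegative majorant keeps
      the terms of the series nonnegative.\<close>
    define D where "D = max C 0"
    define u where "u n = D * exp (- logratio s (initial x n))" for n
    have u0: "0 \<le> u n" for n by (simp add: u_def D_def)
    have u_eq: "D / sv_fun s (word_map T (initial x n)) * measure \<mu> (cylinder (initial x n)) = u n" for n
      using exp_logratio[OF s(1), of "initial x n"] cylinder_pos[of "initial x n"]
      by (simp add: u_def exp_minus)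
    have "summable u"
    proof (rule summable_comparison_test_ev)
      show "\<forall>\<^sub>F n in sequentially. norm (u n) \<le> D * exp (- \<delta>) ^ n"
        using elim
      proof eventually_elim
        case (elim n)
        have "exp (- logratio s (initial x n)) \<le> exp (- \<delta> * real n)" using elim by simp
        also have "\<dots> = exp (- \<delta>) ^ n" by (simp add: exp_of_nat_mult[symmetric] mult.commute)
        finally show ?case by (simp add: u_def D_def mult_left_mono)
      qed
      show "summable (\<lambda>n. D * exp (- \<delta>) ^ n)" using \<delta> by (intro summable_mult summable_geometric) simp
    qed
    have hm: "(\<lambda>z. riesz_kernel s (code_point T (fst z) x - code_point T (fst z) (snd z))) \<in> borel_measurable (P \<Otimes>\<^sub>M \<mu>)"
    proof (rule measurable_compose[OF _ riesz_kernel_measurable], rule borel_measurable_diff[OF _ cpm])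
      have "(\<lambda>z. (fst z, x)) \<in> measurable (P \<Otimes>\<^sub>M \<mu>) (P \<Otimes>\<^sub>M \<mu>)" by measurable
      from measurable_compose[OF this cpm]
      show "(\<lambda>z. code_point T (fst z) x) \<in> borel_measurable (P \<Otimes>\<^sub>M \<mu>)" by simp
    qed
    have "(\<integral>\<^sup>+\<omega>. K \<omega> x \<partial>P) = (\<integral>\<^sup>+y. \<integral>\<^sup>+\<omega>. riesz_kernel s (code_point T \<omega> x - code_point T \<omega> y) \<partial>P \<partial>\<mu>)"
      unfolding K_def using hm by (intro PM.Fubini'[symmetric]) (simp add: split_beta')
    \<comment> \<open>The diagonal is null because \<open>\<mu>\<close> has no atoms. Every other
      \<open>y\<close> lies in the cylinder of its common beginning with \<open>x\<close>, so a
      single term of the series already dominates.\<close>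
    also have "\<dots> \<le> (\<integral>\<^sup>+y. (\<Sum>n. ennreal (D / sv_fun s (word_map T (initial x n))) * indicator (cylinder (initial x n)) y) \<partial>\<mu>)"
    proof (rule nn_integral_mono_AE, rule AE_mp[OF AE_neq[of x]], intro AE_I2 impI)
      fix y assume ne: "y \<noteq> x"
      define n where "n = (LEAST n. x n \<noteq> y n)"
      have n: "meet x y = initial x n" by (simp add: meet_def n_def)
      have "x i = y i" if "i < n" for i using not_less_Least[of i "\<lambda>n. x n \<noteq> y n"] that by (auto simp: n_def)
      then have yc: "y \<in> cylinder (initial x n)" by (simp add: mem_cylinder initial_eq_iff)
      have "(\<integral>\<^sup>+\<omega>. riesz_kernel s (code_point T \<omega> x - code_point T \<omega> y) \<partial>P) \<le> ennreal (C / sv_fun s (word_map T (initial x n)))"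
        using energy[of x y] ne n by simp
      also have "\<dots> \<le> ennreal (D / sv_fun s (word_map T (initial x n)))"
        using sv_word_fun_pos[OF s(1), of "initial x n"] by (intro ennreal_leI divide_right_mono) (auto simp: D_def)
      also have "\<dots> = (\<Sum>k\<in>{n}. ennreal (D / sv_fun s (word_map T (initial x k))) * indicator (cylinder (initial x k)) y)"
        using yc by simp
      also have "\<dots> \<le> (\<Sum>k. ennreal (D / sv_fun s (word_map T (initial x k))) * indicator (cylinder (initial x k)) y)"
        by (intro sum_le_suminf) auto
      finally show "(\<integral>\<^sup>+\<omega>. riesz_kernel s (code_point T \<omega> x - code_point T \<omega> y) \<partial>P)
         \<le> (\<Sum>n. ennreal (D / sv_fun s (word_map T (initial x n))) * indicator (cylinder (initial x n)) y)" .
    qed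
    also have "\<dots> = (\<Sum>n. \<integral>\<^sup>+y. ennreal (D / sv_fun s (word_map T (initial x n))) * indicator (cylinder (initial x n)) y \<partial>\<mu>)"
      by (intro nn_integral_suminf) measurable
    also have "\<dots> = (\<Sum>n. ennreal (u n))"
    proof (intro suminf_cong)
      fix n
      have "0 \<le> D / sv_fun s (word_map T (initial x n))"
        using sv_word_fun_pos[OF s(1), of "initial x n"] by (simp add: D_def)
      moreover have "(\<integral>\<^sup>+y. ennreal (D / sv_fun s (word_map T (initial x n))) * indicator (cylinder (initial x n)) y \<partial>\<mu>)
          = ennreal (D / sv_fun s (word_map T (initial x n))) * ennreal (measure \<mu> (cylinder (initial x n)))"
        by (subst nn_integral_cmult_indicator) (simp_all add: emeasure_eq_measure)
      ultimately show "(\<integral>\<^sup>+y. ennreal (D / sv_fun s (word_map T (initial x n))) * indicator (cylinder (initial x n)) y \<partial>\<mu>) = ennreal (u n)"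
        by (simp only: u_eq flip: ennreal_mult')
    qed
    also have "\<dots> < \<infinity>" using ennreal_suminf_neq_top[OF \<open>summable u\<close> u0] by (simp add: less_top)
    finally have fin: "(\<integral>\<^sup>+\<omega>. K \<omega> x \<partial>P) \<noteq> \<infinity>" by simp
    have "(\<lambda>\<omega>. K \<omega> x) \<in> borel_measurable P"
    proof -
      have "(\<lambda>\<omega>. (\<omega>, x)) \<in> measurable P (P \<Otimes>\<^sub>M \<mu>)" by measurable
      from measurable_compose[OF this Km] show ?thesis by simp
    qed
    from nn_integral_PInf_AE[OF this fin] show ?case by (simp add: less_top)
  qed
  \<comment> \<open>Exchanging the quantifiers requires the exceptional set to be measurable in the
    product.\<close>
  moreover have "{z \<in> space (P \<Otimes>\<^sub>M \<mu>). K (fst z) (snd z) < \<infinity>} \<in> sets (P \<Otimes>\<^sub>M \<mu>)" using Km by measurable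
  ultimately have "AE \<omega> in P. AE x in \<mu>. K \<omega> x < \<infinity>" using PM.AE_commute[of "\<lambda>\<omega> x. K \<omega> x < \<infinity>"] by simp
  then show ?thesis by (simp add: K_def)
qed

text \<open>Markov's inequality: the kernel is at least \<open>r powr - s\<close> on the ball, so
  the potential bounds the mass of every ball around the same centre with one constant.\<close>

lemma ball_mass_le_potential:
  assumes s: "0 \<le> s" and fin: "(\<integral>\<^sup>+y. riesz_kernel s (code_point T \<omega> x - code_point T \<omega> y) \<partial>\<mu>) < \<infinity>"
  shows "\<exists>K\<ge>0. \<forall>r>0. measure (projected_measure T \<mu> \<omega>) (cball (code_point T \<omega> x) r) \<le> K * r powr s"
proof -
  let ?I = "\<integral>\<^sup>+y. riesz_kernel s (code_point T \<omega> x - code_point T \<omega> y) \<partial>\<mu>"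
  define K where "K = enn2real ?I"
  have K: "?I = ennreal K" using fin by (simp add: K_def less_top)
  have "measure (projected_measure T \<mu> \<omega>) (cball (code_point T \<omega> x) r) \<le> K * r powr s" if r: "0 < r" for r
  proof -
    let ?A = "{y. code_point T \<omega> y \<in> cball (code_point T \<omega> x) r}"
    have "code_point T \<omega> -` cball (code_point T \<omega> x) r \<inter> space code_borel \<in> sets code_borel"
      by (rule measurable_sets[OF code_point_measurable]) simp
    then have A: "?A \<in> sets \<mu>" by (simp add: vimage_def)
    have rs: "0 < r powr s" using r by simp
    have "inverse (ennreal (r powr s)) * emeasure \<mu> ?A = (\<integral>\<^sup>+y. inverse (ennreal (r powr s)) * indicator ?A y \<partial>\<mu>)"
      using A by (rule nn_integral_cmult_indicator[symmetric])
    also have "\<dots> \<le> ?I"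
      using riesz_kernel_ge[OF s _ r] by (intro nn_integral_mono) (auto simp: indicator_def dist_norm)
    finally have "inverse (ennreal (r powr s)) * emeasure \<mu> ?A \<le> ennreal K" using K by simp
    then have "ennreal (inverse (r powr s) * measure \<mu> ?A) \<le> ennreal K"
      using rs by (simp add: inverse_ennreal emeasure_eq_measure ennreal_mult'')
    then have "inverse (r powr s) * measure \<mu> ?A \<le> K" by (simp add: K_def)
    then have "measure \<mu> ?A \<le> K * r powr s" using rs by (simp add: field_simps)
    then show ?thesis by (simp add: measure_projected)
  qed
  moreover have "0 \<le> K" by (simp add: K_def)
  ultimately show ?thesis by blast
qed

section \<open>From typical sequences to typical points\<close>

text \<open>The mass of a ball is the measure of a section of the closed set of pairs at distance at
  most \<open>r\<close>, hence measurable in the centre.\<close>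

lemma projected_ball_measurable:
  "(\<lambda>z. measure (projected_measure T \<mu> \<omega>) (cball z r)) \<in> borel_measurable borel"
proof -
  have "code_point T \<omega> \<in> borel_measurable \<mu>"
    using code_point_measurable by (simp only: measurable_cong_sets[OF sets_mu refl])
  then interpret D: prob_space "projected_measure T \<mu> \<omega>"
    unfolding projected_measure_def by (rule prob_space_distr)
  have sD: "sets (projected_measure T \<mu> \<omega>) = sets borel" by (simp add: projected_measure_def)
  have "closed {z :: 'a \<times> 'a. dist (fst z) (snd z) \<le> r}"
    by (intro closed_Collect_le continuous_intros)
  then have "{z :: 'a \<times> 'a. dist (fst z) (snd z) \<le> r} \<in> sets (borel \<Otimes>\<^sub>M projected_measure T \<mu> \<omega>)"
    unfolding sets_pair_measure_cong[OF refl sD] borel_prod by (rule borel_closed)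
  from D.measurable_emeasure_Pair[OF this]
  have "(\<lambda>z. emeasure (projected_measure T \<mu> \<omega>) (cball z r)) \<in> borel_measurable borel"
    by (simp add: vimage_def cball_def)
  then show ?thesis unfolding measure_def by measurable
qed

lemma local_dimension:
  assumes M: "\<And>w. w \<noteq> [] \<Longrightarrow> norm (\<omega> w) \<le> M" "0 < M"
  defines "m \<equiv> min (dim_q T \<mu> 1) (real DIM('a))"
  assumes pot: "\<And>j::nat. \<exists>s\<ge>0. m - 1 / (real j + 1) < s \<and>
     (AE x in \<mu>. (\<integral>\<^sup>+y. riesz_kernel s (code_point T \<omega> x - code_point T \<omega> y) \<partial>\<mu>) < \<infinity>)"
  shows "AE z in projected_measure T \<mu> \<omega>.
    ((\<lambda>r. ln (measure (projected_measure T \<mu> \<omega>) (cball z r)) / ln r) \<longlongrightarrow> m) (at_right 0)"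
proof -
  let ?\<pi> = "code_point T \<omega>"
  let ?g = "\<lambda>z r. measure (projected_measure T \<mu> \<omega>) (cball z r)"
  have m0: "0 < m" using dim_q_root(1)[of 1] by (simp add: m_def)
  \<comment> \<open>An almost sure property passes from \<open>\<mu>\<close> to its image only
    through a measurable set of points; unlike the existence of a limit, \<open>Q\<close> is visibly
    a countable combination of measurable conditions.\<close>
  define Q where "Q z \<longleftrightarrow> (\<forall>j::nat. \<exists>i::nat. \<forall>n\<ge>i. ((1/2) ^ n) powr (m + 1 / (real j + 1)) \<le> (real i + 1) * ?g z ((1/2) ^ n)
       \<and> ?g z ((1/2) ^ n) \<le> (real i + 1) * ((1/2) ^ n) powr (m - 1 / (real j + 1)))" for z
  have up: "AE x in \<mu>. \<forall>j::nat. \<exists>A>0. \<forall>\<^sub>F r in at_right 0. A * r powr (m + 1 / (real j + 1)) \<le> ?g (?\<pi> x) r"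
  proof (subst AE_all_countable, rule allI)
    fix j :: nat
    let ?s = "m + 1 / (real j + 1)"
    have sm: "m < ?s" by simp
    show "AE x in \<mu>. \<exists>A>0. \<forall>\<^sub>F r in at_right 0. A * r powr ?s \<le> ?g (?\<pi> x) r"
    proof (cases "real DIM('a) < ?s")
      case True
      show ?thesis by (rule ball_mass_ge_dimension[OF M(1) M(2) True])
    next
      case False
      \<comment> \<open>If the exponent just above \<open>m\<close> is still at most the dimension,
        then \<open>m\<close> must be d_1, and the argument with ellipsoids applies.\<close>
      then have "m \<noteq> real DIM('a)" using sm by auto
      moreover have "m = dim_q T \<mu> 1 \<or> m = real DIM('a)" by (auto simp: m_def min_def)
      ultimately have "dim_q T \<mu> 1 = m" by simp
      then show ?thesis using sm False by (intro ball_mass_ge_entropy[OF M]) simp_all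
    qed
  qed
  have "\<forall>j::nat. \<exists>s. 0 \<le> s \<and> m - 1 / (real j + 1) < s \<and>
     (AE x in \<mu>. (\<integral>\<^sup>+y. riesz_kernel s (code_point T \<omega> x - code_point T \<omega> y) \<partial>\<mu>) < \<infinity>)"
    using pot by blast
  then obtain s where s: "\<And>j::nat. 0 \<le> s j" "\<And>j::nat. m - 1 / (real j + 1) < s j"
    "\<And>j::nat. AE x in \<mu>. (\<integral>\<^sup>+y. riesz_kernel (s j) (code_point T \<omega> x - code_point T \<omega> y) \<partial>\<mu>) < \<infinity>"
    by metis
  have lo: "AE x in \<mu>. \<forall>j::nat. (\<integral>\<^sup>+y. riesz_kernel (s j) (code_point T \<omega> x - code_point T \<omega> y) \<partial>\<mu>) < \<infinity>"
    using s(3) by (subst AE_all_countable) blast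
  from up lo have AEQ: "AE x in \<mu>. Q (?\<pi> x)"
  proof eventually_elim
    case (elim x)
    show ?case unfolding Q_def
    proof
      fix j :: nat
      obtain A where A: "A > 0" "\<forall>\<^sub>F r in at_right 0. A * r powr (m + 1 / (real j + 1)) \<le> ?g (?\<pi> x) r"
        using elim(1) by blast
      obtain K where K: "\<And>r. r > 0 \<Longrightarrow> ?g (?\<pi> x) r \<le> K * r powr s j" "K \<ge> 0"
        using ball_mass_le_potential[OF s(1)[of j]] elim(2) by blast
      have "filterlim (\<lambda>n. (1/2 :: real) ^ n) (at_right 0) sequentially"
        unfolding filterlim_at by (auto intro!: LIMSEQ_realpow_zero)
      then have "\<forall>\<^sub>F n in sequentially. A * ((1/2) ^ n) powr (m + 1 / (real j + 1)) \<le> ?g (?\<pi> x) ((1/2) ^ n)"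
        by (rule eventually_compose_filterlim[OF A(2)])
      then obtain n0 where n0: "\<And>n. n0 \<le> n \<Longrightarrow> A * ((1/2) ^ n) powr (m + 1 / (real j + 1)) \<le> ?g (?\<pi> x) ((1/2) ^ n)"
        by (auto simp: eventually_sequentially)
      obtain i0 :: nat where i0: "max (1 / A) K < real i0" using reals_Archimedean2 by blast
      \<comment> \<open>One index dominates the threshold for the radii and both constants, as
        \<open>Q\<close> demands.\<close>
      define i where "i = max n0 i0"
      have i: "n0 \<le> i" "1 / A \<le> real i + 1" "K \<le> real i + 1" using i0 by (auto simp: i_def)
      show "\<exists>i::nat. \<forall>n\<ge>i. ((1/2) ^ n) powr (m + 1 / (real j + 1)) \<le> (real i + 1) * ?g (?\<pi> x) ((1/2) ^ n)
       \<and> ?g (?\<pi> x) ((1/2) ^ n) \<le> (real i + 1) * ((1/2) ^ n) powr (m - 1 / (real j + 1))"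
      proof (intro exI[of _ i] allI impI conjI)
        fix n assume n: "i \<le> n"
        have "((1/2) ^ n) powr (m + 1 / (real j + 1)) = (1 / A) * (A * ((1/2) ^ n) powr (m + 1 / (real j + 1)))"
          using A(1) by simp
        also have "\<dots> \<le> (1 / A) * ?g (?\<pi> x) ((1/2) ^ n)" using n0[of n] n i A(1) by (intro mult_left_mono) auto
        also have "\<dots> \<le> (real i + 1) * ?g (?\<pi> x) ((1/2) ^ n)" using i(2) by (intro mult_right_mono) auto
        finally show "((1/2) ^ n) powr (m + 1 / (real j + 1)) \<le> (real i + 1) * ?g (?\<pi> x) ((1/2) ^ n)" .
        have "?g (?\<pi> x) ((1/2) ^ n) \<le> K * ((1/2) ^ n) powr s j" by (rule K(1)) simp
        also have "\<dots> \<le> (real i + 1) * ((1/2) ^ n) powr (m - 1 / (real j + 1))"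
          using i(3) K(2) s(2)[of j] by (intro mult_mono powr_mono') (auto simp: power_le_one)
        finally show "?g (?\<pi> x) ((1/2) ^ n) \<le> (real i + 1) * ((1/2) ^ n) powr (m - 1 / (real j + 1))" .
      qed
    qed
  qed
  have "{z \<in> space borel. Q z} \<in> sets borel"
    unfolding Q_def using projected_ball_measurable by measurable
  then have "AE z in projected_measure T \<mu> \<omega>. Q z"
    unfolding projected_measure_def using AEQ code_point_measurable
    by (subst AE_distr_iff) (simp_all only: measurable_cong_sets[OF sets_mu refl])
  then show ?thesis
  proof (rule AE_mp, intro AE_I2 impI)
    fix z assume "Q z"
    then show "((\<lambda>r. ln (?g z r) / ln r) \<longlongrightarrow> m) (at_right 0)"
      unfolding Q_def by (intro local_dimension_tendsto projected_mono m0) auto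
  qed
qed

end

theorem theorem7p2:
  fixes T :: "'m::finite \<Rightarrow> real^'n \<Rightarrow> real^'n"
    and \<mu> :: "(nat \<Rightarrow> 'm) measure"
    and \<P> :: "('m list \<Rightarrow> real^'n) measure"
  assumes m: "CARD('m) \<ge> 2"
    and T: "\<And>i. nonsingular_contraction (T i)"
    and gibbs: "gibbs_measure \<mu>"
    and inv: "shift_invariant \<mu>"
    and prob: "prob_space \<P>"
    and joint_measurable: "(\<lambda>\<omega>. \<omega>) \<in> \<P> \<rightarrow>\<^sub>M Pi\<^sub>M UNIV (\<lambda>_. borel)"
    and trapping: "\<exists>B. compact B \<and> B \<noteq> {} \<and>
          (\<forall>\<omega>\<in>space \<P>. \<forall>w. w \<noteq> [] \<longrightarrow> (\<lambda>y. T (last w) y + \<omega> w) ` B \<subseteq> B)"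
    and energy: "\<And>\<epsilon>. \<epsilon> > 0 \<Longrightarrow> \<exists>s. 0 \<le> s \<and> s < min (dim_q T \<mu> 1) (real CARD('n)) \<and>
          min (dim_q T \<mu> 1) (real CARD('n)) - \<epsilon> < s \<and>
          (\<exists>c::real. \<forall>x y. x \<noteq> y \<longrightarrow>
            (\<integral>\<^sup>+\<omega>. riesz_kernel s (code_point T \<omega> x - code_point T \<omega> y) \<partial>\<P>)
              \<le> ennreal (c / sv_fun s (word_map T (meet x y))))"
  shows "AE \<omega> in \<P>. AE x in projected_measure T \<mu> \<omega>.
           \<exists>L. ((\<lambda>r. ln (measure (projected_measure T \<mu> \<omega>) (cball x r)) / ln r) \<longlongrightarrow> L) (at_right 0)
             \<and> min (dim_q T \<mu> 1) (real CARD('n)) \<le> L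
             \<and> L \<le> min (Lim (at_left 1) (dim_q T \<mu>)) (real CARD('n))"
proof -
  obtain c where "quasi_bernoulli \<mu> c" using gibbs_imp_quasi_bernoulli[OF gibbs inv] by blast
  then interpret quasi_bernoulli \<mu> c .
  obtain \<kappa> \<iota> where contr: "0 < \<kappa>" "\<kappa> < 1" "0 < \<iota>" "\<iota> < 1"
    "\<And>i v. norm (T i v) \<le> \<kappa> * norm v" "\<And>i v. \<iota> * norm v \<le> norm (T i v)"
    using uniform_contraction_bounds[of T, OF T] by blast
  have lin: "linear (T i)" "bij (T i)" for i using T[of i] by (simp_all add: nonsingular_contraction_def)
  interpret self_affine \<mu> c T \<kappa> \<iota>
    by unfold_locales (rule linear_add[OF lin(1)] linear_scale[OF lin(1)] lin(2) contr m)+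
  define d where "d = min (dim_q T \<mu> 1) (real CARD('n))"
  have dDIM: "d = min (dim_q T \<mu> 1) (real DIM(real^'n))" by (simp add: d_def)
  obtain B where B: "compact B" "B \<noteq> {}"
    "\<forall>\<omega>\<in>space \<P>. \<forall>w. w \<noteq> [] \<longrightarrow> (\<lambda>y. T (last w) y + \<omega> w) ` B \<subseteq> B"
    using trapping by (elim exE conjE) (rule that)
  obtain b where b: "\<And>y. y \<in> B \<Longrightarrow> norm y \<le> b" using compact_imp_bounded[OF B(1)] bounded_iff by blast
  obtain y0 where y0: "y0 \<in> B" using B(2) by blast
  \<comment> \<open>Writing \<open>\<omega> w\<close> as the difference of
    \<open>T (last w) y0 + \<omega> w\<close>, which lies in \<open>B\<close>, and
    \<open>T (last w) y0\<close> bounds it by \<open>2 * b\<close>; the added 1 makes the bound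
    positive.\<close>
  define M where "M = 2 * b + 1"
  have b0: "0 \<le> b" using b[OF y0] norm_ge_zero order_trans by blast
  have M0: "0 < M" using b0 by (simp add: M_def)
  have M: "norm (\<omega> w) \<le> M" if "\<omega> \<in> space \<P>" "w \<noteq> []" for \<omega> w
  proof -
    have "(\<lambda>y. T (last w) y + \<omega> w) ` B \<subseteq> B" using B(3) that by simp
    then have "norm (T (last w) y0 + \<omega> w) \<le> b" using y0 by (intro b) (simp add: image_subset_iff)
    moreover have "norm (T (last w) y0) \<le> norm y0"
      using contr(1,2) contr(5)[of "last w" y0] mult_right_mono[of \<kappa> 1 "norm y0"] by simp
    moreover have "norm (\<omega> w) \<le> norm (T (last w) y0 + \<omega> w) + norm (T (last w) y0)"
      using norm_triangle_ineq4[of "T (last w) y0 + \<omega> w" "T (last w) y0"] by simp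
    ultimately show ?thesis using b[OF y0] by (simp add: M_def)
  qed
  \<comment> \<open>The energy estimate is available along a sequence of exponents approaching
    \<open>d\<close>; being countably many, they share one exceptional null set.\<close>
  have "AE \<omega> in \<P>. \<forall>j::nat. \<exists>s\<ge>0. d - 1 / (real j + 1) < s \<and>
     (AE x in \<mu>. (\<integral>\<^sup>+y. riesz_kernel s (code_point T \<omega> x - code_point T \<omega> y) \<partial>\<mu>) < \<infinity>)"
  proof (subst AE_all_countable, rule allI)
    fix j :: nat
    obtain s C where s: "0 \<le> s" "s < d" "d - 1 / (real j + 1) < s"
      "\<And>x y. x \<noteq> y \<Longrightarrow> (\<integral>\<^sup>+\<omega>. riesz_kernel s (code_point T \<omega> x - code_point T \<omega> y) \<partial>\<P>)
              \<le> ennreal (C / sv_fun s (word_map T (meet x y)))"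
      using energy[of "1 / (real j + 1)"] unfolding d_def[symmetric] by auto
    have "s < dim_q T \<mu> 1" using s(2) by (simp add: d_def)
    then have "AE \<omega> in \<P>. AE x in \<mu>. (\<integral>\<^sup>+y. riesz_kernel s (code_point T \<omega> x - code_point T \<omega> y) \<partial>\<mu>) < \<infinity>"
      using s(4) by (rule potential_finite[OF prob joint_measurable s(1)])
    then show "AE \<omega> in \<P>. \<exists>s\<ge>0. d - 1 / (real j + 1) < s \<and>
     (AE x in \<mu>. (\<integral>\<^sup>+y. riesz_kernel s (code_point T \<omega> x - code_point T \<omega> y) \<partial>\<mu>) < \<infinity>)"
      by eventually_elim (use s in blast)
  qed
  with AE_space[of \<P>] show ?thesis
  proof eventually_elim
    case (elim \<omega>)
    have "AE z in projected_measure T \<mu> \<omega>.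
      ((\<lambda>r. ln (measure (projected_measure T \<mu> \<omega>) (cball z r)) / ln r) \<longlongrightarrow> d) (at_right 0)"
      unfolding dDIM
    proof (rule local_dimension)
      show "norm (\<omega> w) \<le> M" if "w \<noteq> []" for w by (rule M[OF elim(1) that])
      show "0 < M" by (rule M0)
    qed (use elim(2) in \<open>simp only: dDIM\<close>)
    \<comment> \<open>The limit \<open>d\<close> itself is the witness: the first inequality is an
      equality, and the second is \<open>dim_1_le_Lim\<close>.\<close>
    then show ?case
      by eventually_elim (use dim_1_le_Lim in \<open>auto simp: d_def intro!: exI[of _ d]\<close>)
  qed
qed

end
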